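(* Let $L\subset J^1M$ be a Legendrian surface with Maslov potential $\mu$ and compatible polygonal decomposition $\mathcal{E}$. For any $\rho\mid m(L)$, there is a bijection between $\rho$-graded augmentations (to $\mathbb{Z}/2$) of the Cellular DGA of $(L,\mathcal{E})$ and $\rho$-graded Chain Homotopy Diagrams for $(L,\mathcal{E})$.
   Context: **Setting.** $M$ is a smooth surface, $J^1M=T^*M\times\mathbb{R}_z$ with contact structure $\ker(dz-y\,dx)$; $\Pi_F:J^1M\to M\times\mathbb{R}$ is the front projection and $\Pi_B:J^1M\to M$ the base projection. $L\subset J^1M$ is a closed Legendrian surface with generic front and base projections: the singularities of $\Pi_F(L)$ are crossing arcs, (semicubical) cusp edges, triple points, transverse intersections of a cusp edge with another sheet, and swallowtail points (where two cusp edges and one crossing arc end); crossing/cusp arcs disjoint in the front meet transversally in the base. $\Sigma_{cusp},\Sigma_{st}\subset L$ are the sets of cusp and swallowtail points, and $\Sigma\subset M$ is the base projection of the union of all cusp, swallowtail and crossing points. Near a swallowtail point, the swallowtail region is the part of $M$ between the two cusp edges above which the cusping sheets exist. Sheets are numbered by descending $z$-coordinate. If $L$ has $n$ sheets above the swallowtail region (and $n-2$ outside), let $S_k,S_{k+1},S_{k+2}$ be those meeting at the swallowtail point. The point is upward if $S_{k+1},S_{k+2}$ are the crossing sheets (at the cusp edges $S_k,S_{k+1}$ meet), and downward if $S_k,S_{k+1}$ are the crossing sheets (at the cusp edges $S_{k+1},S_{k+2}$ meet). **Maslov data.** For a generic loop $\gamma\subset L$ let $m(\gamma)=D(\gamma)-U(\gamma)$,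 where $D$ (resp. $U$) counts downward (resp. upward) crossings of cusp edges; $m(L)\ge 0$ is the non-negative generator of the image of $m:H_1(L;\mathbb{Z})\to\mathbb{Z}$. A Maslov potential is a locally constant $\mu:L\setminus(\Sigma_{cusp}\cup\Sigma_{st})\to\mathbb{Z}/m(L)$ increasing by $1$ from the lower to the upper sheet at each cusp edge. **Linear algebra over $\mathbb{Z}/2$.** For $V$ with basis $\{v_p\}$ partially ordered by $\prec$, $\langle\cdot,\cdot\rangle$ is the bilinear form with $\langle v_p,v_q\rangle=\delta_{p,q}$. A linear map $T$ is strictly upper triangular if $\langle Tv_q,v_p\rangle\neq 0$ implies $v_p\prec v_q$. The handleslide map is $h_{u,l}(v_k)=v_k+\delta_{k,l}v_u$. An ordered complex is such a $V$ with a strictly upper triangular differential. $E_{i,j}$ is the matrix with a single $1$ in entry $(i,j)$. **Compatible polygonal decomposition $\mathcal{E}$.** A polygonal cell decomposition of $\Pi_B(L)$ containing $\Sigma$ in its $1$-skeleton, with: an orientation of each $1$-cell; for each $2$-cell, a choice of initial and terminal vertices $v_0,v_1$ in the domain of its characteristic map (and, if $v_0=v_1$, a direction for the path around the circle from $v_0$ to $v_1$); at each swallowtail point, a labeling by $S$ and $T$ of the two corners in the swallowtail region bordering the crossing locus. Near swallowtail points the $1$-skeleton is assumed to agree with $\Sigma$ with the three $1$-cells oriented away from the swallowtail point. At a swallowtail point $e^0_{st}$: $e^1_{cr}$ is the $1$-cell in the crossing locus, $e^2_S,e^2_T$ are the $2$-cells containing the corners $S,T$, and $e^1_S,e^1_T$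 are the $1$-cells below the cusp edges bordering those corners. $L(e^d_\alpha)$ is the set of components of $\Pi_B^{-1}(e^d_\alpha)\cap(L\setminus\Sigma_{cusp})$ (a swallowtail point above a $0$-cell counts as a sheet), partially ordered by $S_p\prec S_q\Leftrightarrow z(S_p)>z(S_q)$ pointwise (sheets are incomparable exactly when they cross above the cell). $V(e^d_\alpha)$ is the $\mathbb{Z}/2$-span of $L(e^d_\alpha)$, graded by $|S_p|=\mu(S_p)$. **Cellular DGA and augmentations.** $\mathcal{A}$ is the free associative unital $\mathbb{Z}/2$-algebra with one generator for each cell and each pair $S_p\prec S_q$ in $L(e^d_\alpha)$, denoted $a^\alpha_{p,q},b^\alpha_{p,q},c^\alpha_{p,q}$ for $d=0,1,2$, of degree $\mu(S_p)-\mu(S_q)-1$, $\mu(S_p)-\mu(S_q)$, $\mu(S_p)-\mu(S_q)+1$ respectively. For each cell choose a total order of its sheets refining $\prec$ and arrange generators in strictly upper triangular matrices $A,B,C$ (entries for crossing pairs are $0$). If a cell $e'$ lies on the boundary of $e$, its boundary matrix has size $\#L(e)$: generators of $e'$ are placed in the rows/columns of the sheets of $L(e)$ whose closures contain the sheets of $L(e')$, and for each pair of sheets of $L(e)$ cusping above $e'$ one inserts a block $\left[\begin{smallmatrix}0&1\\0&0\end{smallmatrix}\right]$ if $e'$ is a $0$-cell and the zero block if $e'$ is a $1$-cell. Then entrywise $\partial A=A^2$, $\partial B=A_+(I+B)+(I+B)A_-$, and $\partial C=A_{v_1}C+CA_{v_0}+(I+B_j)^{\eta_j}\cdots(I+B_1)^{\eta_1}+(I+B_m)^{\eta_m}\cdots(I+B_{j+1})^{\eta_{j+1}}$,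 where $A_\pm$ are the boundary matrices of the terminal/initial vertex, $B_1,\dots,B_j$ and $B_{j+1},\dots,B_m$ those of the edges met along the two boundary paths from $v_0$ to $v_1$, and $\eta_i=\pm1$ according to whether the edge orientation agrees with the path. At an upward swallowtail (matrix $A$ at $e^0_{st}$, $\widehat A_{i,j}$ denoting $A$ enlarged by the block $\left[\begin{smallmatrix}0&1\\0&0\end{smallmatrix}\right]$ in rows and columns $i,j$): set $A_S=(I+E_{k+2,k+1})\widehat A_{k,k+2}(I+E_{k+2,k+1})$, $A_T=(I+E_{k+1,k+2})\widehat A_{k,k+1}(I+E_{k+1,k+2})$, and matrices $S=I+\sum_{i<k}a_{i,k}E_{i,k}+E_{k+1,k+2}$, $T=I+E_{k+1,k+2}$. The boundary matrix of $e^0_{st}$ for $e^2_S$ (resp. $e^2_T$), and for $e^1_{cr}$ when its chosen sheet order agrees with that of $e^2_S$ (resp. $e^2_T$), is $A_S$ (resp. $A_T$); in $\partial C$ for $e^2_X$, $X\in\{S,T\}$, the factor $I+B_i$ of $e^1_X$ is replaced by $(I+B_i)X$. Downward swallowtails are the vertical reflection: $A_S=(I+E_{k+1,k})\widehat A_{k,k+2}(I+E_{k+1,k})$, $A_T=(I+E_{k,k+1})\widehat A_{k+1,k+2}(I+E_{k,k+1})$, $S=I+\sum_{j>k}a_{k,j}E_{k+2,j+2}+E_{k,k+1}$, $T=I+E_{k,k+1}$. An augmentation is a unital algebra map $\epsilon:\mathcal{A}\to\mathbb{Z}/2$ with $\epsilon\circ\partial=0$; it is $\rho$-graded if $\epsilon(a)\ne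 0$ for a generator $a$ implies $|a|=0$ mod $\rho$. **Boundary differentials and boundary morphisms.** If $e^0_\beta$ is a vertex of $e^d_\alpha$ ($d=1,2$), then $V(e^d_\alpha)=V(e^0_\beta)\oplus V_{cusp}$, with $V(e^0_\beta)$ included by sending a sheet to the sheet whose closure contains it, and $V_{cusp}$ spanned by sheets meeting in pairs at cusps above $e^0_\beta$. Given a differential $d_\beta$ on $V(e^0_\beta)$, the boundary differential is $\widehat d_\beta=d_\beta\oplus d_{cusp}$ with $d_{cusp}S_b=S_a$ for $S_b$ the lower and $S_a$ the upper sheet of a cusping pair. For a $1$-cell $e^1_\beta$ on the boundary of $e^2_\alpha$ and $f:V(e^1_\beta)\to V(e^1_\beta)$, the boundary morphism is $\widehat f=f\oplus\mathrm{id}$ on $V(e^2_\alpha)=V(e^1_\beta)\oplus V_{cusp}$. Exceptions at an upward swallowtail $e^0_{st}$ with differential $d_0$ on $V(e^0_{st})$ (sheets $S^0_1,\dots,S^0_{n-2}$): (i) on $V(e^2_T)$, $\widehat d_T=h_{k+1,k+2}\,d_{k,k+1}\,h_{k+1,k+2}$, where $d_{k,k+1}$ equals $d_0$ on $\mathrm{Span}\{S_i:i\ne k,k+1\}\cong V(e^0_{st})$ (order-preserving) and $d_{k,k+1}S_{k+1}=S_k$; the boundary differentials on $V(e^1_{cr})$ and $V(e^2_S)$ are transported from $\widehat d_T$ by the bijections $L(e^2_S)\cong L(e^1_{cr})\cong L(e^2_T)$ identifying sheets whose closures meet above $e^1_{cr}$; for $e^1_S$, $e^1_T$ and neighboring cells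 outside the swallowtail region use the bijection with $L(e^0_{st})$. (ii) The boundary morphism for $e^1_X$ in $e^2_X$ ($X\in\{S,T\}$) is $\widehat f=(f\oplus\mathrm{id})\circ H_X$, with $H_T=h_{k+1,k+2}$ and $H_S=\big(\prod_{i:\langle d_0S^0_k,S^0_i\rangle\ne0}h_{i,k}\big)h_{k+1,k+2}$. Downward case (vertical reflection): $\widehat d_T=h_{k,k+1}d_{k+1,k+2}h_{k,k+1}$, $H_T=h_{k,k+1}$, $H_S=\big(\prod_{j:\langle d_0S^0_j,S^0_k\rangle\ne0}h_{k+2,j+2}\big)h_{k,k+1}$. **Chain homotopy diagram (CHD)** for $(L,\mathcal{E})$: a triple $(\{d_\alpha\},\{f_\beta\},\{K_\gamma\})$ with (1) for each $0$-cell, a differential $d_\alpha$ making $V(e^0_\alpha)$ an ordered complex; (2) for each $1$-cell, a chain map $f_\beta:(V(e^1_\beta),\widehat d_-)\to(V(e^1_\beta),\widehat d_+)$ with $f_\beta-\mathrm{id}$ strictly upper triangular, $\widehat d_\mp$ being the boundary differentials of the initial/terminal vertices; (3) for each $2$-cell, a strictly upper triangular chain homotopy $K_\gamma:(V(e^2_\gamma),\widehat d_{v_0})\to(V(e^2_\gamma),\widehat d_{v_1})$ between $\widehat f_j^{\eta_j}\circ\cdots\circ\widehat f_1^{\eta_1}$ and $\widehat f_m^{\eta_m}\circ\cdots\circ\widehat f_{j+1}^{\eta_{j+1}}$, with edges along the two boundary paths from $v_0$ to $v_1$ and exponents as in $\partial C$. It is $\rho$-graded if $d_\alpha,f_\beta,K_\gamma$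 have degrees $+1,0,-1$ mod $\rho$. *)

theory Defs
  imports "HOL-Analysis.Analysis" "HOL-Number_Theory.Cong" "HOL-Library.Poly_Mapping" "HOL-Library.Z2"
begin

section \<open>Smooth surfaces and the 1-jet space\<close>

type_synonym plane = "real \<times> real"
type_synonym 'a chart = "'a set \<times> ('a \<Rightarrow> plane)"

text \<open>\<open>f\<close> is infinitely differentiable on the open set \<open>U\<close>: all iterated directional derivatives
  exist and are differentiable, i.e. \<open>f\<close> lies in a family of functions differentiable on \<open>U\<close> that
  is closed under directional derivatives.\<close>

definition smooth_on :: "'a::euclidean_space set \<Rightarrow> ('a \<Rightarrow> 'b::real_normed_vector) \<Rightarrow> bool" where
  "smooth_on U f \<longleftrightarrow> (\<exists>F. f \<in> F \<and> (\<forall>g\<in>F. \<forall>x\<in>U. g differentiable (at x))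
     \<and> (\<forall>g\<in>F. \<forall>v. (\<lambda>x. frechet_derivative g (at x) v) \<in> F))"

definition smooth_atlas :: "'a::topological_space chart set \<Rightarrow> bool" where
  "smooth_atlas A \<longleftrightarrow> (\<Union>c\<in>A. fst c) = UNIV
     \<and> (\<forall>(U,\<phi>)\<in>A. open U \<and> open (\<phi> ` U) \<and> (\<exists>\<psi>. homeomorphism U (\<phi> ` U) \<phi> \<psi>))
     \<and> (\<forall>(U,\<phi>)\<in>A. \<forall>(W,\<psi>)\<in>A. smooth_on (\<phi> ` (U \<inter> W)) (\<psi> \<circ> inv_into U \<phi>))"

text \<open>A smooth chart is one belonging to the maximal atlas.\<close>

definition smooth_chart :: "'a::topological_space chart set \<Rightarrow> 'a chart \<Rightarrow> bool" where
  "smooth_chart A c \<longleftrightarrow> smooth_atlas (insert c A)"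

text \<open>A covector at \<open>x\<close> is given by its components in all charts of the atlas around \<open>x\<close>, subject to
  the transformation law; a 1-jet is a base point with a covector and a \<open>z\<close>-coordinate.\<close>

type_synonym 'm jet = "'m \<times> ('m chart \<Rightarrow> plane) \<times> real"

definition covectors :: "'m::topological_space chart set \<Rightarrow> 'm \<Rightarrow> ('m chart \<Rightarrow> plane) set" where
  "covectors A x = {\<eta>. (\<forall>c. c \<notin> A \<or> x \<notin> fst c \<longrightarrow> \<eta> c = 0) \<and>
     (\<forall>(U,\<phi>)\<in>A. \<forall>(W,\<psi>)\<in>A. x \<in> U \<and> x \<in> W \<longrightarrow>
        (\<forall>w. \<eta> (U,\<phi>) \<bullet> w =
           \<eta> (W,\<psi>) \<bullet> frechet_derivative (\<psi> \<circ> inv_into U \<phi>) (at (\<phi> x)) w))}"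

definition J1 :: "'m::topological_space chart set \<Rightarrow> 'm jet set" where
  "J1 A = {(x, \<eta>, t). \<eta> \<in> covectors A x}"

section \<open>Closed Legendrian surfaces with generic projections\<close>

text \<open>The surfaces \<open>M\<close> and \<open>L\<close> are the types \<open>'m\<close>, \<open>'l\<close> with the given atlases; \<open>L\<close> is placed in
  the 1-jet space of \<open>M\<close> by the embedding \<open>jet\<close>, so that points of \<open>L\<close> are elements of \<open>'l\<close>.\<close>

record ('m, 'l) legendrian =
  atlasM :: "'m chart set"
  atlasL :: "'l chart set"
  jet :: "'l \<Rightarrow> 'm jet"

definition base :: "('m, 'l) legendrian \<Rightarrow> 'l \<Rightarrow> 'm" where
  "base \<Lambda> q = fst (jet \<Lambda> q)"

definition covec :: "('m, 'l) legendrian \<Rightarrow> 'l \<Rightarrow> 'm chart \<Rightarrow> plane" where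
  "covec \<Lambda> q = fst (snd (jet \<Lambda> q))"

definition ht :: "('m, 'l) legendrian \<Rightarrow> 'l \<Rightarrow> real" where
  "ht \<Lambda> q = snd (snd (jet \<Lambda> q))"

text \<open>Since \<open>L\<close> is compact, an injective Legendrian immersion is an embedding. The first condition on
  derivatives says that \<open>dz - y dx\<close> vanishes on \<open>L\<close>; given it, the second says that \<open>jet\<close> is an
  immersion.\<close>

definition legendrian_surface ::
    "('m::{t2_space,second_countable_topology}, 'l::{t2_space,second_countable_topology}) legendrian \<Rightarrow> bool" where
  "legendrian_surface \<Lambda> \<longleftrightarrow> smooth_atlas (atlasM \<Lambda>) \<and> smooth_atlas (atlasL \<Lambda>) \<and> compact (UNIV :: 'l set)
     \<and> inj (jet \<Lambda>) \<and> range (jet \<Lambda>) \<subseteq> J1 (atlasM \<Lambda>) \<and> continuous_on UNIV (base \<Lambda>)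
     \<and> (\<forall>(U,\<phi>)\<in>atlasM \<Lambda>. \<forall>(W,\<theta>)\<in>atlasL \<Lambda>.
          let Q = \<theta> ` (W \<inter> base \<Lambda> -` U);
              X = (\<lambda>u. \<phi> (base \<Lambda> (inv_into W \<theta> u)));
              Y = (\<lambda>u. covec \<Lambda> (inv_into W \<theta> u) (U,\<phi>));
              Z = (\<lambda>u. ht \<Lambda> (inv_into W \<theta> u))
          in smooth_on Q X \<and> smooth_on Q Y \<and> smooth_on Q Z
           \<and> (\<forall>u\<in>Q. \<forall>v. frechet_derivative Z (at u) v = Y u \<bullet> frechet_derivative X (at u) v)
           \<and> (\<forall>u\<in>Q. \<forall>v. frechet_derivative X (at u) v = 0 \<and> frechet_derivative Y (at u) v = 0
                \<longrightarrow> v = 0))"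

text \<open>The front of \<open>L\<close> has a given normal form at \<open>q\<close>: in suitable smooth coordinates of \<open>L\<close> at \<open>q\<close>
  and of \<open>M\<close> at \<open>base q\<close>, and up to adding a smooth function of the base point to \<open>z\<close>, the front
  projection is the model map. The swallowtail model comes from the family
  \<open>z = t^4 + a t^2 + b t\<close> (or its negative) by setting the \<open>t\<close>-derivative to \<open>0\<close>.\<close>

definition front_form ::
    "('m::topological_space, 'l::topological_space) legendrian \<Rightarrow> (plane \<Rightarrow> plane \<times> real) \<Rightarrow> 'l \<Rightarrow> bool" where
  "front_form \<Lambda> F q \<longleftrightarrow> (\<exists>N \<theta> P \<kappa> g. smooth_chart (atlasL \<Lambda>) (N,\<theta>) \<and> smooth_chart (atlasM \<Lambda>) (P,\<kappa>)
     \<and> q \<in> N \<and> base \<Lambda> ` N \<subseteq> P \<and> \<theta> q = 0 \<and> \<kappa> (base \<Lambda> q) = 0 \<and> smooth_on (\<kappa> ` P) g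
     \<and> (\<forall>q'\<in>N. \<kappa> (base \<Lambda> q') = fst (F (\<theta> q'))
          \<and> ht \<Lambda> q' = snd (F (\<theta> q')) + g (\<kappa> (base \<Lambda> q'))))"

definition regular_points :: "('m::topological_space, 'l::topological_space) legendrian \<Rightarrow> 'l set" where
  "regular_points \<Lambda> = {q. front_form \<Lambda> (\<lambda>(u,v). ((u, v), 0)) q}"

definition cusps :: "('m::topological_space, 'l::topological_space) legendrian \<Rightarrow> 'l set" where
  "cusps \<Lambda> = {q. front_form \<Lambda> (\<lambda>(u,v). ((u^2, v), u^3)) q}"

definition swallowtails :: "('m::topological_space, 'l::topological_space) legendrian \<Rightarrow> 'l set" where
  "swallowtails \<Lambda> = {q. front_form \<Lambda> (\<lambda>(t,a). ((a, - 4*t^3 - 2*a*t), - 3*t^4 - a*t^2)) q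
                     \<or> front_form \<Lambda> (\<lambda>(t,a). ((a, - 4*t^3 - 2*a*t), 3*t^4 + a*t^2)) q}"

definition same_front :: "('m, 'l) legendrian \<Rightarrow> 'l \<Rightarrow> 'l \<Rightarrow> bool" where
  "same_front \<Lambda> q q' \<longleftrightarrow> base \<Lambda> q = base \<Lambda> q' \<and> ht \<Lambda> q = ht \<Lambda> q'"

definition crossings :: "('m, 'l) legendrian \<Rightarrow> 'l set" where
  "crossings \<Lambda> = {q. \<exists>q'. q' \<noteq> q \<and> same_front \<Lambda> q q'}"

definition singular_locus :: "('m::topological_space, 'l::topological_space) legendrian \<Rightarrow> 'm set" where
  "singular_locus \<Lambda> = base \<Lambda> ` (cusps \<Lambda> \<union> swallowtails \<Lambda> \<union> crossings \<Lambda>)"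

definition det2 :: "plane \<Rightarrow> plane \<Rightarrow> real" where
  "det2 v w = fst v * snd w - snd v * fst w"

definition dcov :: "('m, 'l) legendrian \<Rightarrow> 'm chart \<Rightarrow> 'l \<Rightarrow> 'l \<Rightarrow> plane" where
  "dcov \<Lambda> c q q' = covec \<Lambda> q c - covec \<Lambda> q' c"

text \<open>Image of the differential of the base projection at \<open>q\<close>; at a cusp point this is the line tangent
  to the base projection of the cusp edge.\<close>

definition base_image :: "('m::topological_space, 'l::topological_space) legendrian \<Rightarrow> 'm chart \<Rightarrow> 'l \<Rightarrow> plane set" where
  "base_image \<Lambda> c q = (\<Union>(W,\<theta>)\<in>{d \<in> atlasL \<Lambda>. q \<in> fst d}.
     range (frechet_derivative (\<lambda>u. snd c (base \<Lambda> (inv_into W \<theta> u))) (at (\<theta> q))))"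

text \<open>Tangent lines at \<open>x\<close> of the base projections of the crossing arcs and cusp edges passing through
  the front point \<open>(x,t)\<close>. Two sheets \<open>z = f\<close> and \<open>z = f'\<close> cross along \<open>f = f'\<close>, whose tangent is
  the kernel of \<open>df - df'\<close>.\<close>

definition arc_tangents ::
    "('m::topological_space, 'l::topological_space) legendrian \<Rightarrow> 'm chart \<Rightarrow> 'm \<Rightarrow> real \<Rightarrow> plane set set" where
  "arc_tangents \<Lambda> c x t =
     {{w. dcov \<Lambda> c q q' \<bullet> w = 0} | q q'. q \<noteq> q' \<and> base \<Lambda> q = x \<and> ht \<Lambda> q = t \<and> same_front \<Lambda> q q'}
   \<union> {base_image \<Lambda> c q | q. q \<in> cusps \<Lambda> \<and> base \<Lambda> q = x \<and> ht \<Lambda> q = t}"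

text \<open>Multiple points of the front: transverse double points (transversality is automatic, since \<open>jet\<close> is
  injective), triple points in general position, and transverse intersections of a cusp edge with one
  smooth sheet.\<close>

definition generic_projections :: "('m::topological_space, 'l::topological_space) legendrian \<Rightarrow> bool" where
  "generic_projections \<Lambda> \<longleftrightarrow>
     UNIV = regular_points \<Lambda> \<union> cusps \<Lambda> \<union> swallowtails \<Lambda>
   \<and> (\<forall>q q'. q \<noteq> q' \<and> same_front \<Lambda> q q' \<longrightarrow>
        q \<notin> swallowtails \<Lambda> \<and> \<not> (q \<in> cusps \<Lambda> \<and> q' \<in> cusps \<Lambda>)
      \<and> (q \<in> cusps \<Lambda> \<longrightarrow> (\<forall>c\<in>atlasM \<Lambda>. base \<Lambda> q \<in> fst c \<longrightarrow>
            (\<exists>w\<in>base_image \<Lambda> c q. dcov \<Lambda> c q' q \<bullet> w \<noteq> 0))))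
   \<and> (\<forall>q1 q2 q3. distinct [q1,q2,q3] \<and> same_front \<Lambda> q1 q2 \<and> same_front \<Lambda> q1 q3 \<longrightarrow>
        q1 \<in> regular_points \<Lambda>
      \<and> (\<forall>c\<in>atlasM \<Lambda>. base \<Lambda> q1 \<in> fst c \<longrightarrow> det2 (dcov \<Lambda> c q1 q2) (dcov \<Lambda> c q1 q3) \<noteq> 0)
      \<and> (\<forall>q4. same_front \<Lambda> q1 q4 \<longrightarrow> q4 \<in> {q1,q2,q3}))
   \<and> (\<forall>x t t'. \<forall>c\<in>atlasM \<Lambda>. x \<in> fst c \<and> t \<noteq> t' \<longrightarrow>
        (\<forall>l\<in>arc_tangents \<Lambda> c x t. \<forall>l'\<in>arc_tangents \<Lambda> c x t'. l \<inter> l' = {0}))"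

section \<open>Maslov number and Maslov potentials\<close>

text \<open>For small \<open>N\<close> around a cusp point these are the parts of \<open>N\<close> in the upper and lower of the two
  sheets meeting there.\<close>

definition upper_part :: "('m, 'l) legendrian \<Rightarrow> 'l set \<Rightarrow> 'l set" where
  "upper_part \<Lambda> N = {q\<in>N. \<exists>q'\<in>N. base \<Lambda> q' = base \<Lambda> q \<and> ht \<Lambda> q' < ht \<Lambda> q}"

definition lower_part :: "('m, 'l) legendrian \<Rightarrow> 'l set \<Rightarrow> 'l set" where
  "lower_part \<Lambda> N = {q\<in>N. \<exists>q'\<in>N. base \<Lambda> q' = base \<Lambda> q \<and> ht \<Lambda> q < ht \<Lambda> q'}"

definition down_times :: "('m::topological_space, 'l::topological_space) legendrian \<Rightarrow> (real \<Rightarrow> 'l) \<Rightarrow> real set" where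
  "down_times \<Lambda> \<gamma> = {t\<in>{0<..<1}. \<gamma> t \<in> cusps \<Lambda> \<and> (\<forall>N. open N \<and> \<gamma> t \<in> N \<longrightarrow>
     (\<exists>\<delta>>0. \<gamma> ` {t-\<delta><..<t} \<subseteq> upper_part \<Lambda> N \<and> \<gamma> ` {t<..<t+\<delta>} \<subseteq> lower_part \<Lambda> N))}"

definition up_times :: "('m::topological_space, 'l::topological_space) legendrian \<Rightarrow> (real \<Rightarrow> 'l) \<Rightarrow> real set" where
  "up_times \<Lambda> \<gamma> = {t\<in>{0<..<1}. \<gamma> t \<in> cusps \<Lambda> \<and> (\<forall>N. open N \<and> \<gamma> t \<in> N \<longrightarrow>
     (\<exists>\<delta>>0. \<gamma> ` {t-\<delta><..<t} \<subseteq> lower_part \<Lambda> N \<and> \<gamma> ` {t<..<t+\<delta>} \<subseteq> upper_part \<Lambda> N))}"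

definition generic_loop :: "('m::topological_space, 'l::topological_space) legendrian \<Rightarrow> (real \<Rightarrow> 'l) \<Rightarrow> bool" where
  "generic_loop \<Lambda> \<gamma> \<longleftrightarrow> continuous_on {0..1} \<gamma> \<and> \<gamma> 0 = \<gamma> 1 \<and> \<gamma> ` {0..1} \<inter> swallowtails \<Lambda> = {}
     \<and> finite {t\<in>{0..1}. \<gamma> t \<in> cusps \<Lambda>}
     \<and> {t\<in>{0..1}. \<gamma> t \<in> cusps \<Lambda>} = down_times \<Lambda> \<gamma> \<union> up_times \<Lambda> \<gamma>"

text \<open>Every class in \<open>H_1(L;Z)\<close> is a sum of classes of generic loops, so the image of \<open>m\<close> on homology
  is the subgroup generated by its values on generic loops.\<close>

definition maslov_number :: "('m::topological_space, 'l::topological_space) legendrian \<Rightarrow> int" where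
  "maslov_number \<Lambda> = Gcd {int (card (down_times \<Lambda> \<gamma>)) - int (card (up_times \<Lambda> \<gamma>)) | \<gamma>. generic_loop \<Lambda> \<gamma>}"

text \<open>The values of \<open>\<mu>\<close> are integers representing residue classes modulo the Maslov number; the values
  of \<open>\<mu>\<close> at cusp and swallowtail points are irrelevant.\<close>

definition maslov_potential ::
    "('m::topological_space, 'l::topological_space) legendrian \<Rightarrow> ('l \<Rightarrow> int) \<Rightarrow> bool" where
  "maslov_potential \<Lambda> \<mu> \<longleftrightarrow>
     (\<forall>q. q \<notin> cusps \<Lambda> \<union> swallowtails \<Lambda> \<longrightarrow>
        (\<exists>N. open N \<and> q \<in> N \<and> (\<forall>q'\<in>N - (cusps \<Lambda> \<union> swallowtails \<Lambda>). [\<mu> q' = \<mu> q] (mod maslov_number \<Lambda>))))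
   \<and> (\<forall>c\<in>cusps \<Lambda>. \<exists>N. open N \<and> c \<in> N \<and>
        (\<forall>l\<in>N. \<forall>u\<in>N. base \<Lambda> l = base \<Lambda> u \<and> ht \<Lambda> l < ht \<Lambda> u \<longrightarrow>
           [\<mu> u = \<mu> l + 1] (mod maslov_number \<Lambda>)))"

section \<open>Compatible polygonal decompositions\<close>

text \<open>Cells are subsets of \<open>M\<close>. A 1-cell has a characteristic map on \<open>[0,1]\<close>, which also carries its
  orientation; a 2-cell \<open>f\<close> has one on the closed unit disc, the corners of the polygon being the
  points \<open>corner_pt E f j\<close> for \<open>j < nsides E f\<close>. Side \<open>i\<close> runs counterclockwise from corner \<open>i\<close> to
  corner \<open>i + 1\<close>, its edge is the 1-cell \<open>side E f i\<close>, and \<open>agrees E f i\<close> says whether the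
  orientation of that edge is the counterclockwise one. \<open>v0\<close> and \<open>v1\<close> are indices of corners, and
  \<open>ccw\<close> is the direction of the path from \<open>v0\<close> to \<open>v1\<close> in case they coincide. The remaining fields
  except \<open>sheet_order\<close> concern swallowtail vertices (given as 0-cells): the corners labeled \<open>S\<close> and
  \<open>T\<close>, as a 2-cell with a corner index, and the three adjacent 1-cells. \<open>sheet_order\<close> is the total
  order of sheets chosen for each cell.\<close>

record ('m, 'l) decomposition =
  cells0 :: "'m set set"
  cells1 :: "'m set set"
  cells2 :: "'m set set"
  ch1 :: "'m set \<Rightarrow> real \<Rightarrow> 'm"
  ch2 :: "'m set \<Rightarrow> complex \<Rightarrow> 'm"
  nsides :: "'m set \<Rightarrow> nat"
  side :: "'m set \<Rightarrow> nat \<Rightarrow> 'm set"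
  agrees :: "'m set \<Rightarrow> nat \<Rightarrow> bool"
  v0 :: "'m set \<Rightarrow> nat"
  v1 :: "'m set \<Rightarrow> nat"
  ccw :: "'m set \<Rightarrow> bool"
  cornerS :: "'m set \<Rightarrow> 'm set \<times> nat"
  cornerT :: "'m set \<Rightarrow> 'm set \<times> nat"
  edge_cr :: "'m set \<Rightarrow> 'm set"
  edge_S :: "'m set \<Rightarrow> 'm set"
  edge_T :: "'m set \<Rightarrow> 'm set"
  sheet_order :: "'m set \<Rightarrow> 'l set rel"

definition cells :: "('m, 'l) decomposition \<Rightarrow> 'm set set" where
  "cells E = cells0 E \<union> cells1 E \<union> cells2 E"

definition side_pt :: "('m, 'l) decomposition \<Rightarrow> 'm set \<Rightarrow> nat \<Rightarrow> real \<Rightarrow> complex" where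
  "side_pt E f i t = cis (2 * pi * (real i + t) / real (nsides E f))"

definition corner_pt :: "('m, 'l) decomposition \<Rightarrow> 'm set \<Rightarrow> nat \<Rightarrow> complex" where
  "corner_pt E f j = side_pt E f j 0"

definition end1 :: "('m, 'l) decomposition \<Rightarrow> 'm set \<Rightarrow> real \<Rightarrow> 'm set" where
  "end1 E e t = {ch1 E e t}"

definition vertex2 :: "('m, 'l) decomposition \<Rightarrow> 'm set \<Rightarrow> nat \<Rightarrow> 'm set" where
  "vertex2 E f j = {ch2 E f (corner_pt E f j)}"

definition prev_side :: "('m, 'l) decomposition \<Rightarrow> 'm set \<Rightarrow> nat \<Rightarrow> nat" where
  "prev_side E f j = (j + nsides E f - 1) mod nsides E f"

definition polygonal_decomposition :: "('m::topological_space) set \<Rightarrow> ('m, 'l) decomposition \<Rightarrow> bool" where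
  "polygonal_decomposition B E \<longleftrightarrow>
     finite (cells E) \<and> disjoint (cells E) \<and> \<Union>(cells E) = B
   \<and> cells0 E \<inter> cells1 E = {} \<and> cells0 E \<inter> cells2 E = {} \<and> cells1 E \<inter> cells2 E = {}
   \<and> (\<forall>v\<in>cells0 E. \<exists>x. v = {x})
   \<and> (\<forall>e\<in>cells1 E. continuous_on {0..1} (ch1 E e) \<and> inj_on (ch1 E e) {0<..<1}
        \<and> e = ch1 E e ` {0<..<1} \<and> end1 E e 0 \<in> cells0 E \<and> end1 E e 1 \<in> cells0 E)
   \<and> (\<forall>f\<in>cells2 E. continuous_on (cball 0 1) (ch2 E f) \<and> inj_on (ch2 E f) (ball 0 1)
        \<and> f = ch2 E f ` ball 0 1 \<and> 1 \<le> nsides E f \<and> v0 E f < nsides E f \<and> v1 E f < nsides E f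
        \<and> (\<forall>i<nsides E f. side E f i \<in> cells1 E \<and>
             (\<exists>\<tau> \<tau>'. homeomorphism {0..1} {0..1} \<tau> \<tau>'
                \<and> \<tau> 0 = (if agrees E f i then 0 else 1) \<and> \<tau> 1 = (if agrees E f i then 1 else 0)
                \<and> (\<forall>t\<in>{0..1}. ch2 E f (side_pt E f i t) = ch1 E (side E f i) (\<tau> t)))))"

subsection \<open>Sheets\<close>

definition sheets :: "('m::topological_space, 'l::topological_space) legendrian \<Rightarrow> 'm set \<Rightarrow> 'l set set" where
  "sheets \<Lambda> e = components (base \<Lambda> -` e \<inter> (- cusps \<Lambda>))"

text \<open>\<open>higher \<Lambda> p q\<close> is the relation \<open>p \<prec> q\<close> on sheets.\<close>

definition higher :: "('m, 'l) legendrian \<Rightarrow> 'l set \<Rightarrow> 'l set \<Rightarrow> bool" where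
  "higher \<Lambda> p q \<longleftrightarrow> (\<forall>a\<in>p. \<forall>b\<in>q. base \<Lambda> a = base \<Lambda> b \<longrightarrow> ht \<Lambda> a > ht \<Lambda> b)"

definition crosses :: "('m, 'l) legendrian \<Rightarrow> 'l set \<Rightarrow> 'l set \<Rightarrow> bool" where
  "crosses \<Lambda> p q \<longleftrightarrow> p \<noteq> q \<and> (\<forall>a\<in>p. \<forall>b\<in>q. base \<Lambda> a = base \<Lambda> b \<longrightarrow> ht \<Lambda> a = ht \<Lambda> b)"

text \<open>Position of a sheet when sheets are numbered from \<open>1\<close> by descending \<open>z\<close>-coordinate.\<close>

definition sheet_no :: "('m::topological_space, 'l::topological_space) legendrian \<Rightarrow> 'm set \<Rightarrow> 'l set \<Rightarrow> nat" where
  "sheet_no \<Lambda> e p = Suc (card {q \<in> sheets \<Lambda> e. higher \<Lambda> q p})"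

definition nth_sheet :: "('m::topological_space, 'l::topological_space) legendrian \<Rightarrow> 'm set \<Rightarrow> nat \<Rightarrow> 'l set" where
  "nth_sheet \<Lambda> e i = (THE p. p \<in> sheets \<Lambda> e \<and> sheet_no \<Lambda> e p = i)"

text \<open>\<open>s\<close> is in the closure of the sheet \<open>p\<close> above a 1-cell at its end \<open>t\<close>, respectively above a 2-cell
  at the point \<open>\<zeta>\<close> of the boundary of the domain of its characteristic map. As a cell may meet the
  same boundary point more than once, closures are localized in the domain.\<close>

definition lim1 ::
    "('m::topological_space, 'l::topological_space) legendrian \<Rightarrow> ('m, 'l) decomposition \<Rightarrow> 'm set \<Rightarrow> real \<Rightarrow> 'l set \<Rightarrow> 'l \<Rightarrow> bool" where
  "lim1 \<Lambda> E e t p s \<longleftrightarrow> (\<forall>r>0. s \<in> closure (p \<inter> base \<Lambda> -` (ch1 E e ` ({0<..<1} \<inter> ball t r))))"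

definition lim2 ::
    "('m::topological_space, 'l::topological_space) legendrian \<Rightarrow> ('m, 'l) decomposition \<Rightarrow> 'm set \<Rightarrow> complex \<Rightarrow> 'l set \<Rightarrow> 'l \<Rightarrow> bool" where
  "lim2 \<Lambda> E f \<zeta> p s \<longleftrightarrow> (\<forall>r>0. s \<in> closure (p \<inter> base \<Lambda> -` (ch2 E f ` (ball 0 1 \<inter> ball \<zeta> r))))"

text \<open>The sheet of a cell whose closure contains a given sheet \<open>p'\<close> of a boundary cell: for an end of a
  1-cell, a corner of a 2-cell, and a side of a 2-cell.\<close>

definition inc1 ::
    "('m::topological_space, 'l::topological_space) legendrian \<Rightarrow> ('m, 'l) decomposition \<Rightarrow> 'm set \<Rightarrow> real \<Rightarrow> 'l set \<Rightarrow> 'l set" where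
  "inc1 \<Lambda> E e t p' = (THE p. p \<in> sheets \<Lambda> e \<and> (\<forall>s\<in>p'. lim1 \<Lambda> E e t p s))"

definition inc2 ::
    "('m::topological_space, 'l::topological_space) legendrian \<Rightarrow> ('m, 'l) decomposition \<Rightarrow> 'm set \<Rightarrow> nat \<Rightarrow> 'l set \<Rightarrow> 'l set" where
  "inc2 \<Lambda> E f j p' = (THE p. p \<in> sheets \<Lambda> f \<and> (\<forall>s\<in>p'. lim2 \<Lambda> E f (corner_pt E f j) p s))"

definition inc_side ::
    "('m::topological_space, 'l::topological_space) legendrian \<Rightarrow> ('m, 'l) decomposition \<Rightarrow> 'm set \<Rightarrow> nat \<Rightarrow> 'l set \<Rightarrow> 'l set" where
  "inc_side \<Lambda> E f i p' = (THE p. p \<in> sheets \<Lambda> f \<and>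
     (\<forall>t\<in>{0<..<1}. \<forall>s\<in>p'. base \<Lambda> s = ch2 E f (side_pt E f i t) \<longrightarrow> lim2 \<Lambda> E f (side_pt E f i t) p s))"

text \<open>\<open>p\<close> and \<open>q\<close> are the upper and lower sheet of a pair meeting at a cusp above a vertex.\<close>

definition cusp_pair1 ::
    "('m::topological_space, 'l::topological_space) legendrian \<Rightarrow> ('m, 'l) decomposition \<Rightarrow> 'm set \<Rightarrow> real \<Rightarrow> 'l set \<Rightarrow> 'l set \<Rightarrow> bool" where
  "cusp_pair1 \<Lambda> E e t p q \<longleftrightarrow> p \<in> sheets \<Lambda> e \<and> q \<in> sheets \<Lambda> e \<and> higher \<Lambda> p q
     \<and> (\<exists>c\<in>cusps \<Lambda>. lim1 \<Lambda> E e t p c \<and> lim1 \<Lambda> E e t q c)"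

definition cusp_pair2 ::
    "('m::topological_space, 'l::topological_space) legendrian \<Rightarrow> ('m, 'l) decomposition \<Rightarrow> 'm set \<Rightarrow> nat \<Rightarrow> 'l set \<Rightarrow> 'l set \<Rightarrow> bool" where
  "cusp_pair2 \<Lambda> E f j p q \<longleftrightarrow> p \<in> sheets \<Lambda> f \<and> q \<in> sheets \<Lambda> f \<and> higher \<Lambda> p q
     \<and> (\<exists>c\<in>cusps \<Lambda>. lim2 \<Lambda> E f (corner_pt E f j) p c \<and> lim2 \<Lambda> E f (corner_pt E f j) q c)"

subsection \<open>Swallowtail vertices\<close>

definition st_vertex ::
    "('m::topological_space, 'l::topological_space) legendrian \<Rightarrow> ('m, 'l) decomposition \<Rightarrow> 'm set \<Rightarrow> bool" where
  "st_vertex \<Lambda> E v \<longleftrightarrow> v \<in> cells0 E \<and> v \<inter> base \<Lambda> ` swallowtails \<Lambda> \<noteq> {}"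

definition st_point :: "('m::topological_space, 'l::topological_space) legendrian \<Rightarrow> 'm set \<Rightarrow> 'l" where
  "st_point \<Lambda> v = (THE s. s \<in> swallowtails \<Lambda> \<and> base \<Lambda> s \<in> v)"

text \<open>The number \<open>k\<close> of the swallowtail sheet above the vertex, i.e. of the first of the three sheets
  above the swallowtail region meeting there.\<close>

definition st_no :: "('m::topological_space, 'l::topological_space) legendrian \<Rightarrow> 'm set \<Rightarrow> nat" where
  "st_no \<Lambda> v = sheet_no \<Lambda> v {st_point \<Lambda> v}"

definition cr_side :: "('m, 'l) decomposition \<Rightarrow> 'm set \<Rightarrow> 'm set \<times> nat \<Rightarrow> nat" where
  "cr_side E v = (\<lambda>(f,j). if side E f j = edge_cr E v then j else prev_side E f j)"

text \<open>The bijections from the sheets of the crossing 1-cell to those of the 2-cells containing the corners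
  \<open>S\<close> and \<open>T\<close>.\<close>

definition cr_to_S ::
    "('m::topological_space, 'l::topological_space) legendrian \<Rightarrow> ('m, 'l) decomposition \<Rightarrow> 'm set \<Rightarrow> 'l set \<Rightarrow> 'l set" where
  "cr_to_S \<Lambda> E v = inc_side \<Lambda> E (fst (cornerS E v)) (cr_side E v (cornerS E v))"

definition cr_to_T ::
    "('m::topological_space, 'l::topological_space) legendrian \<Rightarrow> ('m, 'l) decomposition \<Rightarrow> 'm set \<Rightarrow> 'l set \<Rightarrow> 'l set" where
  "cr_to_T \<Lambda> E v = inc_side \<Lambda> E (fst (cornerT E v)) (cr_side E v (cornerT E v))"

text \<open>The sheets numbered \<open>i\<close> and \<open>i + 1\<close> cross above the crossing 1-cell, exchanging their order from
  the side of \<open>S\<close> to the side of \<open>T\<close>.\<close>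

definition crossing_at ::
    "('m::topological_space, 'l::topological_space) legendrian \<Rightarrow> ('m, 'l) decomposition \<Rightarrow> 'm set \<Rightarrow> nat \<Rightarrow> bool" where
  "crossing_at \<Lambda> E v i \<longleftrightarrow> (\<exists>p\<in>sheets \<Lambda> (edge_cr E v). \<exists>q\<in>sheets \<Lambda> (edge_cr E v). crosses \<Lambda> p q
     \<and> cr_to_S \<Lambda> E v p = nth_sheet \<Lambda> (fst (cornerS E v)) i
     \<and> cr_to_S \<Lambda> E v q = nth_sheet \<Lambda> (fst (cornerS E v)) (i + 1)
     \<and> cr_to_T \<Lambda> E v p = nth_sheet \<Lambda> (fst (cornerT E v)) (i + 1)
     \<and> cr_to_T \<Lambda> E v q = nth_sheet \<Lambda> (fst (cornerT E v)) i)"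

definition upward ::
    "('m::topological_space, 'l::topological_space) legendrian \<Rightarrow> ('m, 'l) decomposition \<Rightarrow> 'm set \<Rightarrow> bool" where
  "upward \<Lambda> E v \<longleftrightarrow> crossing_at \<Lambda> E v (st_no \<Lambda> v + 1)"

definition downward ::
    "('m::topological_space, 'l::topological_space) legendrian \<Rightarrow> ('m, 'l) decomposition \<Rightarrow> 'm set \<Rightarrow> bool" where
  "downward \<Lambda> E v \<longleftrightarrow> crossing_at \<Lambda> E v (st_no \<Lambda> v)"

definition st_corner ::
    "('m::topological_space, 'l::topological_space) legendrian \<Rightarrow> ('m, 'l) decomposition \<Rightarrow> 'm set \<Rightarrow> 'm set \<times> nat \<Rightarrow> 'm set \<Rightarrow> bool" where
  "st_corner \<Lambda> E v \<kappa> e \<longleftrightarrow> (case \<kappa> of (f,j) \<Rightarrow>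
     f \<in> cells2 E \<and> j < nsides E f \<and> vertex2 E f j = v
   \<and> {side E f j, side E f (prev_side E f j)} = {edge_cr E v, e}
   \<and> card (sheets \<Lambda> f) = card (sheets \<Lambda> v) + 2
   \<and> {p \<in> sheets \<Lambda> f. lim2 \<Lambda> E f (corner_pt E f j) p (st_point \<Lambda> v)}
       = nth_sheet \<Lambda> f ` {st_no \<Lambda> v, st_no \<Lambda> v + 1, st_no \<Lambda> v + 2}
   \<and> bij_betw (inc_side \<Lambda> E f (cr_side E v \<kappa>)) (sheets \<Lambda> (edge_cr E v)) (sheets \<Lambda> f))"

text \<open>Local structure at a swallowtail vertex. The first six lines say that the 1-skeleton agrees with the
  singular locus there and consists of the crossing arc and the two cusp edges, oriented away. The
  others, and the conditions on sheets in \<open>st_corner\<close>, record how sheets are arranged over the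
  neighboring cells, as follows from the normal form and the genericity of the projections: three
  sheets above the swallowtail region meet at the swallowtail point and two of them cross, whereas
  outside of that region and along the cusp edges exactly one sheet ends there.\<close>

definition st_structure ::
    "('m::topological_space, 'l::topological_space) legendrian \<Rightarrow> ('m, 'l) decomposition \<Rightarrow> 'm set \<Rightarrow> bool" where
  "st_structure \<Lambda> E v \<longleftrightarrow>
     (\<exists>W. open W \<and> v \<subseteq> W \<and> W \<inter> \<Union>(cells0 E \<union> cells1 E) = W \<inter> singular_locus \<Lambda>)
   \<and> distinct [edge_cr E v, edge_S E v, edge_T E v]
   \<and> {e \<in> cells1 E. end1 E e 0 = v} = {edge_cr E v, edge_S E v, edge_T E v}
   \<and> {e \<in> cells1 E. end1 E e 1 = v} = {}
   \<and> edge_cr E v \<subseteq> base \<Lambda> ` crossings \<Lambda>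
   \<and> edge_S E v \<subseteq> base \<Lambda> ` cusps \<Lambda> \<and> edge_T E v \<subseteq> base \<Lambda> ` cusps \<Lambda>
   \<and> (\<exists>!s. s \<in> swallowtails \<Lambda> \<and> base \<Lambda> s \<in> v)
   \<and> (\<forall>p\<in>sheets \<Lambda> v. \<forall>q\<in>sheets \<Lambda> v. \<not> crosses \<Lambda> p q)
   \<and> st_corner \<Lambda> E v (cornerS E v) (edge_S E v) \<and> st_corner \<Lambda> E v (cornerT E v) (edge_T E v)
   \<and> (upward \<Lambda> E v \<or> downward \<Lambda> E v)
   \<and> (\<forall>p\<in>sheets \<Lambda> (edge_cr E v). \<forall>q\<in>sheets \<Lambda> (edge_cr E v). \<forall>p'\<in>sheets \<Lambda> (edge_cr E v).
        \<forall>q'\<in>sheets \<Lambda> (edge_cr E v). crosses \<Lambda> p q \<and> crosses \<Lambda> p' q' \<longrightarrow> {p,q} = {p',q'})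
   \<and> (\<forall>e\<in>{edge_S E v, edge_T E v}. \<exists>!p. p \<in> sheets \<Lambda> e \<and> lim1 \<Lambda> E e 0 p (st_point \<Lambda> v))
   \<and> (\<forall>f\<in>cells2 E. \<forall>j<nsides E f. vertex2 E f j = v \<and> (f,j) \<noteq> cornerS E v \<and> (f,j) \<noteq> cornerT E v \<longrightarrow>
        (\<exists>!p. p \<in> sheets \<Lambda> f \<and> lim2 \<Lambda> E f (corner_pt E f j) p (st_point \<Lambda> v)))"

text \<open>The conditions on sheets hold for every polygonal decomposition with the singular locus in its
  1-skeleton: above a cell, \<open>L\<close> without the cusp points is a disjoint union of finitely many copies
  of the cell, and two of these either cross above the whole cell or nowhere.\<close>

definition compatible_decomposition ::
    "('m::topological_space, 'l::topological_space) legendrian \<Rightarrow> ('m, 'l) decomposition \<Rightarrow> bool" where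
  "compatible_decomposition \<Lambda> E \<longleftrightarrow>
     polygonal_decomposition (range (base \<Lambda>)) E
   \<and> singular_locus \<Lambda> \<subseteq> \<Union>(cells0 E \<union> cells1 E)
   \<and> (\<forall>x\<in>base \<Lambda> ` swallowtails \<Lambda>. {x} \<in> cells0 E)
   \<and> (\<forall>e\<in>cells E. finite (sheets \<Lambda> e)
        \<and> (\<forall>p\<in>sheets \<Lambda> e. \<exists>g. homeomorphism p e (base \<Lambda>) g)
        \<and> (\<forall>p\<in>sheets \<Lambda> e. \<forall>q\<in>sheets \<Lambda> e. p \<noteq> q \<longrightarrow> higher \<Lambda> p q \<or> higher \<Lambda> q p \<or> crosses \<Lambda> p q))
   \<and> (\<forall>v. st_vertex \<Lambda> E v \<longrightarrow> st_structure \<Lambda> E v)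
   \<and> (\<forall>e\<in>cells E. linear_order_on (sheets \<Lambda> e) (sheet_order E e)
        \<and> (\<forall>p\<in>sheets \<Lambda> e. \<forall>q\<in>sheets \<Lambda> e. higher \<Lambda> p q \<longrightarrow> (p,q) \<in> sheet_order E e))"

text \<open>The sheet consisting of a swallowtail point is graded as the sheet of \<open>edge_T\<close> ending there; all
  other sheets contain no swallowtail point, and \<open>\<mu>\<close> is constant on them modulo the Maslov number.\<close>

definition sheet_degree ::
    "('m::topological_space, 'l::topological_space) legendrian \<Rightarrow> ('m, 'l) decomposition \<Rightarrow> ('l \<Rightarrow> int) \<Rightarrow> 'm set \<Rightarrow> 'l set \<Rightarrow> int" where
  "sheet_degree \<Lambda> E \<mu> e p =
     \<mu> (SOME q. q \<in> (if st_vertex \<Lambda> E e \<and> p = {st_point \<Lambda> e} then inc1 \<Lambda> E (edge_T E e) 0 p else p))"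

text \<open>The two boundary paths from \<open>v0\<close> to \<open>v1\<close>, as lists of side indices with a Boolean for the
  exponent (\<open>True\<close> for \<open>+1\<close>).\<close>

definition ccw_path :: "('m, 'l) decomposition \<Rightarrow> 'm set \<Rightarrow> (nat \<times> bool) list" where
  "ccw_path E f = (let n = nsides E f in
     map (\<lambda>m. let i = (v0 E f + m) mod n in (i, agrees E f i))
       [0..<(if v0 E f = v1 E f then (if ccw E f then n else 0) else (v1 E f + n - v0 E f) mod n)])"

definition cw_path :: "('m, 'l) decomposition \<Rightarrow> 'm set \<Rightarrow> (nat \<times> bool) list" where
  "cw_path E f = (let n = nsides E f in
     map (\<lambda>m. let i = (v0 E f + n - 1 - m) mod n in (i, \<not> agrees E f i))
       [0..<(if v0 E f = v1 E f then (if ccw E f then 0 else n) else (v0 E f + n - v1 E f) mod n)])"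

section \<open>The cellular DGA\<close>

subsection \<open>Free algebras over the field with two elements, and matrices\<close>

datatype 'g fword = FWord (letters: "'g list")

instantiation fword :: (type) monoid_add
begin

definition zero_fword :: "'a fword" where
  "zero_fword = FWord []"

definition plus_fword :: "'a fword \<Rightarrow> 'a fword \<Rightarrow> 'a fword" where
  "plus_fword v w = FWord (letters v @ letters w)"

instance
  by standard (auto simp: zero_fword_def plus_fword_def)

end

text \<open>The free associative unital algebra; its product is convolution of concatenation.\<close>

type_synonym 'g free_alg = "'g fword \<Rightarrow>\<^sub>0 bit"

definition gen :: "'g \<Rightarrow> 'g free_alg" where
  "gen g = Poly_Mapping.single (FWord [g]) 1"

text \<open>The subalgebra generated by a set \<open>G\<close> of generators.\<close>

definition free_alg_on :: "'g set \<Rightarrow> 'g free_alg set" where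
  "free_alg_on G = {a. \<forall>w\<in>Poly_Mapping.keys a. set (letters w) \<subseteq> G}"

text \<open>Extension of a map on generators to a derivation (signs are irrelevant).\<close>

definition derivation :: "('g \<Rightarrow> 'g free_alg) \<Rightarrow> 'g free_alg \<Rightarrow> 'g free_alg" where
  "derivation D a = (\<Sum>w\<in>Poly_Mapping.keys a. \<Sum>i<length (letters w).
     Poly_Mapping.single (FWord (take i (letters w))) (Poly_Mapping.lookup a w) * D (letters w ! i)
       * Poly_Mapping.single (FWord (drop (Suc i) (letters w))) 1)"

type_synonym ('i, 'a) sqmat = "'i \<Rightarrow> 'i \<Rightarrow> 'a"

definition mone :: "'i set \<Rightarrow> ('i, 'a::ring_1) sqmat" where
  "mone I p q = (if p \<in> I \<and> p = q then 1 else 0)"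

definition madd :: "('i, 'a::ring_1) sqmat \<Rightarrow> ('i, 'a) sqmat \<Rightarrow> ('i, 'a) sqmat" where
  "madd X Y p q = X p q + Y p q"

definition mmul :: "'i set \<Rightarrow> ('i, 'a::ring_1) sqmat \<Rightarrow> ('i, 'a) sqmat \<Rightarrow> ('i, 'a) sqmat" where
  "mmul I X Y p q = (if p \<in> I \<and> q \<in> I then \<Sum>r\<in>I. X p r * Y r q else 0)"

definition minverse :: "'i set \<Rightarrow> ('i, 'a::ring_1) sqmat \<Rightarrow> ('i, 'a) sqmat" where
  "minverse I X = (THE Y. (\<forall>p q. p \<notin> I \<or> q \<notin> I \<longrightarrow> Y p q = 0)
     \<and> mmul I X Y = mone I \<and> mmul I Y X = mone I)"

definition elem_mat :: "'i \<Rightarrow> 'i \<Rightarrow> ('i, 'a::ring_1) sqmat" where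
  "elem_mat i j p q = (if p = i \<and> q = j then 1 else 0)"

text \<open>\<open>unskip a b\<close> is the order-preserving renumbering of the indices other than \<open>a < b\<close>; \<open>enlarge a b X\<close>
  is the matrix \<open>X\<close> enlarged by a block with upper right entry \<open>1\<close> in rows and columns \<open>a,b\<close>.\<close>

definition unskip :: "nat \<Rightarrow> nat \<Rightarrow> nat \<Rightarrow> nat" where
  "unskip a b i = i - (if a < i then 1 else 0) - (if b < i then 1 else 0)"

definition enlarge :: "nat \<Rightarrow> nat \<Rightarrow> (nat, 'a::ring_1) sqmat \<Rightarrow> (nat, 'a) sqmat" where
  "enlarge a b X i j = (if i \<in> {a,b} \<or> j \<in> {a,b} then (if i = a \<and> j = b then 1 else 0)
                        else X (unskip a b i) (unskip a b j))"

definition conj_elem :: "nat \<Rightarrow> nat \<Rightarrow> nat \<Rightarrow> (nat, 'a::ring_1) sqmat \<Rightarrow> (nat, 'a) sqmat" where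
  "conj_elem n i j X = (let F = madd (mone {1..n}) (elem_mat i j) in mmul {1..n} (mmul {1..n} F X) F)"

subsection \<open>Generators and boundary matrices\<close>

text \<open>A generator is a cell with a pair of sheets. Matrices are indexed by sheets, so that the choice of
  a total order of the sheets of each cell only matters in the conventions at swallowtails.\<close>

type_synonym ('m, 'l) generator = "'m set \<times> 'l set \<times> 'l set"
type_synonym ('m, 'l) cell_alg = "('m, 'l) generator free_alg"

definition generators ::
    "('m::topological_space, 'l::topological_space) legendrian \<Rightarrow> ('m, 'l) decomposition \<Rightarrow> ('m, 'l) generator set" where
  "generators \<Lambda> E = {(e,p,q). e \<in> cells E \<and> p \<in> sheets \<Lambda> e \<and> q \<in> sheets \<Lambda> e \<and> higher \<Lambda> p q}"

definition gen_degree ::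
    "('m::topological_space, 'l::topological_space) legendrian \<Rightarrow> ('m, 'l) decomposition \<Rightarrow> ('l \<Rightarrow> int) \<Rightarrow> ('m, 'l) generator \<Rightarrow> int" where
  "gen_degree \<Lambda> E \<mu> = (\<lambda>(e,p,q). sheet_degree \<Lambda> E \<mu> e p - sheet_degree \<Lambda> E \<mu> e q
     + (if e \<in> cells0 E then - 1 else if e \<in> cells1 E then 0 else 1))"

definition gen_mat ::
    "('m::topological_space, 'l::topological_space) legendrian \<Rightarrow> 'm set \<Rightarrow> ('l set, ('m, 'l) cell_alg) sqmat" where
  "gen_mat \<Lambda> e p q = (if p \<in> sheets \<Lambda> e \<and> q \<in> sheets \<Lambda> e \<and> higher \<Lambda> p q then gen (e,p,q) else 0)"

text \<open>Place a matrix indexed by \<open>I'\<close> in the rows and columns in the image of \<open>\<iota>\<close>.\<close>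

definition place :: "('i \<Rightarrow> 'i) \<Rightarrow> 'i set \<Rightarrow> ('i, 'a::ring_1) sqmat \<Rightarrow> ('i, 'a) sqmat" where
  "place \<iota> I' X p q = (if p \<in> \<iota> ` I' \<and> q \<in> \<iota> ` I' then X (inv_into I' \<iota> p) (inv_into I' \<iota> q) else 0)"

definition st_gen_mat ::
    "('m::topological_space, 'l::topological_space) legendrian \<Rightarrow> 'm set \<Rightarrow> (nat, ('m, 'l) cell_alg) sqmat" where
  "st_gen_mat \<Lambda> v i j = (if i \<in> {1..card (sheets \<Lambda> v)} \<and> j \<in> {1..card (sheets \<Lambda> v)}
     then gen_mat \<Lambda> v (nth_sheet \<Lambda> v i) (nth_sheet \<Lambda> v j) else 0)"

definition A_S ::
    "('m::topological_space, 'l::topological_space) legendrian \<Rightarrow> ('m, 'l) decomposition \<Rightarrow> 'm set \<Rightarrow> (nat, ('m, 'l) cell_alg) sqmat" where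
  "A_S \<Lambda> E v = (let n = card (sheets \<Lambda> v) + 2; k = st_no \<Lambda> v; X = enlarge k (k+2) (st_gen_mat \<Lambda> v) in
     if upward \<Lambda> E v then conj_elem n (k+2) (k+1) X else conj_elem n (k+1) k X)"

definition A_T ::
    "('m::topological_space, 'l::topological_space) legendrian \<Rightarrow> ('m, 'l) decomposition \<Rightarrow> 'm set \<Rightarrow> (nat, ('m, 'l) cell_alg) sqmat" where
  "A_T \<Lambda> E v = (let n = card (sheets \<Lambda> v) + 2; k = st_no \<Lambda> v in
     if upward \<Lambda> E v then conj_elem n (k+1) (k+2) (enlarge k (k+1) (st_gen_mat \<Lambda> v))
     else conj_elem n k (k+1) (enlarge (k+1) (k+2) (st_gen_mat \<Lambda> v)))"

definition mat_S ::
    "('m::topological_space, 'l::topological_space) legendrian \<Rightarrow> ('m, 'l) decomposition \<Rightarrow> 'm set \<Rightarrow> (nat, ('m, 'l) cell_alg) sqmat" where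
  "mat_S \<Lambda> E v i j = (let N = card (sheets \<Lambda> v); k = st_no \<Lambda> v; a = st_gen_mat \<Lambda> v in
     if upward \<Lambda> E v
     then mone {1..N+2} i j + (\<Sum>m\<in>{1..<k}. a m k * elem_mat m k i j) + elem_mat (k+1) (k+2) i j
     else mone {1..N+2} i j + (\<Sum>m\<in>{k<..N}. a k m * elem_mat (k+2) (m+2) i j) + elem_mat k (k+1) i j)"

definition mat_T ::
    "('m::topological_space, 'l::topological_space) legendrian \<Rightarrow> ('m, 'l) decomposition \<Rightarrow> 'm set \<Rightarrow> (nat, ('m, 'l) cell_alg) sqmat" where
  "mat_T \<Lambda> E v i j = (let N = card (sheets \<Lambda> v); k = st_no \<Lambda> v in
     mone {1..N+2} i j + (if upward \<Lambda> E v then elem_mat (k+1) (k+2) i j else elem_mat k (k+1) i j))"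

definition by_number ::
    "('m::topological_space, 'l::topological_space) legendrian \<Rightarrow> 'm set \<Rightarrow> (nat, 'a::ring_1) sqmat \<Rightarrow> ('l set, 'a) sqmat" where
  "by_number \<Lambda> e X p q =
     (if p \<in> sheets \<Lambda> e \<and> q \<in> sheets \<Lambda> e then X (sheet_no \<Lambda> e p) (sheet_no \<Lambda> e q) else 0)"

text \<open>The sheet order chosen for the crossing 1-cell agrees with that of the 2-cell of the corner \<open>S\<close>.\<close>

definition order_agrees_S ::
    "('m::topological_space, 'l::topological_space) legendrian \<Rightarrow> ('m, 'l) decomposition \<Rightarrow> 'm set \<Rightarrow> bool" where
  "order_agrees_S \<Lambda> E v \<longleftrightarrow> (\<forall>p\<in>sheets \<Lambda> (edge_cr E v). \<forall>q\<in>sheets \<Lambda> (edge_cr E v).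
     (p,q) \<in> sheet_order E (edge_cr E v) \<longleftrightarrow>
     (cr_to_S \<Lambda> E v p, cr_to_S \<Lambda> E v q) \<in> sheet_order E (fst (cornerS E v)))"

definition bdry_A1 ::
    "('m::topological_space, 'l::topological_space) legendrian \<Rightarrow> ('m, 'l) decomposition \<Rightarrow> 'm set \<Rightarrow> real \<Rightarrow> ('l set, ('m, 'l) cell_alg) sqmat" where
  "bdry_A1 \<Lambda> E e t = (let v = end1 E e t in
     if st_vertex \<Lambda> E v \<and> e = edge_cr E v then
       (if order_agrees_S \<Lambda> E v
        then (\<lambda>p q. by_number \<Lambda> (fst (cornerS E v)) (A_S \<Lambda> E v) (cr_to_S \<Lambda> E v p) (cr_to_S \<Lambda> E v q))
        else (\<lambda>p q. by_number \<Lambda> (fst (cornerT E v)) (A_T \<Lambda> E v) (cr_to_T \<Lambda> E v p) (cr_to_T \<Lambda> E v q)))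
     else madd (place (inc1 \<Lambda> E e t) (sheets \<Lambda> v) (gen_mat \<Lambda> v))
               (\<lambda>p q. if cusp_pair1 \<Lambda> E e t p q then 1 else 0))"

definition bdry_A2 ::
    "('m::topological_space, 'l::topological_space) legendrian \<Rightarrow> ('m, 'l) decomposition \<Rightarrow> 'm set \<Rightarrow> nat \<Rightarrow> ('l set, ('m, 'l) cell_alg) sqmat" where
  "bdry_A2 \<Lambda> E f j = (let v = vertex2 E f j in
     if st_vertex \<Lambda> E v \<and> (f,j) = cornerS E v then by_number \<Lambda> f (A_S \<Lambda> E v)
     else if st_vertex \<Lambda> E v \<and> (f,j) = cornerT E v then by_number \<Lambda> f (A_T \<Lambda> E v)
     else madd (place (inc2 \<Lambda> E f j) (sheets \<Lambda> v) (gen_mat \<Lambda> v))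
               (\<lambda>p q. if cusp_pair2 \<Lambda> E f j p q then 1 else 0))"

text \<open>The factor \<open>I + B_i\<close> of side \<open>i\<close>, multiplied by \<open>S\<close> or \<open>T\<close> for the two exceptional edges at a
  swallowtail (which are oriented away from it).\<close>

definition side_factor ::
    "('m::topological_space, 'l::topological_space) legendrian \<Rightarrow> ('m, 'l) decomposition \<Rightarrow> 'm set \<Rightarrow> nat \<Rightarrow> ('l set, ('m, 'l) cell_alg) sqmat" where
  "side_factor \<Lambda> E f i = (let e = side E f i; v = end1 E e 0;
       F = madd (mone (sheets \<Lambda> f)) (place (inc_side \<Lambda> E f i) (sheets \<Lambda> e) (gen_mat \<Lambda> e)) in
     if st_vertex \<Lambda> E v \<and> f = fst (cornerS E v) \<and> e = edge_S E v
       then mmul (sheets \<Lambda> f) F (by_number \<Lambda> f (mat_S \<Lambda> E v))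
     else if st_vertex \<Lambda> E v \<and> f = fst (cornerT E v) \<and> e = edge_T E v
       then mmul (sheets \<Lambda> f) F (by_number \<Lambda> f (mat_T \<Lambda> E v))
     else F)"

definition path_product ::
    "('m::topological_space, 'l::topological_space) legendrian \<Rightarrow> ('m, 'l) decomposition \<Rightarrow> 'm set \<Rightarrow> (nat \<times> bool) list \<Rightarrow> ('l set, ('m, 'l) cell_alg) sqmat" where
  "path_product \<Lambda> E f \<pi> = foldl (\<lambda>P (i,pos). mmul (sheets \<Lambda> f)
       (if pos then side_factor \<Lambda> E f i else minverse (sheets \<Lambda> f) (side_factor \<Lambda> E f i)) P)
     (mone (sheets \<Lambda> f)) \<pi>"

definition gen_boundary ::
    "('m::topological_space, 'l::topological_space) legendrian \<Rightarrow> ('m, 'l) decomposition \<Rightarrow> ('m, 'l) generator \<Rightarrow> ('m, 'l) cell_alg" where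
  "gen_boundary \<Lambda> E = (\<lambda>(e,p,q). let I = sheets \<Lambda> e; G = gen_mat \<Lambda> e in
     if e \<in> cells0 E then mmul I G G p q
     else if e \<in> cells1 E then
       mmul I (bdry_A1 \<Lambda> E e 1) (madd (mone I) G) p q + mmul I (madd (mone I) G) (bdry_A1 \<Lambda> E e 0) p q
     else
       mmul I (bdry_A2 \<Lambda> E e (v1 E e)) G p q + mmul I G (bdry_A2 \<Lambda> E e (v0 E e)) p q
         + path_product \<Lambda> E e (ccw_path E e) p q + path_product \<Lambda> E e (cw_path E e) p q)"

definition dga ::
    "('m::topological_space, 'l::topological_space) legendrian \<Rightarrow> ('m, 'l) decomposition \<Rightarrow> ('m, 'l) cell_alg set" where
  "dga \<Lambda> E = free_alg_on (generators \<Lambda> E)"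

definition dga_diff ::
    "('m::topological_space, 'l::topological_space) legendrian \<Rightarrow> ('m, 'l) decomposition \<Rightarrow> ('m, 'l) cell_alg \<Rightarrow> ('m, 'l) cell_alg" where
  "dga_diff \<Lambda> E = derivation (gen_boundary \<Lambda> E)"

definition augmentations ::
    "('m::topological_space, 'l::topological_space) legendrian \<Rightarrow> ('m, 'l) decomposition \<Rightarrow> (('m, 'l) cell_alg \<Rightarrow> bit) set" where
  "augmentations \<Lambda> E = {\<epsilon> \<in> extensional (dga \<Lambda> E). \<epsilon> 1 = 1
     \<and> (\<forall>a\<in>dga \<Lambda> E. \<forall>b\<in>dga \<Lambda> E. \<epsilon> (a + b) = \<epsilon> a + \<epsilon> b \<and> \<epsilon> (a * b) = \<epsilon> a * \<epsilon> b)
     \<and> (\<forall>a\<in>dga \<Lambda> E. \<epsilon> (dga_diff \<Lambda> E a) = 0)}"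

definition graded_augmentations ::
    "('m::topological_space, 'l::topological_space) legendrian \<Rightarrow> ('m, 'l) decomposition \<Rightarrow> ('l \<Rightarrow> int) \<Rightarrow> nat \<Rightarrow> (('m, 'l) cell_alg \<Rightarrow> bit) set" where
  "graded_augmentations \<Lambda> E \<mu> \<rho> = {\<epsilon> \<in> augmentations \<Lambda> E.
     \<forall>g\<in>generators \<Lambda> E. \<epsilon> (gen g) \<noteq> 0 \<longrightarrow> [gen_degree \<Lambda> E \<mu> g = 0] (mod int \<rho>)}"

section \<open>Chain homotopy diagrams\<close>

type_synonym 'l vec = "'l set \<Rightarrow> bit"

definition sheet_space :: "('m::topological_space, 'l::topological_space) legendrian \<Rightarrow> 'm set \<Rightarrow> 'l vec set" where
  "sheet_space \<Lambda> e = {v. \<forall>p. p \<notin> sheets \<Lambda> e \<longrightarrow> v p = 0}"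

definition basis_vec :: "'l set \<Rightarrow> 'l vec" where
  "basis_vec p = (\<lambda>q. if q = p then 1 else 0)"

definition vadd :: "'l vec \<Rightarrow> 'l vec \<Rightarrow> 'l vec" where
  "vadd v w = (\<lambda>p. v p + w p)"

definition form :: "('m::topological_space, 'l::topological_space) legendrian \<Rightarrow> 'm set \<Rightarrow> 'l vec \<Rightarrow> 'l vec \<Rightarrow> bit" where
  "form \<Lambda> e v w = (\<Sum>p\<in>sheets \<Lambda> e. v p * w p)"

definition endos :: "('m::topological_space, 'l::topological_space) legendrian \<Rightarrow> 'm set \<Rightarrow> ('l vec \<Rightarrow> 'l vec) set" where
  "endos \<Lambda> e = {T \<in> sheet_space \<Lambda> e \<rightarrow>\<^sub>E sheet_space \<Lambda> e.
     \<forall>v\<in>sheet_space \<Lambda> e. \<forall>w\<in>sheet_space \<Lambda> e. T (vadd v w) = vadd (T v) (T w)}"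

text \<open>The linear endomorphism with prescribed values on the basis.\<close>

definition lin_ext ::
    "('m::topological_space, 'l::topological_space) legendrian \<Rightarrow> 'm set \<Rightarrow> ('l set \<Rightarrow> 'l vec) \<Rightarrow> 'l vec \<Rightarrow> 'l vec" where
  "lin_ext \<Lambda> e g = (\<lambda>v\<in>sheet_space \<Lambda> e. \<lambda>p. \<Sum>q\<in>sheets \<Lambda> e. v q * g q p)"

definition strictly_upper ::
    "('m::topological_space, 'l::topological_space) legendrian \<Rightarrow> 'm set \<Rightarrow> ('l vec \<Rightarrow> 'l vec) \<Rightarrow> bool" where
  "strictly_upper \<Lambda> e T \<longleftrightarrow> (\<forall>p\<in>sheets \<Lambda> e. \<forall>q\<in>sheets \<Lambda> e.
     form \<Lambda> e (T (basis_vec q)) (basis_vec p) \<noteq> 0 \<longrightarrow> higher \<Lambda> p q)"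

text \<open>\<open>T\<close> maps the part of degree \<open>i\<close> into that of degree \<open>i + j\<close>, modulo \<open>\<rho>\<close>.\<close>

definition graded_part ::
    "('m::topological_space, 'l::topological_space) legendrian \<Rightarrow> ('m, 'l) decomposition \<Rightarrow> ('l \<Rightarrow> int) \<Rightarrow> nat \<Rightarrow> 'm set \<Rightarrow> int \<Rightarrow> 'l vec set" where
  "graded_part \<Lambda> E \<mu> \<rho> e i = {v \<in> sheet_space \<Lambda> e.
     \<forall>p\<in>sheets \<Lambda> e. v p \<noteq> 0 \<longrightarrow> [sheet_degree \<Lambda> E \<mu> e p = i] (mod int \<rho>)}"

definition has_degree ::
    "('m::topological_space, 'l::topological_space) legendrian \<Rightarrow> ('m, 'l) decomposition \<Rightarrow> ('l \<Rightarrow> int) \<Rightarrow> nat \<Rightarrow> 'm set \<Rightarrow> ('l vec \<Rightarrow> 'l vec) \<Rightarrow> int \<Rightarrow> bool" where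
  "has_degree \<Lambda> E \<mu> \<rho> e T j \<longleftrightarrow>
     (\<forall>i. T ` graded_part \<Lambda> E \<mu> \<rho> e i \<subseteq> graded_part \<Lambda> E \<mu> \<rho> e (i + j))"

text \<open>The inclusion of the span of \<open>I'\<close> induced by a map \<open>\<iota>\<close> of sheets.\<close>

definition push :: "('l set \<Rightarrow> 'l set) \<Rightarrow> 'l set set \<Rightarrow> 'l vec \<Rightarrow> 'l vec" where
  "push \<iota> I' v = (\<lambda>p. \<Sum>p'\<in>I'. v p' * basis_vec (\<iota> p') p)"

text \<open>The direct sum of \<open>T\<close>, defined on the span of \<open>I'\<close> and placed by \<open>\<iota>\<close>, with the map given by \<open>g\<close> on
  the remaining basis vectors.\<close>

definition dsum ::
    "('m::topological_space, 'l::topological_space) legendrian \<Rightarrow> 'm set \<Rightarrow> ('l set \<Rightarrow> 'l set) \<Rightarrow> 'l set set \<Rightarrow> ('l vec \<Rightarrow> 'l vec) \<Rightarrow> ('l set \<Rightarrow> 'l vec) \<Rightarrow> 'l vec \<Rightarrow> 'l vec" where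
  "dsum \<Lambda> e \<iota> I' T g = lin_ext \<Lambda> e (\<lambda>p. if p \<in> \<iota> ` I' then push \<iota> I' (T (basis_vec (inv_into I' \<iota> p))) else g p)"

definition handle ::
    "('m::topological_space, 'l::topological_space) legendrian \<Rightarrow> 'm set \<Rightarrow> nat \<Rightarrow> nat \<Rightarrow> 'l vec \<Rightarrow> 'l vec" where
  "handle \<Lambda> e u l = lin_ext \<Lambda> e (\<lambda>p. if p = nth_sheet \<Lambda> e l
     then vadd (basis_vec p) (basis_vec (nth_sheet \<Lambda> e u)) else basis_vec p)"

text \<open>For a swallowtail vertex \<open>v\<close> with differential \<open>d0\<close>, the map on the span of the sheets of \<open>f\<close> that
  equals \<open>d0\<close> on the span of the sheets with numbers other than \<open>a,b\<close> and sends sheet \<open>b\<close> to sheet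
  \<open>a\<close>.\<close>

definition st_enlarge ::
    "('m::topological_space, 'l::topological_space) legendrian \<Rightarrow> 'm set \<Rightarrow> 'm set \<Rightarrow> nat \<Rightarrow> nat \<Rightarrow> ('l vec \<Rightarrow> 'l vec) \<Rightarrow> 'l vec \<Rightarrow> 'l vec" where
  "st_enlarge \<Lambda> v f a b d0 = lin_ext \<Lambda> f (\<lambda>q.
     if sheet_no \<Lambda> f q = b then basis_vec (nth_sheet \<Lambda> f a)
     else if sheet_no \<Lambda> f q = a then (\<lambda>p. 0)
     else (\<lambda>p. if p \<notin> sheets \<Lambda> f \<or> sheet_no \<Lambda> f p \<in> {a,b} then 0
       else form \<Lambda> v (d0 (basis_vec (nth_sheet \<Lambda> v (unskip a b (sheet_no \<Lambda> f q)))))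
                     (basis_vec (nth_sheet \<Lambda> v (unskip a b (sheet_no \<Lambda> f p))))))"

definition hat_d_T ::
    "('m::topological_space, 'l::topological_space) legendrian \<Rightarrow> ('m, 'l) decomposition \<Rightarrow> 'm set \<Rightarrow> ('l vec \<Rightarrow> 'l vec) \<Rightarrow> 'l vec \<Rightarrow> 'l vec" where
  "hat_d_T \<Lambda> E v d0 = (let f = fst (cornerT E v); k = st_no \<Lambda> v in
     if upward \<Lambda> E v
     then handle \<Lambda> f (k+1) (k+2) \<circ> st_enlarge \<Lambda> v f k (k+1) d0 \<circ> handle \<Lambda> f (k+1) (k+2)
     else handle \<Lambda> f k (k+1) \<circ> st_enlarge \<Lambda> v f (k+1) (k+2) d0 \<circ> handle \<Lambda> f k (k+1))"

text \<open>Transport of an endomorphism from the span of the sheets of \<open>e'\<close> to that of \<open>e\<close> along a bijection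
  \<open>\<beta>\<close> from the sheets of \<open>e\<close> to those of \<open>e'\<close>.\<close>

definition transport ::
    "('m::topological_space, 'l::topological_space) legendrian \<Rightarrow> 'm set \<Rightarrow> ('l set \<Rightarrow> 'l set) \<Rightarrow> ('l vec \<Rightarrow> 'l vec) \<Rightarrow> 'l vec \<Rightarrow> 'l vec" where
  "transport \<Lambda> e \<beta> T = lin_ext \<Lambda> e (\<lambda>q p. if p \<in> sheets \<Lambda> e then T (basis_vec (\<beta> q)) (\<beta> p) else 0)"

definition S_to_T ::
    "('m::topological_space, 'l::topological_space) legendrian \<Rightarrow> ('m, 'l) decomposition \<Rightarrow> 'm set \<Rightarrow> 'l set \<Rightarrow> 'l set" where
  "S_to_T \<Lambda> E v p = cr_to_T \<Lambda> E v (inv_into (sheets \<Lambda> (edge_cr E v)) (cr_to_S \<Lambda> E v) p)"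

text \<open>Boundary differentials at the end \<open>t\<close> of a 1-cell and at corner \<open>j\<close> of a 2-cell, for a family \<open>d\<close>
  of differentials indexed by 0-cells.\<close>

definition hat_d1 ::
    "('m::topological_space, 'l::topological_space) legendrian \<Rightarrow> ('m, 'l) decomposition \<Rightarrow> ('m set \<Rightarrow> 'l vec \<Rightarrow> 'l vec) \<Rightarrow> 'm set \<Rightarrow> real \<Rightarrow> 'l vec \<Rightarrow> 'l vec" where
  "hat_d1 \<Lambda> E d e t = (let v = end1 E e t in
     if st_vertex \<Lambda> E v \<and> e = edge_cr E v then transport \<Lambda> e (cr_to_T \<Lambda> E v) (hat_d_T \<Lambda> E v (d v))
     else dsum \<Lambda> e (inc1 \<Lambda> E e t) (sheets \<Lambda> v) (d v)
            (\<lambda>q p. if cusp_pair1 \<Lambda> E e t p q then 1 else 0))"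

definition hat_d2 ::
    "('m::topological_space, 'l::topological_space) legendrian \<Rightarrow> ('m, 'l) decomposition \<Rightarrow> ('m set \<Rightarrow> 'l vec \<Rightarrow> 'l vec) \<Rightarrow> 'm set \<Rightarrow> nat \<Rightarrow> 'l vec \<Rightarrow> 'l vec" where
  "hat_d2 \<Lambda> E d f j = (let v = vertex2 E f j in
     if st_vertex \<Lambda> E v \<and> (f,j) = cornerS E v then transport \<Lambda> f (S_to_T \<Lambda> E v) (hat_d_T \<Lambda> E v (d v))
     else if st_vertex \<Lambda> E v \<and> (f,j) = cornerT E v then hat_d_T \<Lambda> E v (d v)
     else dsum \<Lambda> f (inc2 \<Lambda> E f j) (sheets \<Lambda> v) (d v)
            (\<lambda>q p. if cusp_pair2 \<Lambda> E f j p q then 1 else 0))"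

text \<open>In the products defining \<open>H_S\<close> the factors commute.\<close>

definition H_S ::
    "('m::topological_space, 'l::topological_space) legendrian \<Rightarrow> ('m, 'l) decomposition \<Rightarrow> 'm set \<Rightarrow> ('l vec \<Rightarrow> 'l vec) \<Rightarrow> 'l vec \<Rightarrow> 'l vec" where
  "H_S \<Lambda> E v d0 = (let f = fst (cornerS E v); k = st_no \<Lambda> v;
       b = (\<lambda>i. basis_vec (nth_sheet \<Lambda> v i)); js = [1..<card (sheets \<Lambda> v) + 1] in
     if upward \<Lambda> E v
     then foldr (\<circ>) (map (\<lambda>i. handle \<Lambda> f i k) (filter (\<lambda>i. form \<Lambda> v (d0 (b k)) (b i) \<noteq> 0) js))
            (handle \<Lambda> f (k+1) (k+2))
     else foldr (\<circ>) (map (\<lambda>j. handle \<Lambda> f (k+2) (j+2)) (filter (\<lambda>j. form \<Lambda> v (d0 (b j)) (b k) \<noteq> 0) js))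
            (handle \<Lambda> f k (k+1)))"

definition H_T ::
    "('m::topological_space, 'l::topological_space) legendrian \<Rightarrow> ('m, 'l) decomposition \<Rightarrow> 'm set \<Rightarrow> 'l vec \<Rightarrow> 'l vec" where
  "H_T \<Lambda> E v = (let f = fst (cornerT E v); k = st_no \<Lambda> v in
     if upward \<Lambda> E v then handle \<Lambda> f (k+1) (k+2) else handle \<Lambda> f k (k+1))"

definition hat_f ::
    "('m::topological_space, 'l::topological_space) legendrian \<Rightarrow> ('m, 'l) decomposition \<Rightarrow> ('m set \<Rightarrow> 'l vec \<Rightarrow> 'l vec) \<Rightarrow> ('m set \<Rightarrow> 'l vec \<Rightarrow> 'l vec) \<Rightarrow> 'm set \<Rightarrow> nat \<Rightarrow> 'l vec \<Rightarrow> 'l vec" where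
  "hat_f \<Lambda> E d F f i = (let e = side E f i; v = end1 E e 0;
       G = dsum \<Lambda> f (inc_side \<Lambda> E f i) (sheets \<Lambda> e) (F e) basis_vec in
     if st_vertex \<Lambda> E v \<and> f = fst (cornerS E v) \<and> e = edge_S E v then G \<circ> H_S \<Lambda> E v (d v)
     else if st_vertex \<Lambda> E v \<and> f = fst (cornerT E v) \<and> e = edge_T E v then G \<circ> H_T \<Lambda> E v
     else G)"

definition path_map ::
    "('m::topological_space, 'l::topological_space) legendrian \<Rightarrow> ('m, 'l) decomposition \<Rightarrow> ('m set \<Rightarrow> 'l vec \<Rightarrow> 'l vec) \<Rightarrow> ('m set \<Rightarrow> 'l vec \<Rightarrow> 'l vec) \<Rightarrow> 'm set \<Rightarrow> (nat \<times> bool) list \<Rightarrow> 'l vec \<Rightarrow> 'l vec" where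
  "path_map \<Lambda> E d F f \<pi> = foldl (\<lambda>P (i,pos).
       (if pos then hat_f \<Lambda> E d F f i else inv_into (sheet_space \<Lambda> f) (hat_f \<Lambda> E d F f i)) \<circ> P) id \<pi>"

text \<open>A diagram consists of families indexed by the 0-, 1- and 2-cells.\<close>

definition chain_homotopy_diagrams ::
    "('m::topological_space, 'l::topological_space) legendrian \<Rightarrow> ('m, 'l) decomposition \<Rightarrow>
     (('m set \<Rightarrow> 'l vec \<Rightarrow> 'l vec) \<times> ('m set \<Rightarrow> 'l vec \<Rightarrow> 'l vec) \<times> ('m set \<Rightarrow> 'l vec \<Rightarrow> 'l vec)) set" where
  "chain_homotopy_diagrams \<Lambda> E = {(d, F, K).
     d \<in> extensional (cells0 E) \<and> F \<in> extensional (cells1 E) \<and> K \<in> extensional (cells2 E)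
   \<and> (\<forall>e\<in>cells0 E. d e \<in> endos \<Lambda> e \<and> strictly_upper \<Lambda> e (d e)
        \<and> (\<forall>v\<in>sheet_space \<Lambda> e. d e (d e v) = (\<lambda>p. 0)))
   \<and> (\<forall>e\<in>cells1 E. F e \<in> endos \<Lambda> e \<and> strictly_upper \<Lambda> e (\<lambda>v p. F e v p - v p)
        \<and> (\<forall>v\<in>sheet_space \<Lambda> e. hat_d1 \<Lambda> E d e 1 (F e v) = F e (hat_d1 \<Lambda> E d e 0 v)))
   \<and> (\<forall>f\<in>cells2 E. K f \<in> endos \<Lambda> f \<and> strictly_upper \<Lambda> f (K f)
        \<and> (\<forall>v\<in>sheet_space \<Lambda> f. \<forall>p.
             path_map \<Lambda> E d F f (ccw_path E f) v p - path_map \<Lambda> E d F f (cw_path E f) v p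
             = hat_d2 \<Lambda> E d f (v1 E f) (K f v) p + K f (hat_d2 \<Lambda> E d f (v0 E f) v) p))}"

definition graded_CHDs ::
    "('m::topological_space, 'l::topological_space) legendrian \<Rightarrow> ('m, 'l) decomposition \<Rightarrow> ('l \<Rightarrow> int) \<Rightarrow> nat \<Rightarrow>
     (('m set \<Rightarrow> 'l vec \<Rightarrow> 'l vec) \<times> ('m set \<Rightarrow> 'l vec \<Rightarrow> 'l vec) \<times> ('m set \<Rightarrow> 'l vec \<Rightarrow> 'l vec)) set" where
  "graded_CHDs \<Lambda> E \<mu> \<rho> = {(d, F, K) \<in> chain_homotopy_diagrams \<Lambda> E.
     (\<forall>e\<in>cells0 E. has_degree \<Lambda> E \<mu> \<rho> e (d e) 1)
   \<and> (\<forall>e\<in>cells1 E. has_degree \<Lambda> E \<mu> \<rho> e (F e) 0)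
   \<and> (\<forall>f\<in>cells2 E. has_degree \<Lambda> E \<mu> \<rho> f (K f) (- 1))}"

end

theory Submission
  imports Defs
begin

text \<open>Both an augmentation and a chain homotopy diagram amount to a function \<open>x\<close> from the generators to
  \<open>Z/2\<close>: its values are the entries of the maps \<open>d\<close>, \<open>f - id\<close> and \<open>K\<close> in the bases given by the sheets.
  Evaluation at \<open>x\<close> is a ring homomorphism and takes the boundary matrices of the cellular DGA to the
  matrices of the boundary differentials and boundary morphisms, so that the vanishing of the evaluated
  differential of the generators is the system of equations defining a diagram, restricted to the entries
  \<open>(p,q)\<close> with \<open>p\<close> above \<open>q\<close>. The other entries vanish since all matrices involved are triangular.

  Triangularity rests on the fact that passing from the sheets over a boundary cell to those over a cell
  is injective and preserves the order. This is seen by taking limits of the sections of the base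
  projection at boundary points; such limits are unique because the base projection has discrete fibers.
  At a swallowtail, the matrices \<open>A_S\<close> and \<open>A_T\<close> differ by the transposition of the two crossing sheets,
  and their entries at this pair of sheets vanish.\<close>

section \<open>Evaluation of free algebras\<close>

text \<open>The sheet maps \<open>inc1\<close>, \<open>inc2\<close>, \<open>inc_side\<close> and the
  matrix \<open>minverse\<close> are definite descriptions, which say nothing until existence and
  uniqueness are known; much of the work goes into supplying these. For sheets, existence at a
  regular point comes from the local inverse of the base projection, and at a swallowtail point from
  the clauses of \<open>st_structure\<close> on sheets. Ends of edges, corners and points of sides
  are treated alike, as boundary points of a convex domain: a cell may return to the same point of
  M, so its closure has to be examined in the domain. For inverses, which arise when a side is
  traversed against its orientation, the entries lie in a noncommutative algebra. A further obstacle
  is that a diagram always transports its differential from the corner \<open>T\<close> to the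
  crossing edge, while the DGA uses \<open>A_S\<close> or \<open>A_T\<close> according to the chosen
  sheet order; the two have to be reconciled.\<close>

definition ev :: "('g \<Rightarrow> bit) \<Rightarrow> 'g free_alg \<Rightarrow> bit" where
  "ev x a = (\<Sum>w\<in>Poly_Mapping.keys a. Poly_Mapping.lookup a w * prod_list (map x (letters w)))"

text \<open>Keys may cancel in a sum, so additivity is proved by writing \<open>ev\<close> of both
  summands and of the sum over one common finite set of words.\<close>

lemma ev_superset:
  assumes "finite W" "Poly_Mapping.keys a \<subseteq> W"
  shows "ev x a = (\<Sum>w\<in>W. Poly_Mapping.lookup a w * prod_list (map x (letters w)))"
  unfolding ev_def using assms
  by (intro sum.mono_neutral_left) (auto simp: in_keys_iff)

lemma ev_add: "ev x (a + b) = ev x a + ev x b"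
proof -
  let ?W = "Poly_Mapping.keys a \<union> Poly_Mapping.keys b"
  have "ev x (a + b) = (\<Sum>w\<in>?W. Poly_Mapping.lookup (a + b) w * prod_list (map x (letters w)))"
    by (rule ev_superset) (auto simp: Poly_Mapping.keys_add)
  also have "\<dots> = ev x a + ev x b"
    by (simp only: ev_superset[of ?W] finite_UnI finite_keys Un_upper1 Un_upper2 lookup_add
        distrib_right sum.distrib)
  finally show ?thesis .
qed

lemma ev_0 [simp]: "ev x 0 = 0"
  by (simp add: ev_def)

lemma ev_single: "ev x (Poly_Mapping.single w c) = c * prod_list (map x (letters w))"
  by (cases "c = 0") (simp_all add: ev_def)

lemma ev_1 [simp]: "ev x 1 = 1"
  by (simp add: ev_single zero_fword_def flip: single_one)

lemma ev_gen [simp]: "ev x (gen g) = x g"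
  by (simp add: gen_def ev_single)

lemma ev_sum: "ev x (sum f I) = (\<Sum>i\<in>I. ev x (f i))"
  by (induction I rule: infinite_finite_induct) (simp_all add: ev_add)

lemma sum_monomials:
  "a = (\<Sum>w\<in>Poly_Mapping.keys a. Poly_Mapping.single w (Poly_Mapping.lookup a w))"
  by (rule poly_mapping_eqI) (simp add: lookup_sum lookup_single when_def in_keys_iff)

text \<open>Both sides are biadditive, so it suffices to compare products of monomials, where words
  are concatenated and coefficients multiplied.\<close>

lemma ev_mult: "ev x (a * b) = ev x a * ev x b"
proof -
  let ?s = "\<lambda>a w. Poly_Mapping.single w (Poly_Mapping.lookup a w)"
  have *: "ev x (?s a v * ?s b w) = ev x (?s a v) * ev x (?s b w)" for v w
    by (simp add: mult_single ev_single plus_fword_def)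
  have "ev x (a * b) =
     ev x ((\<Sum>v\<in>Poly_Mapping.keys a. ?s a v) * (\<Sum>w\<in>Poly_Mapping.keys b. ?s b w))"
    by (simp flip: sum_monomials)
  also have "\<dots> = ev x (\<Sum>v\<in>Poly_Mapping.keys a. ?s a v) * ev x (\<Sum>w\<in>Poly_Mapping.keys b. ?s b w)"
    unfolding sum_product ev_sum * ..
  finally show ?thesis
    by (simp flip: sum_monomials)
qed

lemma free_alg_on_simps [simp]:
  "0 \<in> free_alg_on G" "1 \<in> free_alg_on G"
  by (auto simp: free_alg_on_def zero_fword_def)

lemma gen_in_free_alg_on [simp]: "gen g \<in> free_alg_on G \<longleftrightarrow> g \<in> G"
  by (auto simp: free_alg_on_def gen_def)

lemma add_in_free_alg_on: "a \<in> free_alg_on G \<Longrightarrow> b \<in> free_alg_on G \<Longrightarrow> a + b \<in> free_alg_on G"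
  using Poly_Mapping.keys_add[of a b] by (fastforce simp: free_alg_on_def)

lemma uminus_in_free_alg_on: "a \<in> free_alg_on G \<Longrightarrow> - a \<in> free_alg_on G"
  by (simp add: free_alg_on_def in_keys_iff)

lemma mult_in_free_alg_on: "a \<in> free_alg_on G \<Longrightarrow> b \<in> free_alg_on G \<Longrightarrow> a * b \<in> free_alg_on G"
  using keys_mult[of a b] by (fastforce simp: free_alg_on_def plus_fword_def)

lemma sum_in_free_alg_on:
  "(\<And>i. i \<in> I \<Longrightarrow> f i \<in> free_alg_on G) \<Longrightarrow> sum f I \<in> free_alg_on G"
  by (induction I rule: infinite_finite_induct) (simp_all add: add_in_free_alg_on)

lemma single_in_free_alg_on:
  "set (letters w) \<subseteq> G \<Longrightarrow> Poly_Mapping.single w c \<in> free_alg_on G"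
  by (auto simp: free_alg_on_def split: if_splits)

lemma derivation_gen [simp]: "derivation D (gen g) = D g"
  by (simp add: derivation_def gen_def flip: zero_fword_def)

lemma derivation_in_free_alg_on:
  assumes "a \<in> free_alg_on G" "\<And>g. g \<in> G \<Longrightarrow> D g \<in> free_alg_on G"
  shows "derivation D a \<in> free_alg_on G"
  unfolding derivation_def
proof (intro sum_in_free_alg_on mult_in_free_alg_on single_in_free_alg_on)
  fix w i assume w: "w \<in> Poly_Mapping.keys a" "i \<in> {..<length (letters w)}"
  then have *: "set (letters w) \<subseteq> G"
    using assms(1) by (auto simp: free_alg_on_def)
  show "D (letters w ! i) \<in> free_alg_on G"
    using w * by (intro assms(2)) auto
  show "set (letters (FWord (take i (letters w)))) \<subseteq> G"
    using * set_take_subset[of i "letters w"] by auto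
  show "set (letters (FWord (drop (Suc i) (letters w)))) \<subseteq> G"
    using * set_drop_subset[of "Suc i" "letters w"] by auto
qed

text \<open>Every term of the Leibniz expansion of a word contains the factor \<open>D g\<close> for
  one of its letters. Hence the condition on an augmentation needs checking on generators
  only.\<close>

lemma ev_derivation_eq_0:
  assumes "a \<in> free_alg_on G" "\<And>g. g \<in> G \<Longrightarrow> ev x (D g) = 0"
  shows "ev x (derivation D a) = 0"
  unfolding derivation_def ev_sum ev_mult
proof (intro sum.neutral ballI)
  fix w i assume "w \<in> Poly_Mapping.keys a" "i \<in> {..<length (letters w)}"
  then have "letters w ! i \<in> G"
    using assms(1) nth_mem[of i "letters w"] by (auto simp: free_alg_on_def simp del: nth_mem)
  then show "ev x (Poly_Mapping.single (FWord (take i (letters w))) (Poly_Mapping.lookup a w)) *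
     ev x (D (letters w ! i)) * ev x (Poly_Mapping.single (FWord (drop (Suc i) (letters w))) 1) = 0"
    by (simp add: assms(2))
qed

lemma ev_cong:
  assumes "a \<in> free_alg_on G" "\<And>g. g \<in> G \<Longrightarrow> x g = y g"
  shows "ev x a = ev y a"
  unfolding ev_def
proof (rule sum.cong)
  fix w assume "w \<in> Poly_Mapping.keys a"
  then have "map x (letters w) = map y (letters w)"
    using assms by (auto simp: free_alg_on_def)
  then show "Poly_Mapping.lookup a w * prod_list (map x (letters w)) =
      Poly_Mapping.lookup a w * prod_list (map y (letters w))" by (simp only:)
qed simp

text \<open>An element is the sum of its monomials and each word is a product of generators. Scalars
  need no separate hypothesis, since the only nonzero coefficient in \<open>bit\<close> is
  1.\<close>

lemma algebra_map_eq_ev: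
  fixes \<epsilon> :: "'g free_alg \<Rightarrow> bit"
  assumes "\<epsilon> 1 = 1"
    and add: "\<And>a b. a \<in> free_alg_on G \<Longrightarrow> b \<in> free_alg_on G \<Longrightarrow> \<epsilon> (a + b) = \<epsilon> a + \<epsilon> b"
    and mult: "\<And>a b. a \<in> free_alg_on G \<Longrightarrow> b \<in> free_alg_on G \<Longrightarrow> \<epsilon> (a * b) = \<epsilon> a * \<epsilon> b"
    and a: "a \<in> free_alg_on G"
  shows "\<epsilon> a = ev (\<lambda>g. \<epsilon> (gen g)) a"
proof -
  have z: "\<epsilon> 0 = 0"
    using add[of 0 0] by simp
  have word: "\<epsilon> (Poly_Mapping.single (FWord l) 1) = prod_list (map (\<lambda>g. \<epsilon> (gen g)) l)"
    if "set l \<subseteq> G" for l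
    using that
  proof (induction l)
    case Nil
    then show ?case
      using assms(1) by (simp flip: zero_fword_def)
  next
    case (Cons g l)
    have "Poly_Mapping.single (FWord (g # l)) 1 = gen g * Poly_Mapping.single (FWord l) (1 :: bit)"
      by (simp add: gen_def mult_single plus_fword_def)
    then show ?case
      using Cons by (simp add: mult single_in_free_alg_on)
  qed
  have "\<epsilon> (\<Sum>w\<in>W. Poly_Mapping.single w (Poly_Mapping.lookup a w)) =
      (\<Sum>w\<in>W. Poly_Mapping.lookup a w * prod_list (map (\<lambda>g. \<epsilon> (gen g)) (letters w)))"
    if "finite W" "W \<subseteq> Poly_Mapping.keys a" for W
    using that
  proof (induction W rule: finite_induct)
    case empty
    then show ?case by (simp add: z)
  next
    case (insert w W)
    have w: "set (letters w) \<subseteq> G"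
      using a insert by (auto simp: free_alg_on_def)
    have 1: "Poly_Mapping.lookup a w = 1"
      using insert by (simp add: in_keys_iff)
    have "(\<Sum>w\<in>W. Poly_Mapping.single w (Poly_Mapping.lookup a w)) \<in> free_alg_on G"
      using a insert by (intro sum_in_free_alg_on single_in_free_alg_on) (auto simp: free_alg_on_def)
    then have "\<epsilon> (\<Sum>w\<in>insert w W. Poly_Mapping.single w (Poly_Mapping.lookup a w)) =
        \<epsilon> (Poly_Mapping.single (FWord (letters w)) 1)
        + \<epsilon> (\<Sum>w\<in>W. Poly_Mapping.single w (Poly_Mapping.lookup a w))"
      using insert(1,2) w 1 by (simp add: add single_in_free_alg_on)
    also have "\<dots> = (\<Sum>w\<in>insert w W. Poly_Mapping.lookup a w * prod_list (map (\<lambda>g. \<epsilon> (gen g)) (letters w)))"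
      using insert.IH insert.prems
      by (simp only: word[OF w] sum.insert[OF insert(1,2)] 1 mult_1 insert_subset)
    finally show ?case .
  qed
  from this[of "Poly_Mapping.keys a"] show ?thesis
    by (simp add: ev_def flip: sum_monomials)
qed

section \<open>Matrices\<close>

lemma mmul_cong:
  assumes "\<And>p q. p \<in> I \<Longrightarrow> q \<in> I \<Longrightarrow> X p q = X' p q" "\<And>p q. p \<in> I \<Longrightarrow> q \<in> I \<Longrightarrow> Y p q = Y' p q"
  shows "mmul I X Y = mmul I X' Y'"
  using assms by (auto simp: mmul_def fun_eq_iff intro!: sum.cong)

lemma mmul_assoc:
  "mmul I (mmul I X Y) Z = mmul I X (mmul I Y Z)"
proof (intro ext)
  fix p q
  have "(\<Sum>r\<in>I. (\<Sum>s\<in>I. X p s * Y s r) * Z r q) = (\<Sum>s\<in>I. X p s * (\<Sum>r\<in>I. Y s r * Z r q))"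
    unfolding sum_distrib_right sum_distrib_left mult.assoc by (rule sum.swap)
  then show "mmul I (mmul I X Y) Z p q = mmul I X (mmul I Y Z) p q"
    by (auto simp: mmul_def cong: sum.cong)
qed

lemma mmul_mone_left:
  assumes "finite I" "p \<in> I" "q \<in> I"
  shows "mmul I (mone I) X p q = X p q"
  using assms by (simp add: mmul_def mone_def if_distrib[of "\<lambda>u. u * _"] cong: if_cong)

lemma mmul_mone_right:
  assumes "finite I" "p \<in> I" "q \<in> I"
  shows "mmul I X (mone I) p q = X p q"
  using assms by (simp add: mmul_def mone_def if_distrib[of "\<lambda>u. _ * u"] eq_commute[of _ q] cong: if_cong)

text \<open>Products and identities vanish outside the index set by definition. This is the
  condition under which a matrix is determined, as a function on the whole type, by its entries in
  \<open>I\<close>; \<open>minverse\<close> ranges over such matrices.\<close>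

definition supported :: "'i set \<Rightarrow> ('i, 'a::ring_1) sqmat \<Rightarrow> bool" where
  "supported I X \<longleftrightarrow> (\<forall>p q. p \<notin> I \<or> q \<notin> I \<longrightarrow> X p q = 0)"

lemma supported_mmul [simp]: "supported I (mmul I X Y)"
  by (auto simp: supported_def mmul_def)

lemma supported_mone [simp]: "supported I (mone I)"
  by (auto simp: supported_def mone_def)

lemma mmul_mone_left_supported: "finite I \<Longrightarrow> supported I X \<Longrightarrow> mmul I (mone I) X = X"
  by (intro ext) (metis mmul_mone_left supported_def supported_mmul)

lemma mmul_mone_right_supported: "finite I \<Longrightarrow> supported I X \<Longrightarrow> mmul I X (mone I) = X"
  by (intro ext) (metis mmul_mone_right supported_def supported_mmul)

text \<open>If \<open>Z\<close> is another inverse then \<open>Z = Z (X Y) = (Z X) Y = Y\<close>;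
  support in \<open>I\<close> makes this an equality of functions and so settles the definite
  description.\<close>

lemma minverse_eqI:
  assumes "finite I" "supported I Y" "mmul I X Y = mone I" "mmul I Y X = mone I"
  shows "minverse I X = Y"
  unfolding minverse_def
proof (rule the_equality)
  fix Z assume "(\<forall>p q. p \<notin> I \<or> q \<notin> I \<longrightarrow> Z p q = 0) \<and> mmul I X Z = mone I \<and> mmul I Z X = mone I"
  then have Z: "supported I Z" "mmul I Z X = mone I"
    by (auto simp: supported_def)
  show "Z = Y"
    using assms Z
    by (metis mmul_assoc mmul_mone_left_supported mmul_mone_right_supported)
qed (use assms in \<open>auto simp: supported_def\<close>)

text \<open>Used with \<open>dga\<close> as the subring: the differential maps the DGA to itself
  because its matrices are built from generators by sums, products and inverses of unipotent
  matrices.\<close>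

locale subring =
  fixes R :: "'a::ring_1 set"
  assumes R_0 [simp]: "0 \<in> R" and R_1 [simp]: "1 \<in> R"
    and R_add: "a \<in> R \<Longrightarrow> b \<in> R \<Longrightarrow> a + b \<in> R"
    and R_uminus: "a \<in> R \<Longrightarrow> - a \<in> R"
    and R_mult: "a \<in> R \<Longrightarrow> b \<in> R \<Longrightarrow> a * b \<in> R"
begin

lemma R_sum: "(\<And>i. i \<in> I \<Longrightarrow> f i \<in> R) \<Longrightarrow> sum f I \<in> R"
  by (induction I rule: infinite_finite_induct) (auto intro: R_add)

lemma R_diff: "a \<in> R \<Longrightarrow> b \<in> R \<Longrightarrow> a - b \<in> R"
  using R_add[of a "- b"] R_uminus[of b] by simp

lemma mone_in_R: "mone I p q \<in> R"
  by (simp add: mone_def)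

lemma mmul_in_R:
  assumes "\<And>p q. p \<in> I \<Longrightarrow> q \<in> I \<Longrightarrow> X p q \<in> R" "\<And>p q. p \<in> I \<Longrightarrow> q \<in> I \<Longrightarrow> Y p q \<in> R"
  shows "mmul I X Y p q \<in> R"
  using assms by (auto simp: mmul_def intro!: R_sum R_mult)

end

lemma subring_free_alg_on: "subring (free_alg_on G)"
  by unfold_locales
    (auto intro: add_in_free_alg_on uminus_in_free_alg_on mult_in_free_alg_on)

section \<open>Triangular and unipotent matrices, and their inverses over a noncommutative
  ring\<close>

definition strict_upper :: "'i set \<Rightarrow> ('i \<Rightarrow> 'i \<Rightarrow> bool) \<Rightarrow> ('i, 'a::ring_1) sqmat \<Rightarrow> bool" where
  "strict_upper I lt X \<longleftrightarrow> (\<forall>p\<in>I. \<forall>q\<in>I. X p q \<noteq> 0 \<longrightarrow> lt p q)"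

definition unipotent :: "'i set \<Rightarrow> ('i \<Rightarrow> 'i \<Rightarrow> bool) \<Rightarrow> ('i, 'a::ring_1) sqmat \<Rightarrow> bool" where
  "unipotent I lt X \<longleftrightarrow> strict_upper I lt (\<lambda>p q. X p q - mone I p q)"

text \<open>The order is not assumed total, because sheets that cross above a cell are incomparable.
  Triangularity with respect to it therefore also forces the entries between crossing sheets to
  vanish.\<close>

locale finite_strict_order =
  fixes I :: "'i set" and lt :: "'i \<Rightarrow> 'i \<Rightarrow> bool"
  assumes fin [simp]: "finite I"
    and irrefl: "p \<in> I \<Longrightarrow> \<not> lt p p"
    and trans: "p \<in> I \<Longrightarrow> q \<in> I \<Longrightarrow> r \<in> I \<Longrightarrow> lt p q \<Longrightarrow> lt q r \<Longrightarrow> lt p r"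
begin

lemma strict_upper_mmul:
  assumes "strict_upper I lt X" "strict_upper I lt Y"
  shows "strict_upper I lt (mmul I X Y)"
  unfolding strict_upper_def
proof (intro ballI impI)
  fix p q assume pq: "p \<in> I" "q \<in> I" "mmul I X Y p q \<noteq> 0"
  then obtain r where "r \<in> I" "X p r * Y r q \<noteq> 0"
    by (metis (no_types, lifting) mmul_def sum.neutral)
  then show "lt p q"
    using assms pq by (metis mult_zero_left mult_zero_right strict_upper_def trans)
qed

lemma strict_upper_add:
  "strict_upper I lt X \<Longrightarrow> strict_upper I lt Y \<Longrightarrow> strict_upper I lt (\<lambda>p q. X p q + Y p q)"
  unfolding strict_upper_def by (metis add.right_neutral)

text \<open>With \<open>X = 1 + N\<close> and \<open>Y = 1 + N'\<close> this is
  \<open>XY = N N' + N + N' + 1\<close>, so that \<open>XY - 1\<close> is a sum of strictly upper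
  matrices whenever \<open>N\<close> and \<open>N'\<close> are.\<close>

lemma mmul_unipotent_expand:
  assumes "p \<in> I" "q \<in> I"
  shows "mmul I X Y p q = mmul I (\<lambda>p q. X p q - mone I p q) (\<lambda>p q. Y p q - mone I p q) p q
     + (X p q - mone I p q) + (Y p q - mone I p q) + mone I p q"
proof -
  have "mmul I X Y p q - (X p q - mone I p q) - Y p q
     = mmul I X Y p q - mmul I X (mone I) p q - mmul I (mone I) Y p q + mmul I (mone I) (mone I) p q"
    using assms by (simp add: mmul_mone_right mmul_mone_left)
  also have "\<dots> = mmul I (\<lambda>p q. X p q - mone I p q) (\<lambda>p q. Y p q - mone I p q) p q"
    using assms by (simp add: mmul_def algebra_simps sum.distrib sum_subtractf)
  finally show ?thesis
    by (simp add: algebra_simps)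
qed

lemma unipotent_mmul:
  assumes "unipotent I lt X" "unipotent I lt Y"
  shows "unipotent I lt (mmul I X Y)"
proof -
  let ?X = "\<lambda>p q. X p q - mone I p q" and ?Y = "\<lambda>p q. Y p q - mone I p q"
  have "strict_upper I lt (\<lambda>p q. mmul I ?X ?Y p q + ?X p q + ?Y p q)"
    using assms unfolding unipotent_def
    by (intro strict_upper_add strict_upper_mmul)
  then show ?thesis
    unfolding unipotent_def strict_upper_def
    by (simp only: mmul_unipotent_expand[of _ _ X Y] add_diff_cancel_right' cong: ball_cong)
qed

lemma unipotent_mone: "unipotent I lt (mone I)"
  by (simp add: unipotent_def strict_upper_def)

lemma unipotent_right_inverse:
  fixes X :: "('i, 'a::ring_1) sqmat"
  assumes X: "unipotent I lt X" "\<And>p q. p \<in> I \<Longrightarrow> q \<in> I \<Longrightarrow> X p q \<in> R" and "subring R"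
  shows "\<exists>Y. supported I Y \<and> unipotent I lt Y \<and> (\<forall>p q. Y p q \<in> R) \<and> mmul I X Y = mone I"
proof -
  interpret subring R by fact
  define N where "N = (\<lambda>p q. mone I p q - X p q)"
  have N: "strict_upper I lt N"
    using X(1) unfolding unipotent_def strict_upper_def N_def by force
  \<comment> \<open>\<open>rk q < rk p\<close> whenever \<open>N p q \<noteq> 0\<close>, so \<open>N\<close> is nilpotent and the geometric series inverting \<open>X = 1 - N\<close> is finite.\<close>
  define P where "P = (\<lambda>k. (mmul I N ^^ k) (mone I))"
  have P0: "P 0 = mone I" and PS: "P (Suc k) = mmul I N (P k)" for k
    by (simp_all add: P_def)
  define rk where "rk = (\<lambda>p. card {r\<in>I. lt p r})"
  have rk_less: "rk q < rk p" if "p \<in> I" "q \<in> I" "lt p q" for p q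
  proof -
    have "{r\<in>I. lt q r} \<subseteq> {r\<in>I. lt p r}"
      using that trans by blast
    moreover have "q \<in> {r\<in>I. lt p r}" "q \<notin> {r\<in>I. lt q r}"
      using that irrefl by auto
    ultimately show ?thesis
      unfolding rk_def by (intro psubset_card_mono) auto
  qed
  have P_rk: "p \<in> I \<Longrightarrow> q \<in> I \<Longrightarrow> P k p q \<noteq> 0 \<Longrightarrow> rk q + k \<le> rk p" for k p q
  proof (induction k arbitrary: p)
    case 0
    then show ?case by (auto simp: P0 mone_def split: if_splits)
  next
    case (Suc k)
    then obtain r where r: "r \<in> I" "N p r * P k r q \<noteq> 0"
      by (metis (no_types, lifting) PS mmul_def sum.neutral)
    then have *: "N p r \<noteq> 0" "P k r q \<noteq> 0"
      by auto
    have "rk q + k \<le> rk r"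
      using Suc.IH[OF r(1)] Suc.prems * by blast
    moreover have "rk r < rk p"
      using N * r(1) Suc.prems by (intro rk_less) (auto simp: strict_upper_def)
    ultimately show ?case by simp
  qed
  have Psupp: "supported I (P k)" for k
    by (cases k) (simp_all add: P0 PS)
  have PSup: "strict_upper I lt (P (Suc k))" for k
  proof (induction k)
    case 0
    then show ?case
      using N unfolding PS P0 strict_upper_def by (simp add: mmul_mone_right)
  next
    case (Suc k)
    then show ?case
      unfolding PS[of "Suc k"] by (intro strict_upper_mmul N)
  qed
  have PR: "P k p q \<in> R" for k p q
  proof (induction k arbitrary: p q)
    case (Suc k)
    then show ?case
      unfolding PS by (intro mmul_in_R) (auto simp: N_def intro!: R_diff mone_in_R X)
  qed (simp add: P0 mone_in_R)
  \<comment> \<open>Since \<open>rk\<close> takes values between 0 and \<open>card I\<close>, a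
    nonzero entry of a power of \<open>N\<close> with exponent greater than \<open>card I\<close>
    would violate \<open>P_rk\<close>.\<close>
  define n where "n = Suc (card I)"
  have "P n p q = 0" for p q
  proof (rule ccontr)
    assume "P n p q \<noteq> 0"
    then have "rk q + n \<le> rk p"
      using P_rk Psupp by (metis supported_def)
    moreover have "rk p \<le> card I"
      unfolding rk_def by (intro card_mono) auto
    ultimately show False by (simp add: n_def)
  qed
  then have Pn: "P n = (\<lambda>p q. 0)" by (simp add: fun_eq_iff)
  define Y where "Y = (\<lambda>p q. \<Sum>k<n. P k p q)"
  \<comment> \<open>Splitting off the identity leaves only powers with positive exponent, which are
    strictly upper; this yields unipotence of the inverse.\<close>
  have Y: "Y p q = mone I p q + (\<Sum>k<card I. P (Suc k) p q)" for p q
    unfolding Y_def n_def sum.lessThan_Suc_shift P0 ..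
  have "mmul I X Y p q = mone I p q" for p q
  proof (cases "p \<in> I \<and> q \<in> I")
    case True
    have "mmul I N Y p q = (\<Sum>k<n. P (Suc k) p q)"
      using True unfolding Y_def PS mmul_def by (simp add: sum_distrib_left sum.swap[of _ _ I])
    moreover have "Y p q = mmul I (mone I) Y p q"
      using True by (simp add: mmul_mone_left)
    ultimately have "mmul I X Y p q = Y p q - (\<Sum>k<n. P (Suc k) p q)"
      using True by (simp add: mmul_def N_def algebra_simps sum_subtractf)
    \<comment> \<open>Multiplying the geometric sum by \<open>1 - N\<close> telescopes, and the last
      power is zero.\<close>
    also have "\<dots> = P 0 p q - P n p q"
      unfolding Y_def sum_subtractf[symmetric] by (rule sum_lessThan_telescope')
    finally show ?thesis by (simp add: Pn P0)
  next
    case False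
    then show ?thesis by (auto simp: mmul_def mone_def)
  qed
  then have "mmul I X Y = mone I" by blast
  moreover have "supported I Y"
    using Psupp by (auto simp: supported_def Y_def)
  moreover have "unipotent I lt Y"
    unfolding unipotent_def strict_upper_def
  proof (intro ballI impI)
    fix p q assume "p \<in> I" "q \<in> I" "Y p q - mone I p q \<noteq> 0"
    then obtain k where "P (Suc k) p q \<noteq> 0"
      unfolding Y by (metis (no_types, lifting) add_diff_cancel_left' sum.neutral)
    then show "lt p q"
      using PSup \<open>p \<in> I\<close> \<open>q \<in> I\<close> by (auto simp: strict_upper_def)
  qed
  moreover have "Y p q \<in> R" for p q
    unfolding Y_def by (intro R_sum PR)
  ultimately show ?thesis by blast
qed

text \<open>Over a noncommutative ring a right inverse \<open>Y\<close> of \<open>X\<close> has to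
  be shown to be a left inverse. As \<open>Y\<close> is again unipotent with entries in
  \<open>R\<close>, it has a right inverse \<open>Z\<close>, and
  \<open>Y X = Y X (Y Z) = Y (X Y) Z = Y Z = 1\<close>.\<close>

lemma unipotent_inverse:
  fixes X :: "('i, 'a::ring_1) sqmat"
  assumes X: "unipotent I lt X" "\<And>p q. p \<in> I \<Longrightarrow> q \<in> I \<Longrightarrow> X p q \<in> R" and R: "subring R"
  shows "supported I (minverse I X)" "unipotent I lt (minverse I X)" "minverse I X p q \<in> R"
    "mmul I X (minverse I X) = mone I" "mmul I (minverse I X) X = mone I"
proof -
  obtain Y where Y: "supported I Y" "unipotent I lt Y" "\<And>p q. Y p q \<in> R" "mmul I X Y = mone I"
    using unipotent_right_inverse[OF assms] by auto
  obtain Z where Z: "supported I Z" "mmul I Y Z = mone I"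
    using unipotent_right_inverse[OF Y(2,3) R] by auto
  have "mmul I Y X = mmul I Y (mmul I X (mmul I Y Z))"
    unfolding Z(2) by (intro mmul_cong) (simp_all add: mmul_mone_right)
  also have "\<dots> = mmul I Y (mmul I (mmul I X Y) Z)"
    by (simp add: mmul_assoc)
  also have "\<dots> = mone I"
    using Y Z by (simp add: mmul_mone_left_supported)
  finally have YX: "mmul I Y X = mone I" .
  have "minverse I X = Y"
    by (intro minverse_eqI Y YX) simp
  then show "supported I (minverse I X)" "unipotent I lt (minverse I X)" "minverse I X p q \<in> R"
    "mmul I X (minverse I X) = mone I" "mmul I (minverse I X) X = mone I"
    using Y YX by auto
qed

end

lemma ev_mmul: "ev x (mmul I X Y p q) = mmul I (\<lambda>p q. ev x (X p q)) (\<lambda>p q. ev x (Y p q)) p q"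
  by (simp add: mmul_def ev_sum ev_mult)

lemma ev_mone [simp]: "ev x (mone I p q) = mone I p q"
  by (auto simp add: mone_def)

section \<open>Sheets over a cell and over its boundary\<close>

lemma front_formE:
  assumes "front_form \<Lambda> F q"
  obtains N \<theta> \<psi> P \<kappa> \<kappa>' where "open N" "open (\<theta> ` N)" "homeomorphism N (\<theta> ` N) \<theta> \<psi>"
    "open P" "homeomorphism P (\<kappa> ` P) \<kappa> \<kappa>'" "q \<in> N" "base \<Lambda> ` N \<subseteq> P" "\<theta> q = 0"
    "\<kappa> (base \<Lambda> q) = 0" "\<And>q'. q' \<in> N \<Longrightarrow> \<kappa> (base \<Lambda> q') = fst (F (\<theta> q'))"
proof -
  from assms obtain N \<theta> P \<kappa> g where *: "smooth_chart (atlasL \<Lambda>) (N,\<theta>)"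
    "smooth_chart (atlasM \<Lambda>) (P,\<kappa>)" "q \<in> N" "base \<Lambda> ` N \<subseteq> P" "\<theta> q = 0"
    "\<kappa> (base \<Lambda> q) = 0" "\<forall>q'\<in>N. \<kappa> (base \<Lambda> q') = fst (F (\<theta> q'))"
    unfolding front_form_def by blast
  from *(1) obtain \<psi> where N: "open N" "open (\<theta> ` N)" "homeomorphism N (\<theta> ` N) \<theta> \<psi>"
    unfolding smooth_chart_def smooth_atlas_def by auto
  from *(2) obtain \<kappa>' where P: "open P" "homeomorphism P (\<kappa> ` P) \<kappa> \<kappa>'"
    unfolding smooth_chart_def smooth_atlas_def by auto
  show thesis
    by (rule that[OF N P *(3-6) bspec[OF *(7)]])
qed

text \<open>Supplies points of the surface with prescribed small coordinates inside an arbitrary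
  neighborhood of \<open>q\<close>.\<close>

lemma chart_neighborhood:
  fixes \<theta> :: "'a::topological_space \<Rightarrow> plane"
  assumes "open N" "open (\<theta> ` N)" "homeomorphism N (\<theta> ` N) \<theta> \<psi>" "q \<in> N" "\<theta> q = 0" "open W" "q \<in> W"
  obtains r where "r > 0" "\<And>u. norm u \<le> r \<Longrightarrow> \<psi> u \<in> N \<inter> W \<and> \<theta> (\<psi> u) = u"
proof -
  have "open (\<theta> ` N \<inter> \<psi> -` (N \<inter> W))"
    using assms by (intro continuous_open_preimage) (auto simp: homeomorphism_def)
  moreover have "0 \<in> \<theta> ` N \<inter> \<psi> -` (N \<inter> W)"
    using assms homeomorphism_apply1[OF assms(3,4)] by force
  ultimately obtain r where "r > 0" "cball 0 r \<subseteq> \<theta> ` N \<inter> \<psi> -` (N \<inter> W)"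
    by (meson open_contains_cball)
  then show thesis
    using assms(3) by (intro that[of r]) (fastforce simp: subset_iff homeomorphism_def)+
qed

text \<open>The base component \<open>(u^2, v)\<close> of the cusp model identifies
  \<open>(r,0)\<close> with \<open>(-r,0)\<close> for every small \<open>r\<close>. Consequently no
  cusp point lies in an open set on which the base projection is injective.\<close>

lemma cusp_double_points:
  assumes "c \<in> cusps \<Lambda>" "open W" "c \<in> W"
  shows "\<exists>a\<in>W. \<exists>b\<in>W. a \<noteq> b \<and> base \<Lambda> a = base \<Lambda> b"
proof -
  obtain N \<theta> \<psi> P \<kappa> \<kappa>' where *: "open N" "open (\<theta> ` N)" "homeomorphism N (\<theta> ` N) \<theta> \<psi>"
    "open P" "homeomorphism P (\<kappa> ` P) \<kappa> \<kappa>'" "c \<in> N" "base \<Lambda> ` N \<subseteq> P" "\<theta> c = 0"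
    "\<kappa> (base \<Lambda> c) = 0"
    "\<And>q'. q' \<in> N \<Longrightarrow> \<kappa> (base \<Lambda> q') = fst ((\<lambda>(u,v). ((u^2, v), u^3)) (\<theta> q') :: plane \<times> real)"
    by (rule front_formE[OF assms(1)[unfolded cusps_def mem_Collect_eq]]) (rule that; assumption)
  obtain r where r: "r > 0" "\<And>u. norm u \<le> r \<Longrightarrow> \<psi> u \<in> N \<inter> W \<and> \<theta> (\<psi> u) = u"
    using chart_neighborhood[OF *(1-3,6,8) assms(2,3)] by blast
  let ?a = "\<psi> (r,0)" and ?b = "\<psi> (-r,0)"
  have a: "?a \<in> N \<inter> W" "\<theta> ?a = (r,0)" "?b \<in> N \<inter> W" "\<theta> ?b = (-r,0)"
    using r by (auto simp: norm_Pair)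
  have "?a \<noteq> ?b"
    using a(2,4) r(1) by auto
  have "\<kappa> (base \<Lambda> ?a) = \<kappa> (base \<Lambda> ?b)"
    using a *(10)[of ?a] *(10)[of ?b] by simp
  moreover have "base \<Lambda> ?a \<in> P" "base \<Lambda> ?b \<in> P"
    using a *(7) by auto
  ultimately have "base \<Lambda> ?a = base \<Lambda> ?b"
    using homeomorphism_apply1[OF *(5)] by metis
  then show ?thesis
    using a \<open>?a \<noteq> ?b\<close> by blast
qed

text \<open>The two swallowtail models differ only in the sign of the height, so for questions about
  the base projection they need not be distinguished.\<close>

lemma swallowtail_fst:
  assumes "s \<in> swallowtails \<Lambda>"
  obtains N \<theta> \<psi> P \<kappa> \<kappa>' where "open N" "open (\<theta> ` N)" "homeomorphism N (\<theta> ` N) \<theta> \<psi>"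
    "open P" "homeomorphism P (\<kappa> ` P) \<kappa> \<kappa>'" "s \<in> N" "base \<Lambda> ` N \<subseteq> P" "\<theta> s = 0"
    "\<kappa> (base \<Lambda> s) = 0"
    "\<And>q'. q' \<in> N \<Longrightarrow> \<kappa> (base \<Lambda> q') = (\<lambda>(t::real,a). (a, - 4*t^3 - 2*a*t)) (\<theta> q')"
proof -
  obtain F where F: "front_form \<Lambda> F s" "\<And>t a. fst (F (t,a)) = (a, - 4*t^3 - 2*a*t)"
    using assms unfolding swallowtails_def by fastforce
  obtain N \<theta> \<psi> P \<kappa> \<kappa>' where *: "open N" "open (\<theta> ` N)" "homeomorphism N (\<theta> ` N) \<theta> \<psi>"
    "open P" "homeomorphism P (\<kappa> ` P) \<kappa> \<kappa>'" "s \<in> N" "base \<Lambda> ` N \<subseteq> P" "\<theta> s = 0"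
    "\<kappa> (base \<Lambda> s) = 0" "\<And>q'. q' \<in> N \<Longrightarrow> \<kappa> (base \<Lambda> q') = fst (F (\<theta> q'))"
    by (rule front_formE[OF F(1)]) (rule that; assumption)
  show thesis
    by (rule that[OF *(1-9)]) (simp add: *(10) F(2) split: prod.splits)
qed

text \<open>Near a cusp point the base projection is at most two-to-one, whereas every neighborhood of a
  swallowtail point contains three points with the same base projection.\<close>

lemma cusps_Int_swallowtails: "cusps \<Lambda> \<inter> swallowtails \<Lambda> = {}"
proof (rule ccontr)
  assume "cusps \<Lambda> \<inter> swallowtails \<Lambda> \<noteq> {}"
  then obtain c where c: "c \<in> cusps \<Lambda>" "c \<in> swallowtails \<Lambda>" by blast
  obtain W \<theta>1 \<psi>1 P1 \<kappa>1 \<kappa>1' where 1: "open W" "open (\<theta>1 ` W)" "homeomorphism W (\<theta>1 ` W) \<theta>1 \<psi>1"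
    "open P1" "homeomorphism P1 (\<kappa>1 ` P1) \<kappa>1 \<kappa>1'" "c \<in> W" "base \<Lambda> ` W \<subseteq> P1" "\<theta>1 c = 0"
    "\<kappa>1 (base \<Lambda> c) = 0"
    "\<And>q'. q' \<in> W \<Longrightarrow> \<kappa>1 (base \<Lambda> q') = fst ((\<lambda>(u,v). ((u^2, v), u^3)) (\<theta>1 q') :: plane \<times> real)"
    by (rule front_formE[OF c(1)[unfolded cusps_def mem_Collect_eq]]) (rule that; assumption)
  have two: "x = y \<or> x = z \<or> y = z" if "x \<in> W" "y \<in> W" "z \<in> W" "base \<Lambda> x = base \<Lambda> y" "base \<Lambda> x = base \<Lambda> z"
    for x y z
  proof -
    have "fst (\<theta>1 x)^2 = fst (\<theta>1 y)^2" "fst (\<theta>1 x)^2 = fst (\<theta>1 z)^2"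
      "snd (\<theta>1 x) = snd (\<theta>1 y)" "snd (\<theta>1 x) = snd (\<theta>1 z)"
      using that 1(10)[of x] 1(10)[of y] 1(10)[of z] by (auto split: prod.splits)
    then have "\<theta>1 x = \<theta>1 y \<or> \<theta>1 x = \<theta>1 z \<or> \<theta>1 y = \<theta>1 z"
      unfolding power2_eq_iff prod_eq_iff by auto
    then show ?thesis
      using that 1(3) by (metis homeomorphism_apply1)
  qed
  obtain N \<theta> \<psi> P \<kappa> \<kappa>' where *: "open N" "open (\<theta> ` N)" "homeomorphism N (\<theta> ` N) \<theta> \<psi>"
    "open P" "homeomorphism P (\<kappa> ` P) \<kappa> \<kappa>'" "c \<in> N" "base \<Lambda> ` N \<subseteq> P" "\<theta> c = 0"
    "\<kappa> (base \<Lambda> c) = 0" "\<And>q'. q' \<in> N \<Longrightarrow> \<kappa> (base \<Lambda> q') = (\<lambda>(t::real,a). (a, - 4*t^3 - 2*a*t)) (\<theta> q')"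
    by (rule swallowtail_fst[OF c(2)]) (rule that; assumption)
  obtain r where r: "r > 0" "\<And>u. norm u \<le> r \<Longrightarrow> \<psi> u \<in> N \<inter> W \<and> \<theta> (\<psi> u) = u"
    using chart_neighborhood[OF *(1-3,6,8) 1(1,6)] by blast
  \<comment> \<open>For \<open>a = - 2 * \<delta>^2\<close> the second coordinate
    \<open>- 4*t^3 - 2*a*t\<close> equals \<open>- 4*t*(t^2 - \<delta>^2)\<close>, which vanishes at
    the three values 0, \<open>\<delta>\<close> and \<open>-\<delta>\<close> of \<open>t\<close>.
    The bounds 1 and \<open>r / 3\<close> give
    \<open>\<delta> + 2*\<delta>^2 \<le> 3*\<delta> \<le> r\<close>, so that these points lie in
    both charts.\<close>
  define \<delta> where "\<delta> = min 1 (r / 3)"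
  have \<delta>: "\<delta> > 0" "\<delta> \<le> 1" "\<delta> \<le> r / 3"
    using r(1) by (auto simp: \<delta>_def)
  have small: "norm (\<tau>, - 2 * \<delta>\<^sup>2) \<le> r" if "\<bar>\<tau>\<bar> \<le> \<delta>" for \<tau>
  proof -
    have "norm (\<tau>, - 2 * \<delta>\<^sup>2) \<le> norm \<tau> + norm (- 2 * \<delta>\<^sup>2)"
      by (rule norm_Pair_le)
    also have "\<dots> \<le> \<delta> + 2 * \<delta>"
    proof -
      have "\<delta> * \<delta> \<le> \<delta> * 1"
        using \<delta> by (intro mult_left_mono) auto
      then show ?thesis
        using that by (simp add: power2_eq_square)
    qed
    finally show ?thesis
      using \<delta> by simp
  qed
  define pt where "pt = (\<lambda>\<tau>. \<psi> (\<tau>, - 2 * \<delta>\<^sup>2))"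
  have pt: "pt \<tau> \<in> N" "pt \<tau> \<in> W" "\<theta> (pt \<tau>) = (\<tau>, - 2 * \<delta>\<^sup>2)" if "\<bar>\<tau>\<bar> \<le> \<delta>" for \<tau>
    using r(2)[OF small[OF that]] unfolding pt_def by blast+
  have "base \<Lambda> (pt \<tau>) = base \<Lambda> (pt 0)" if "\<tau> \<in> {\<delta>, -\<delta>}" for \<tau>
  proof -
    have \<tau>: "\<bar>\<tau>\<bar> \<le> \<delta>" "\<bar>0\<bar> \<le> \<delta>"
      using that \<delta> by auto
    have "\<kappa> (base \<Lambda> (pt \<tau>)) = \<kappa> (base \<Lambda> (pt 0))"
      using *(10)[OF pt(1)[OF \<tau>(1)]] *(10)[OF pt(1)[OF \<tau>(2)]] pt(3)[OF \<tau>(1)] pt(3)[OF \<tau>(2)] that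
      by (auto simp: power2_eq_square power3_eq_cube)
    then show ?thesis
      using pt(1) \<tau> *(5,7) by (metis homeomorphism_apply1 image_subset_iff)
  qed
  then have "pt 0 = pt \<delta> \<or> pt 0 = pt (-\<delta>) \<or> pt \<delta> = pt (-\<delta>)"
    using \<delta> pt by (intro two) auto
  then show False
    using pt(3)[of 0] pt(3)[of \<delta>] pt(3)[of "-\<delta>"] \<delta> by auto
qed

lemma smooth_atlasD:
  assumes "smooth_atlas A"
  shows "\<exists>U \<phi>. (U,\<phi>) \<in> A \<and> x \<in> U"
    "(U,\<phi>) \<in> A \<Longrightarrow> open U" "(U,\<phi>) \<in> A \<Longrightarrow> \<exists>\<psi>. homeomorphism U (\<phi> ` U) \<phi> \<psi>"
proof -
  have *: "(\<Union>c\<in>A. fst c) = UNIV"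
    "\<forall>(U,\<phi>)\<in>A. open U \<and> open (\<phi> ` U) \<and> (\<exists>\<psi>. homeomorphism U (\<phi> ` U) \<phi> \<psi>)"
    using assms unfolding smooth_atlas_def by blast+
  have "x \<in> (\<Union>c\<in>A. fst c)"
    by (simp add: *(1))
  then show "\<exists>U \<phi>. (U,\<phi>) \<in> A \<and> x \<in> U"
    by auto
  show "(U,\<phi>) \<in> A \<Longrightarrow> open U" "(U,\<phi>) \<in> A \<Longrightarrow> \<exists>\<psi>. homeomorphism U (\<phi> ` U) \<phi> \<psi>"
    using *(2) by auto
qed

section \<open>Consequences of the hypotheses on the surface and on the decomposition\<close>

locale legendrian_setting =
  fixes \<Lambda> :: "('m::{t2_space,second_countable_topology}, 'l::{t2_space,second_countable_topology}) legendrian"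
    and E :: "('m, 'l) decomposition"
  assumes legendrian: "legendrian_surface \<Lambda>"
    and generic: "generic_projections \<Lambda>"
    and compatible: "compatible_decomposition \<Lambda> E"
begin

lemma continuous_base: "continuous_on UNIV (base \<Lambda>)"
  using legendrian by (simp add: legendrian_surface_def)

lemma open_base_vimage: "open W \<Longrightarrow> open (base \<Lambda> -` W)"
  using continuous_base by (simp add: continuous_on_open_vimage)

lemma compact_L: "compact (UNIV :: 'l set)"
  using legendrian by (simp add: legendrian_surface_def)

text \<open>The definition of the surface gives smoothness of the height only in coordinates;
  continuity follows by composing the differentiable coordinate expression with a chart of the
  atlas.\<close>

lemma continuous_ht: "isCont (ht \<Lambda>) q"
proof -
  have A: "smooth_atlas (atlasM \<Lambda>)" "smooth_atlas (atlasL \<Lambda>)"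
    using legendrian by (auto simp: legendrian_surface_def)
  obtain U \<phi> where U: "(U,\<phi>) \<in> atlasM \<Lambda>" "base \<Lambda> q \<in> U"
    using smooth_atlasD(1)[OF A(1)] by blast
  obtain W \<theta> where W: "(W,\<theta>) \<in> atlasL \<Lambda>" "q \<in> W"
    using smooth_atlasD(1)[OF A(2)] by blast
  obtain \<psi> where "open W" "homeomorphism W (\<theta> ` W) \<theta> \<psi>"
    using smooth_atlasD(2,3)[OF A(2) W(1)] by blast
  then have \<theta>: "isCont \<theta> q" "inj_on \<theta> W"
    using W(2) by (auto simp: homeomorphism_def continuous_on_eq_continuous_at intro!: inj_on_inverseI)
  define Z where "Z = (\<lambda>u. ht \<Lambda> (inv_into W \<theta> u))"
  have "smooth_on (\<theta> ` (W \<inter> base \<Lambda> -` U)) Z"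
    using legendrian U(1) W(1) unfolding legendrian_surface_def Let_def Z_def by fast
  then have "Z differentiable (at (\<theta> q))"
    using U(2) W(2) unfolding smooth_on_def by blast
  then have "isCont Z (\<theta> q)"
    by (rule differentiable_imp_continuous_within)
  then have "isCont (\<lambda>a. Z (\<theta> a)) q"
    by (rule isCont_o2[OF \<theta>(1)])
  moreover have "\<forall>\<^sub>F a in nhds q. ht \<Lambda> a = Z (\<theta> a)"
    using \<open>open W\<close> W(2) \<theta>(2) by (auto simp: eventually_nhds Z_def)
  ultimately show ?thesis
    by (simp add: isCont_cong)
qed

lemma point_cases: "q \<in> regular_points \<Lambda> \<or> q \<in> cusps \<Lambda> \<or> q \<in> swallowtails \<Lambda>"
proof -
  have "UNIV = regular_points \<Lambda> \<union> cusps \<Lambda> \<union> swallowtails \<Lambda>"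
    using generic unfolding generic_projections_def by (elim conjE)
  then show ?thesis
    by blast
qed

text \<open>In each of the three local models the base component takes the value 0 only at the
  origin. At a swallowtail, \<open>a = 0\<close> reduces the second coordinate to
  \<open>- 4*t^3\<close>.\<close>

lemma isolated_in_fiber:
  "\<exists>N \<theta> \<psi>. open N \<and> open (\<theta> ` N) \<and> homeomorphism N (\<theta> ` N) \<theta> \<psi> \<and> q \<in> N \<and> \<theta> q = (0::plane)
     \<and> (\<forall>q'\<in>N. base \<Lambda> q' = base \<Lambda> q \<longrightarrow> q' = q)"
proof -
  have *: ?thesis if ff: "front_form \<Lambda> F q" and F: "\<And>u. fst (F u) = 0 \<longrightarrow> u = 0" for F
  proof -
    obtain N \<theta> \<psi> P \<kappa> \<kappa>' where *: "open N" "open (\<theta> ` N)" "homeomorphism N (\<theta> ` N) \<theta> \<psi>"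
      "open P" "homeomorphism P (\<kappa> ` P) \<kappa> \<kappa>'" "q \<in> N" "base \<Lambda> ` N \<subseteq> P" "\<theta> q = 0"
      "\<kappa> (base \<Lambda> q) = 0" "\<And>q'. q' \<in> N \<Longrightarrow> \<kappa> (base \<Lambda> q') = fst (F (\<theta> q'))"
      by (rule front_formE[OF ff]) (rule that; assumption)
    have "q' = q" if "q' \<in> N" "base \<Lambda> q' = base \<Lambda> q" for q'
    proof -
      have "fst (F (\<theta> q')) = 0"
        using *(9) *(10)[OF that(1)] that(2) by simp
      then have "\<theta> q' = \<theta> q"
        using *(8) F by simp
      then show ?thesis
        using *(3,6) that(1) by (metis homeomorphism_apply1)
    qed
    then show ?thesis
      using * by blast
  qed
  \<comment> \<open>The height component \<open>x\<close> is left arbitrary in order to cover both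
    signs of the swallowtail model.\<close>
  have F0: "fst (case u of (t,a) \<Rightarrow> ((a, - 4*t^3 - 2*a*t), x t a)) = 0 \<longrightarrow> u = 0"
    for u :: "real \<times> real" and x :: "real \<Rightarrow> real \<Rightarrow> real"
  proof
    obtain t a where u: "u = (t, a)" by (cases u)
    assume "fst (case u of (t,a) \<Rightarrow> ((a, - 4*t^3 - 2*a*t), x t a)) = 0"
    then have *: "(a, - 4*t^3 - 2*a*t) = (0, 0)"
      unfolding u prod.case fst_conv zero_prod_def .
    have a: "a = 0"
      by (rule Pair_inject[OF *])
    have t: "- 4*t^3 - 2*a*t = 0"
      by (rule Pair_inject[OF *])
    have "t ^ 3 = 0"
      using t unfolding a by simp
    then show "u = 0"
      unfolding u a zero_prod_def by simp
  qed
  consider "q \<in> regular_points \<Lambda>" | "q \<in> cusps \<Lambda>" | "q \<in> swallowtails \<Lambda>"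
    using point_cases[of q] by blast
  then show ?thesis
  proof cases
    case 1
    show ?thesis
      by (rule *[OF 1[unfolded regular_points_def mem_Collect_eq]]) (simp split: prod.splits)
  next
    case 2
    show ?thesis
      by (rule *[OF 2[unfolded cusps_def mem_Collect_eq]]) (auto split: prod.splits simp: zero_prod_def)
  next
    case 3
    then show ?thesis
      unfolding swallowtails_def mem_Collect_eq by (elim disjE) (erule *, rule F0)+
  qed
qed

lemma polygonal: "polygonal_decomposition (range (base \<Lambda>)) E"
  using compatible unfolding compatible_decomposition_def by (elim conjE)

lemma cell_structure:
  shows "v \<in> cells0 E \<Longrightarrow> \<exists>x. v = {x}"
    and "e \<in> cells1 E \<Longrightarrow> continuous_on {0..1} (ch1 E e) \<and> e = ch1 E e ` {0<..<1} \<and>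
           end1 E e 0 \<in> cells0 E \<and> end1 E e 1 \<in> cells0 E"
    and "f \<in> cells2 E \<Longrightarrow> continuous_on (cball 0 1) (ch2 E f) \<and> f = ch2 E f ` ball 0 1 \<and>
           v0 E f < nsides E f \<and> v1 E f < nsides E f"
    and "f \<in> cells2 E \<Longrightarrow> i < nsides E f \<Longrightarrow> side E f i \<in> cells1 E \<and>
           (\<exists>\<tau> \<tau>'. homeomorphism {0..1} {0..1} \<tau> \<tau>'
              \<and> \<tau> 0 = (if agrees E f i then 0 else 1) \<and> \<tau> 1 = (if agrees E f i then 1 else 0)
              \<and> (\<forall>t\<in>{0..1}. ch2 E f (side_pt E f i t) = ch1 E (side E f i) (\<tau> t)))"
    and "cells0 E \<inter> cells1 E = {}" "cells0 E \<inter> cells2 E = {}" "cells1 E \<inter> cells2 E = {}"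
    and "disjoint (cells E)"
proof -
  note D = polygonal[unfolded polygonal_decomposition_def]
  have p1: "\<forall>v\<in>cells0 E. \<exists>x. v = {x}"
    using D by (elim conjE)
  have p2: "\<forall>e\<in>cells1 E. continuous_on {0..1} (ch1 E e) \<and> inj_on (ch1 E e) {0<..<1}
        \<and> e = ch1 E e ` {0<..<1} \<and> end1 E e 0 \<in> cells0 E \<and> end1 E e 1 \<in> cells0 E"
    using D by (elim conjE)
  have p3: "\<forall>f\<in>cells2 E. continuous_on (cball 0 1) (ch2 E f) \<and> inj_on (ch2 E f) (ball 0 1)
        \<and> f = ch2 E f ` ball 0 1 \<and> 1 \<le> nsides E f \<and> v0 E f < nsides E f \<and> v1 E f < nsides E f
        \<and> (\<forall>i<nsides E f. side E f i \<in> cells1 E \<and>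
             (\<exists>\<tau> \<tau>'. homeomorphism {0..1} {0..1} \<tau> \<tau>'
                \<and> \<tau> 0 = (if agrees E f i then 0 else 1) \<and> \<tau> 1 = (if agrees E f i then 1 else 0)
                \<and> (\<forall>t\<in>{0..1}. ch2 E f (side_pt E f i t) = ch1 E (side E f i) (\<tau> t))))"
    using D by (elim conjE)
  show "cells0 E \<inter> cells1 E = {}"
    using D by (elim conjE)
  show "cells0 E \<inter> cells2 E = {}"
    using D by (elim conjE)
  show "cells1 E \<inter> cells2 E = {}"
    using D by (elim conjE)
  show "disjoint (cells E)"
    using D by (elim conjE)
  show "v \<in> cells0 E \<Longrightarrow> \<exists>x. v = {x}"
    by (rule bspec[OF p1])
  show "continuous_on {0..1} (ch1 E e) \<and> e = ch1 E e ` {0<..<1} \<and>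
           end1 E e 0 \<in> cells0 E \<and> end1 E e 1 \<in> cells0 E" if "e \<in> cells1 E"
    using bspec[OF p2 that] by (elim conjE, intro conjI)
  show "continuous_on (cball 0 1) (ch2 E f) \<and> f = ch2 E f ` ball 0 1 \<and>
           v0 E f < nsides E f \<and> v1 E f < nsides E f" if "f \<in> cells2 E"
    using bspec[OF p3 that] by (elim conjE, intro conjI)
  show "side E f i \<in> cells1 E \<and>
           (\<exists>\<tau> \<tau>'. homeomorphism {0..1} {0..1} \<tau> \<tau>'
              \<and> \<tau> 0 = (if agrees E f i then 0 else 1) \<and> \<tau> 1 = (if agrees E f i then 1 else 0)
              \<and> (\<forall>t\<in>{0..1}. ch2 E f (side_pt E f i t) = ch1 E (side E f i) (\<tau> t)))"
    if "f \<in> cells2 E" "i < nsides E f"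
    using bspec[OF p3 that(1)] that(2) by (elim conjE) (erule allE[of _ i], erule impE, assumption, assumption)
qed

lemma cell_nonempty: "e \<in> cells E \<Longrightarrow> e \<noteq> {}"
proof -
  assume "e \<in> cells E"
  then consider "e \<in> cells0 E" | "e \<in> cells1 E" | "e \<in> cells2 E"
    unfolding cells_def by blast
  then show ?thesis
  proof cases
    case 1
    then show ?thesis using cell_structure(1) by blast
  next
    case 2
    then have "e = ch1 E e ` {0<..<1}" using cell_structure(2) by blast
    moreover have "1/2 \<in> {0<..<1::real}" by simp
    ultimately show ?thesis by blast
  next
    case 3
    then have "e = ch2 E e ` ball 0 1" using cell_structure(3) by blast
    moreover have "0 \<in> ball (0::complex) 1" by simp
    ultimately show ?thesis by blast
  qed
qed

lemma sheet_structure: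
  assumes "e \<in> cells E"
  shows finite_sheets: "finite (sheets \<Lambda> e)"
    and sheet_homeomorphism: "p \<in> sheets \<Lambda> e \<Longrightarrow> \<exists>g. homeomorphism p e (base \<Lambda>) g"
    and sheet_trichotomy: "p \<in> sheets \<Lambda> e \<Longrightarrow> q \<in> sheets \<Lambda> e \<Longrightarrow> p \<noteq> q \<Longrightarrow>
      higher \<Lambda> p q \<or> higher \<Lambda> q p \<or> crosses \<Lambda> p q"
proof -
  have *: "\<forall>e\<in>cells E. finite (sheets \<Lambda> e)
        \<and> (\<forall>p\<in>sheets \<Lambda> e. \<exists>g. homeomorphism p e (base \<Lambda>) g)
        \<and> (\<forall>p\<in>sheets \<Lambda> e. \<forall>q\<in>sheets \<Lambda> e. p \<noteq> q \<longrightarrow> higher \<Lambda> p q \<or> higher \<Lambda> q p \<or> crosses \<Lambda> p q)"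
    using compatible unfolding compatible_decomposition_def by (elim conjE)
  show "finite (sheets \<Lambda> e)" "p \<in> sheets \<Lambda> e \<Longrightarrow> \<exists>g. homeomorphism p e (base \<Lambda>) g"
    "p \<in> sheets \<Lambda> e \<Longrightarrow> q \<in> sheets \<Lambda> e \<Longrightarrow> p \<noteq> q \<Longrightarrow>
      higher \<Lambda> p q \<or> higher \<Lambda> q p \<or> crosses \<Lambda> p q"
    using bspec[OF * assms] by auto
qed

lemma sheet_over:
  assumes "e \<in> cells E" "p \<in> sheets \<Lambda> e" "y \<in> e"
  shows "\<exists>a\<in>p. base \<Lambda> a = y"
  using sheet_homeomorphism[OF assms(1,2)] assms(3) unfolding homeomorphism_def by auto

lemma sheet_subset: "p \<in> sheets \<Lambda> e \<Longrightarrow> p \<subseteq> base \<Lambda> -` e \<inter> - cusps \<Lambda>"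
  unfolding sheets_def by (rule in_components_subset)

lemma sheets_eqI: "p \<in> sheets \<Lambda> e \<Longrightarrow> q \<in> sheets \<Lambda> e \<Longrightarrow> a \<in> p \<Longrightarrow> a \<in> q \<Longrightarrow> p = q"
  unfolding sheets_def using components_nonoverlap by blast

text \<open>\<open>higher\<close> only compares points with the same base point. Transitivity
  therefore needs the middle sheet to cover the whole cell, and irreflexivity needs the cell to be
  nonempty.\<close>

lemma order_sheets: "e \<in> cells E \<Longrightarrow> finite_strict_order (sheets \<Lambda> e) (higher \<Lambda>)"
proof
  fix p q r assume e: "e \<in> cells E"
  then obtain y where y: "y \<in> e"
    using cell_nonempty by blast
  show "\<not> higher \<Lambda> p p" if "p \<in> sheets \<Lambda> e"
    using sheet_over[OF e that y] unfolding higher_def by force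
  assume p: "p \<in> sheets \<Lambda> e" and q: "q \<in> sheets \<Lambda> e" and r: "r \<in> sheets \<Lambda> e"
    and pq: "higher \<Lambda> p q" and qr: "higher \<Lambda> q r"
  show "higher \<Lambda> p r"
    unfolding higher_def
  proof (intro ballI impI)
    fix a b assume ab: "a \<in> p" "b \<in> r" "base \<Lambda> a = base \<Lambda> b"
    then have "base \<Lambda> a \<in> e"
      using sheet_subset[OF p] by blast
    then obtain c where "c \<in> q" "base \<Lambda> c = base \<Lambda> a"
      using sheet_over[OF e q] by blast
    then show "ht \<Lambda> a > ht \<Lambda> b"
      using pq qr ab unfolding higher_def by fastforce
  qed
qed (rule finite_sheets)

lemma higher_asym:
  assumes e: "e \<in> cells E" and "p \<in> sheets \<Lambda> e" "q \<in> sheets \<Lambda> e" "higher \<Lambda> p q"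
  shows "\<not> higher \<Lambda> q p"
proof -
  interpret finite_strict_order "sheets \<Lambda> e" "higher \<Lambda>"
    by (rule order_sheets[OF e])
  show ?thesis
    using assms(2-4) trans irrefl by blast
qed

end

text \<open>A cell with its characteristic map near a point \<open>\<zeta>\<close> of the boundary of the domain.\<close>

locale boundary_germ = legendrian_setting \<Lambda> E
  for \<Lambda> :: "('m::{t2_space,second_countable_topology}, 'l::{t2_space,second_countable_topology}) legendrian"
    and E :: "('m, 'l) decomposition" +
  fixes e :: "'m set" and ch :: "'d::real_normed_vector \<Rightarrow> 'm" and D :: "'d set" and \<zeta> :: 'd
  assumes cell: "e \<in> cells E" and e_eq: "e = ch ` D" and cont: "continuous_on D ch"
    and ch_tendsto: "(ch \<longlongrightarrow> ch \<zeta>) (at \<zeta> within D)"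
    and convex: "convex D" and notin: "\<zeta> \<notin> D" and closure: "\<zeta> \<in> closure D"
begin

text \<open>The common form of \<open>lim1\<close> and \<open>lim2\<close>, which arise for the open
  unit interval and the open unit disc as \<open>D\<close>.\<close>

definition limit_of :: "'l set \<Rightarrow> 'l \<Rightarrow> bool" where
  "limit_of p s \<longleftrightarrow> (\<forall>r>0. s \<in> closure (p \<inter> base \<Lambda> -` (ch ` (D \<inter> ball \<zeta> r))))"

lemma limit_ofD:
  assumes "limit_of p s" "open W" "s \<in> W" "r > 0"
  obtains a where "a \<in> W" "a \<in> p" "base \<Lambda> a \<in> ch ` (D \<inter> ball \<zeta> r)"
proof -
  have "s \<in> closure (p \<inter> base \<Lambda> -` (ch ` (D \<inter> ball \<zeta> r)))"
    using assms(1,4) unfolding limit_of_def by (elim allE[of _ r] impE)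
  then have "W \<inter> (p \<inter> base \<Lambda> -` (ch ` (D \<inter> ball \<zeta> r))) \<noteq> {}"
    using assms(2,3) open_Int_closure_eq_empty[OF assms(2)] by blast
  then show thesis
    using that by blast
qed

lemma nontrivial: "at \<zeta> within D \<noteq> bot"
  using notin closure by (simp add: trivial_limit_within closure_def)

lemma eventually_D: "\<forall>\<^sub>F d in at \<zeta> within D. d \<in> D"
  by (simp add: eventually_at_filter)

lemma eventually_radius:
  assumes "\<forall>\<^sub>F d in at \<zeta> within D. Q d"
  obtains r where "r > 0" "\<And>d. d \<in> D \<inter> ball \<zeta> r \<Longrightarrow> Q d"
proof -
  obtain r where r: "r > 0" "\<And>d. d \<in> D \<Longrightarrow> d \<noteq> \<zeta> \<Longrightarrow> dist d \<zeta> < r \<Longrightarrow> Q d"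
    using assms unfolding eventually_at by blast
  have "Q d" if "d \<in> D \<inter> ball \<zeta> r" for d
    using that notin by (intro r(2)) (auto simp: dist_commute)
  then show thesis
    by (rule that[OF r(1)])
qed

text \<open>This is where convexity of \<open>D\<close> enters: its intersection with a ball is
  again convex, hence connected.\<close>

lemma connected_image: "connected (ch ` (D \<inter> ball \<zeta> r))"
  by (rule connected_continuous_image[OF continuous_on_subset[OF cont Int_lower1]
      convex_connected[OF convex_Int[OF convex convex_ball]]])

text \<open>Points of the sheet close to \<open>s\<close> have base points close both to that of
  \<open>s\<close> and to the boundary point, so the Hausdorff property of \<open>M\<close> forces
  the two to agree.\<close>

lemma limit_of_base:
  assumes "limit_of p s"
  shows "base \<Lambda> s = ch \<zeta>"
proof (rule ccontr)
  assume "base \<Lambda> s \<noteq> ch \<zeta>"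
  then obtain U V where UV: "open U" "open V" "base \<Lambda> s \<in> U" "ch \<zeta> \<in> V" "U \<inter> V = {}"
    using hausdorff[of "base \<Lambda> s" "ch \<zeta>"] by blast
  obtain r where r: "r > 0" "\<And>d. d \<in> D \<inter> ball \<zeta> r \<Longrightarrow> ch d \<in> V"
    by (rule eventually_radius[OF topological_tendstoD[OF ch_tendsto UV(2,4)]]) (rule that; assumption)
  obtain a where a: "a \<in> base \<Lambda> -` U" "base \<Lambda> a \<in> ch ` (D \<inter> ball \<zeta> r)"
    by (rule limit_ofD[OF assms open_base_vimage[OF UV(1)] vimageI2[of "base \<Lambda>", OF UV(3)] r(1)])
      (rule that; assumption)
  have "base \<Lambda> a \<in> V"
    using a(2) by (rule imageE) (simp only: r(2))
  moreover have "base \<Lambda> a \<in> U"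
    using a(1) by (rule vimageD)
  ultimately show False
    using UV(5) by (metis disjoint_iff)
qed

text \<open>The part of the sheet near \<open>\<zeta>\<close> is connected and cannot cross the boundary of a small
  neighborhood of \<open>s\<close>, since \<open>s\<close> is isolated in its fiber.\<close>

lemma limit_of_tendsto:
  assumes p: "homeomorphism p e (base \<Lambda>) g" and lim: "limit_of p s"
  shows "((\<lambda>d. g (ch d)) \<longlongrightarrow> s) (at \<zeta> within D)"
proof (rule topological_tendstoI)
  fix W assume W: "open W" "s \<in> W"
  obtain N \<theta> \<psi> where N: "open N" "open (\<theta> ` N)" "homeomorphism N (\<theta> ` N) \<theta> \<psi>" "s \<in> N" "\<theta> s = (0::plane)"
    "\<And>q'. q' \<in> N \<Longrightarrow> base \<Lambda> q' = base \<Lambda> s \<Longrightarrow> q' = s"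
    using isolated_in_fiber[of s] by blast
  obtain r where r: "r > 0" "\<And>u. norm u \<le> r \<Longrightarrow> \<psi> u \<in> N \<inter> W \<and> \<theta> (\<psi> u) = u"
    using chart_neighborhood[OF N(1-5) W] by blast
  \<comment> \<open>A coordinate disc around \<open>s\<close> whose closure stays in the compact
    disc \<open>K\<close>, inside \<open>N\<close> and \<open>W\<close>. In \<open>N\<close> the
    point \<open>s\<close> is alone in its fiber, so no frontier point of \<open>U\<close> has the
    same base point as \<open>s\<close>.\<close>
  define U where "U = N \<inter> \<theta> -` ball 0 r"
  define K where "K = \<psi> ` cball 0 r"
  have "open U"
    unfolding U_def using N(1,3) by (intro continuous_open_preimage) (auto simp: homeomorphism_def)
  have sU: "s \<in> U"
    using N(4,5) r(1) by (simp add: U_def)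
  have "cball 0 r \<subseteq> \<theta> ` N"
  proof
    fix u :: plane assume "u \<in> cball 0 r"
    then have "\<psi> u \<in> N" "\<theta> (\<psi> u) = u"
      using r(2)[of u] by auto
    then show "u \<in> \<theta> ` N"
      by (metis imageI)
  qed
  then have "continuous_on (cball 0 r) \<psi>"
    by (rule continuous_on_subset[OF homeomorphism_cont2[OF N(3)]])
  then have "compact K"
    unfolding K_def by (intro compact_continuous_image compact_cball)
  then have "closed K" by (rule compact_imp_closed)
  have UK: "U \<subseteq> K"
  proof
    fix a assume a: "a \<in> U"
    then have "\<psi> (\<theta> a) = a" "\<theta> a \<in> cball 0 r"
      using homeomorphism_apply1[OF N(3)] by (auto simp: U_def)
    then show "a \<in> K"
      unfolding K_def by (metis imageI)
  qed
  then have clU: "closure U \<subseteq> K"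
    using \<open>closed K\<close> by (rule closure_minimal)
  have KNW: "K \<subseteq> N \<inter> W"
    using r(2) unfolding K_def by auto
  \<comment> \<open>Compactness of \<open>L\<close> makes the base projection of the frontier
    closed; as it misses the boundary point, it also misses the image of all points of
    \<open>D\<close> close to it.\<close>
  have "compact (frontier U)"
    using compact_L compact_Int_closed[of UNIV "frontier U"] by (simp add: frontier_closed)
  then have "compact (base \<Lambda> ` frontier U)"
    by (intro compact_continuous_image continuous_on_subset[OF continuous_base]) auto
  then have "open (- base \<Lambda> ` frontier U)"
    by (simp add: compact_imp_closed open_Compl)
  moreover have "ch \<zeta> \<in> - base \<Lambda> ` frontier U"
  proof
    assume "ch \<zeta> \<in> base \<Lambda> ` frontier U"
    then obtain q' where q': "q' \<in> frontier U" "base \<Lambda> q' = base \<Lambda> s"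
      using limit_of_base[OF lim] by auto
    then have "q' = s"
      using N(6) clU KNW by (auto simp: frontier_def)
    then show False
      using q'(1) sU \<open>open U\<close> by (simp add: frontier_def interior_open)
  qed
  ultimately obtain \<delta> where \<delta>: "\<delta> > 0" "\<And>d. d \<in> D \<inter> ball \<zeta> \<delta> \<Longrightarrow> ch d \<in> - base \<Lambda> ` frontier U"
    by (rule eventually_radius[OF topological_tendstoD[OF ch_tendsto]]) (rule that; assumption)
  define Q where "Q = g ` ch ` (D \<inter> ball \<zeta> \<delta>)"
  have sub: "ch ` (D \<inter> ball \<zeta> \<delta>) \<subseteq> e"
    unfolding e_eq by (rule image_mono) simp
  have bQ: "base \<Lambda> (g y) = y" if "y \<in> e" for y
    using homeomorphism_apply2[OF p that] .
  have "connected Q"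
    unfolding Q_def
    by (rule connected_continuous_image[OF continuous_on_subset[OF homeomorphism_cont2[OF p] sub] connected_image])
  moreover have "Q \<inter> frontier U = {}"
  proof (rule equals0I)
    fix a assume "a \<in> Q \<inter> frontier U"
    then obtain d where d: "d \<in> D \<inter> ball \<zeta> \<delta>" "a = g (ch d)" "a \<in> frontier U"
      unfolding Q_def by auto
    then have "ch d \<in> e"
      using sub by blast
    then have "base \<Lambda> a = ch d"
      using d(2) bQ by simp
    then show False
      using \<delta>(2)[OF d(1)] d(3) by (metis ComplD imageI)
  qed
  moreover have "Q \<inter> U \<noteq> {}"
  proof -
    obtain a where a: "a \<in> U" "a \<in> p" "base \<Lambda> a \<in> ch ` (D \<inter> ball \<zeta> \<delta>)"
      by (rule limit_ofD[OF lim \<open>open U\<close> sU \<delta>(1)]) (rule that; assumption)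
    have "g (base \<Lambda> a) \<in> Q"
      unfolding Q_def using a(3) by (rule imageI)
    then show ?thesis
      using a(1) homeomorphism_apply1[OF p a(2)] by auto
  qed
  ultimately have QU: "Q \<subseteq> U"
    using connected_Int_frontier[of Q U] by (meson Diff_eq_empty_iff)
  have "g (ch d) \<in> W" if "d \<in> D" "dist d \<zeta> < \<delta>" for d
  proof -
    have "g (ch d) \<in> Q"
      unfolding Q_def using that by (intro imageI) (simp add: dist_commute)
    then show ?thesis
      using QU UK KNW by auto
  qed
  then show "\<forall>\<^sub>F d in at \<zeta> within D. g (ch d) \<in> W"
    using \<delta>(1) unfolding eventually_at by auto
qed

lemma limit_of_unique:
  assumes "p \<in> sheets \<Lambda> e" "limit_of p s" "limit_of p t"
  shows "s = t"
proof -
  obtain g where g: "homeomorphism p e (base \<Lambda>) g"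
    using sheet_homeomorphism[OF cell assms(1)] by blast
  show ?thesis
    by (rule tendsto_unique[OF nontrivial limit_of_tendsto[OF g assms(2)] limit_of_tendsto[OF g assms(3)]])
qed

text \<open>If \<open>p\<close> is not above \<open>q\<close>, trichotomy makes the height on
  \<open>p\<close> at most that on \<open>q\<close> over the whole cell. Passing to the limit along
  the two sections gives the same inequality for \<open>s\<close> and \<open>t\<close>, contrary to
  the hypothesis.\<close>

lemma higher_limit:
  assumes p: "p \<in> sheets \<Lambda> e" "limit_of p s" and q: "q \<in> sheets \<Lambda> e" "limit_of q t"
    and ht: "ht \<Lambda> s > ht \<Lambda> t"
  shows "higher \<Lambda> p q"
proof (rule ccontr)
  assume "\<not> higher \<Lambda> p q"
  moreover have "p \<noteq> q"
    using limit_of_unique assms by blast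
  ultimately have *: "higher \<Lambda> q p \<or> crosses \<Lambda> p q"
    using sheet_trichotomy[OF cell p(1) q(1)] by blast
  obtain g h where g: "homeomorphism p e (base \<Lambda>) g" and h: "homeomorphism q e (base \<Lambda>) h"
    using sheet_homeomorphism[OF cell p(1)] sheet_homeomorphism[OF cell q(1)] by blast
  have "ht \<Lambda> (g (ch d)) \<le> ht \<Lambda> (h (ch d))" if "d \<in> D" for d
  proof -
    have d: "ch d \<in> e"
      using that e_eq by blast
    have "g (ch d) \<in> p" "base \<Lambda> (g (ch d)) = ch d" "h (ch d) \<in> q" "base \<Lambda> (h (ch d)) = ch d"
      using d g h by (auto simp: homeomorphism_def)
    then show ?thesis
      using * unfolding higher_def crosses_def by force
  qed
  then have "\<forall>\<^sub>F d in at \<zeta> within D. ht \<Lambda> (g (ch d)) \<le> ht \<Lambda> (h (ch d))"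
    using eventually_D by (rule eventually_mono[rotated])
  moreover have "((\<lambda>d. ht \<Lambda> (g (ch d))) \<longlongrightarrow> ht \<Lambda> s) (at \<zeta> within D)"
    by (rule isCont_tendsto_compose[OF continuous_ht limit_of_tendsto[OF g p(2)]])
  moreover have "((\<lambda>d. ht \<Lambda> (h (ch d))) \<longlongrightarrow> ht \<Lambda> t) (at \<zeta> within D)"
    by (rule isCont_tendsto_compose[OF continuous_ht limit_of_tendsto[OF h q(2)]])
  ultimately have "ht \<Lambda> s \<le> ht \<Lambda> t"
    using nontrivial by (intro tendsto_le)
  then show False using ht by simp
qed

text \<open>At a regular point the base projection has a local inverse \<open>h\<close>. It maps the
  connected part of the cell near the boundary point onto a connected set without cusp points, which
  therefore lies in a single component, that is, in one sheet.\<close>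

lemma regular_neighborhood:
  assumes s: "s \<notin> cusps \<Lambda>" "s \<notin> swallowtails \<Lambda>" and base: "base \<Lambda> s = ch \<zeta>"
  shows "\<exists>N r p. open N \<and> s \<in> N \<and> r > 0 \<and> p \<in> sheets \<Lambda> e \<and> limit_of p s
     \<and> N \<inter> base \<Lambda> -` (ch ` (D \<inter> ball \<zeta> r)) \<subseteq> p"
proof -
  have "front_form \<Lambda> (\<lambda>(u,v). ((u, v), 0)) s"
    using point_cases[of s] s by (simp add: regular_points_def)
  then obtain N \<theta> \<psi> P \<kappa> \<kappa>' where *: "open N" "open (\<theta> ` N)" "homeomorphism N (\<theta> ` N) \<theta> \<psi>"
    "open P" "homeomorphism P (\<kappa> ` P) \<kappa> \<kappa>'" "s \<in> N" "base \<Lambda> ` N \<subseteq> P" "\<theta> s = 0"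
    "\<kappa> (base \<Lambda> s) = 0"
    "\<And>q'. q' \<in> N \<Longrightarrow> \<kappa> (base \<Lambda> q') = fst ((\<lambda>(u,v). ((u, v), 0)) (\<theta> q') :: plane \<times> real)"
    by (rule front_formE) (rule that; assumption)
  have \<kappa>: "\<kappa> (base \<Lambda> q') = \<theta> q'" if "q' \<in> N" for q'
    using *(10)[OF that] by (simp split: prod.splits)
  define G where "G = P \<inter> \<kappa> -` (\<theta> ` N)"
  define h where "h = (\<lambda>y. \<psi> (\<kappa> y))"
  have G: "open G"
    unfolding G_def using *(2,4,5) by (intro continuous_open_preimage) (auto simp: homeomorphism_def)
  have h1: "h (base \<Lambda> q') = q'" "base \<Lambda> q' \<in> G" if "q' \<in> N" for q'
    using that \<kappa>[OF that] *(3,7) unfolding h_def G_def homeomorphism_def by auto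
  have h2: "h y \<in> N" "base \<Lambda> (h y) = y" if "y \<in> G" for y
  proof -
    show "h y \<in> N"
      using that *(3) unfolding G_def h_def homeomorphism_def by auto
    then have "\<kappa> (base \<Lambda> (h y)) = \<kappa> y"
      using \<kappa>[of "h y"] that *(3) unfolding G_def h_def homeomorphism_def by auto
    moreover have "base \<Lambda> (h y) \<in> P" "y \<in> P"
      using *(7) \<open>h y \<in> N\<close> that by (auto simp: G_def)
    ultimately show "base \<Lambda> (h y) = y"
      using *(5) by (metis homeomorphism_apply1)
  qed
  have hcont: "continuous_on G h"
    unfolding h_def using *(3,5)
    by (intro continuous_on_compose2[of "\<theta> ` N" \<psi> G \<kappa>])
      (auto simp: homeomorphism_def G_def elim: continuous_on_subset)
  \<comment> \<open>The base projection is injective on \<open>N\<close>, its inverse being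
    \<open>h\<close>, while every neighborhood of a cusp point contains two points with the same
    base point.\<close>
  have N_cusps: "N \<inter> cusps \<Lambda> = {}"
    using cusp_double_points[of _ \<Lambda> N] *(1) h1(1) by (metis disjoint_iff)
  have sG: "ch \<zeta> \<in> G"
    using h1(2)[OF *(6)] base by simp
  obtain r where r: "r > 0" "\<And>d. d \<in> D \<inter> ball \<zeta> r \<Longrightarrow> ch d \<in> G"
    by (rule eventually_radius[OF topological_tendstoD[OF ch_tendsto G sG]]) (rule that; assumption)
  define Q where "Q = N \<inter> base \<Lambda> -` (ch ` (D \<inter> ball \<zeta> r))"
  have Q: "Q = h ` ch ` (D \<inter> ball \<zeta> r)"
    unfolding Q_def using h1 h2 r(2) by force
  have "connected Q"
    unfolding Q using r(2)
    by (intro connected_continuous_image connected_image continuous_on_subset[OF hcont]) auto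
  moreover have "Q \<subseteq> base \<Lambda> -` e \<inter> - cusps \<Lambda>"
    unfolding Q_def using N_cusps e_eq by auto
  moreover have lim: "((\<lambda>d. h (ch d)) \<longlongrightarrow> s) (at \<zeta> within D)"
  proof -
    have "isCont h (ch \<zeta>)"
      using hcont G sG by (simp add: continuous_on_eq_continuous_at)
    moreover have "h (ch \<zeta>) = s"
      using h1(1)[OF *(6)] base by simp
    ultimately show ?thesis
      using isCont_tendsto_compose[OF _ ch_tendsto] by metis
  qed
  have near: "\<exists>d\<in>D. d \<in> ball \<zeta> r' \<and> h (ch d) \<in> W" if "r' > 0" "open W" "s \<in> W" for r' W
  proof -
    have "\<forall>\<^sub>F d in at \<zeta> within D. d \<in> D \<and> dist d \<zeta> < r' \<and> h (ch d) \<in> W"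
      using that eventually_D topological_tendstoD[OF lim that(2,3)]
      by (auto simp: eventually_conj_iff eventually_at)
    then show ?thesis
      using nontrivial by (auto simp: dist_commute dest!: eventually_happens)
  qed
  have "Q \<noteq> {}"
    unfolding Q using near[OF r(1), of UNIV] by auto
  ultimately obtain p where p: "p \<in> sheets \<Lambda> e" "Q \<subseteq> p"
    unfolding sheets_def using exists_component_superset by (metis subset_empty)
  have "limit_of p s"
    unfolding limit_of_def
  proof (intro allI impI)
    fix r' :: real assume "r' > 0"
    show "s \<in> closure (p \<inter> base \<Lambda> -` (ch ` (D \<inter> ball \<zeta> r')))"
    proof (rule ccontr)
      assume s: "s \<notin> closure (p \<inter> base \<Lambda> -` (ch ` (D \<inter> ball \<zeta> r')))"
      obtain d where "d \<in> D" "d \<in> ball \<zeta> (min r r')"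
        "h (ch d) \<in> - closure (p \<inter> base \<Lambda> -` (ch ` (D \<inter> ball \<zeta> r')))"
        using near[of "min r r'" "- closure (p \<inter> base \<Lambda> -` (ch ` (D \<inter> ball \<zeta> r')))"] s r(1) \<open>r' > 0\<close>
        by auto
      then have d: "d \<in> D \<inter> ball \<zeta> r" "d \<in> D \<inter> ball \<zeta> r'"
        and nh: "h (ch d) \<notin> closure (p \<inter> base \<Lambda> -` (ch ` (D \<inter> ball \<zeta> r')))"
        by auto
      have "h (ch d) \<in> Q"
        unfolding Q using d(1) by (intro imageI)
      moreover have "base \<Lambda> (h (ch d)) \<in> ch ` (D \<inter> ball \<zeta> r')"
        unfolding h2(2)[OF r(2)[OF d(1)]] using d(2) by (intro imageI)
      ultimately have "h (ch d) \<in> p \<inter> base \<Lambda> -` (ch ` (D \<inter> ball \<zeta> r'))"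
        using p(2) by auto
      then show False
        using nh closure_subset by (metis subsetD)
    qed
  qed
  then show ?thesis
    using p *(1,6) r(1) unfolding Q_def by blast
qed

text \<open>A sheet with limit \<open>s\<close> has points in \<open>N\<close> over the nearby part
  of the cell. All such points belong to the sheet found before, and different sheets are
  disjoint.\<close>

lemma regular_ex1:
  assumes s: "s \<notin> cusps \<Lambda>" "s \<notin> swallowtails \<Lambda>" and base: "base \<Lambda> s = ch \<zeta>"
  shows "\<exists>!p. p \<in> sheets \<Lambda> e \<and> limit_of p s"
proof -
  obtain N r p where *: "open N" "s \<in> N" "r > 0" "p \<in> sheets \<Lambda> e" "limit_of p s"
     "N \<inter> base \<Lambda> -` (ch ` (D \<inter> ball \<zeta> r)) \<subseteq> p"
    using regular_neighborhood[OF assms] by blast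
  have "q = p" if q: "q \<in> sheets \<Lambda> e" "limit_of q s" for q
  proof -
    obtain a where a: "a \<in> N" "a \<in> q" "base \<Lambda> a \<in> ch ` (D \<inter> ball \<zeta> r)"
      by (rule limit_ofD[OF q(2) *(1-3)]) (rule that; assumption)
    then have "a \<in> p"
      using *(6) by auto
    then show "q = p"
      by (rule sheets_eqI[OF q(1) *(4) a(2)])
  qed
  then show ?thesis
    using * by blast
qed

end

text \<open>The order is only required to be preserved, not reflected: sheets crossing above the
  boundary cell \<open>e'\<close> are incomparable there, but may become comparable over
  \<open>e\<close>.\<close>

definition embeds ::
    "('m::topological_space, 'l::topological_space) legendrian \<Rightarrow> 'm set \<Rightarrow> 'm set \<Rightarrow> ('l set \<Rightarrow> 'l set) \<Rightarrow> bool" where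
  "embeds \<Lambda> e' e \<iota> \<longleftrightarrow> \<iota> ` sheets \<Lambda> e' \<subseteq> sheets \<Lambda> e \<and> inj_on \<iota> (sheets \<Lambda> e')
     \<and> (\<forall>p\<in>sheets \<Lambda> e'. \<forall>q\<in>sheets \<Lambda> e'. higher \<Lambda> p q \<longrightarrow> higher \<Lambda> (\<iota> p) (\<iota> q))"

lemma (in legendrian_setting) vertex_sheet:
  assumes v: "v \<in> cells0 E" and p: "p \<in> sheets \<Lambda> v"
  obtains s where "p = {s}" "base \<Lambda> s \<in> v" "s \<notin> cusps \<Lambda>" "v = {base \<Lambda> s}"
proof -
  obtain y where y: "v = {y}"
    using cell_structure(1)[OF v] by blast
  have "v \<in> cells E"
    using v by (simp add: cells_def)
  then obtain g where "homeomorphism p v (base \<Lambda>) g"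
    using sheet_homeomorphism[OF _ p] by blast
  then have "p = {g y}" "base \<Lambda> (g y) = y"
    unfolding homeomorphism_def y by auto
  moreover have "g y \<notin> cusps \<Lambda>"
    using sheet_subset[OF p] calculation(1) by auto
  ultimately show thesis
    using that y by auto
qed

context boundary_germ
begin

text \<open>Sheets above a vertex are single points, so injectivity is uniqueness of limits and
  monotonicity is \<open>higher_limit\<close>. Existence of the adjacent sheet is left as a
  hypothesis, since regular and swallowtail points obtain it from different sources.\<close>

lemma vertex_embeds:
  assumes v: "{ch \<zeta>} \<in> cells0 E" and ex1: "\<And>s. {s} \<in> sheets \<Lambda> {ch \<zeta>} \<Longrightarrow> \<exists>!p. p \<in> sheets \<Lambda> e \<and> limit_of p s"
    and \<iota>: "\<And>p'. \<iota> p' = (THE p. p \<in> sheets \<Lambda> e \<and> (\<forall>s\<in>p'. limit_of p s))"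
  shows "embeds \<Lambda> {ch \<zeta>} e \<iota>" and "{s} \<in> sheets \<Lambda> {ch \<zeta>} \<Longrightarrow> limit_of (\<iota> {s}) s"
proof -
  have th: "\<iota> {s} \<in> sheets \<Lambda> e \<and> limit_of (\<iota> {s}) s" if "{s} \<in> sheets \<Lambda> {ch \<zeta>}" for s
    using theI'[OF ex1[OF that]] unfolding \<iota> by simp
  then show "{s} \<in> sheets \<Lambda> {ch \<zeta>} \<Longrightarrow> limit_of (\<iota> {s}) s"
    by blast
  show "embeds \<Lambda> {ch \<zeta>} e \<iota>"
    unfolding embeds_def
  proof (intro conjI ballI impI inj_onI subsetI)
    fix p assume "p \<in> \<iota> ` sheets \<Lambda> {ch \<zeta>}"
    then obtain p' where p': "p = \<iota> p'" "p' \<in> sheets \<Lambda> {ch \<zeta>}" by blast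
    then show "p \<in> sheets \<Lambda> e"
      by (metis th vertex_sheet[OF v p'(2)])
  next
    fix p q assume p: "p \<in> sheets \<Lambda> {ch \<zeta>}" and q: "q \<in> sheets \<Lambda> {ch \<zeta>}"
    obtain s where s: "p = {s}" "ch \<zeta> = base \<Lambda> s"
      by (rule vertex_sheet[OF v p]) blast
    obtain t where t: "q = {t}" "ch \<zeta> = base \<Lambda> t"
      by (rule vertex_sheet[OF v q]) blast
    have 1: "\<iota> p \<in> sheets \<Lambda> e" "limit_of (\<iota> p) s" "\<iota> q \<in> sheets \<Lambda> e" "limit_of (\<iota> q) t"
      using th[of s] th[of t] p q unfolding s(1) t(1) by auto
    show "p = q" if "\<iota> p = \<iota> q"
      using limit_of_unique[OF 1(1,2), of t] 1(4) that s t by simp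
    show "higher \<Lambda> (\<iota> p) (\<iota> q)" if "higher \<Lambda> p q"
      using that s t by (intro higher_limit[OF 1]) (simp add: higher_def)
  qed
qed

text \<open>Keeps the placed block and the cusp entries of a boundary matrix apart: a sheet
  continuing one above the vertex cannot belong to a cusp pair, because it would have two
  limits.\<close>

lemma limit_of_noncusp:
  assumes "{ch \<zeta>} \<in> cells0 E" "q' \<in> sheets \<Lambda> {ch \<zeta>}"
    and "\<And>s. {s} \<in> sheets \<Lambda> {ch \<zeta>} \<Longrightarrow> limit_of (\<iota> {s}) s" "\<iota> q' \<in> sheets \<Lambda> e"
    and "c \<in> cusps \<Lambda>"
  shows "\<not> limit_of (\<iota> q') c"
proof
  assume c: "limit_of (\<iota> q') c"
  obtain s where s: "q' = {s}" "s \<notin> cusps \<Lambda>"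
    by (rule vertex_sheet[OF assms(1,2)]) blast
  then have "limit_of (\<iota> q') s"
    using assms(2,3) by simp
  then have "s = c"
    using c by (rule limit_of_unique[OF assms(4)])
  then show False
    using s assms(5) by simp
qed

end

section \<open>Sheets above edges and faces compared with those above vertices and sides\<close>

context legendrian_setting
begin

lemma cells_simps: "v \<in> cells0 E \<Longrightarrow> v \<in> cells E" "e \<in> cells1 E \<Longrightarrow> e \<in> cells E" "f \<in> cells2 E \<Longrightarrow> f \<in> cells E"
  by (simp_all add: cells_def)

lemma germ1:
  assumes e: "e \<in> cells1 E" and t: "t \<in> {0,1}"
  shows "boundary_germ \<Lambda> E e (ch1 E e) {0<..<1} t"
proof unfold_locales
  have c: "continuous_on {0..1} (ch1 E e)"
    using cell_structure(2)[OF e] by (elim conjE)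
  have eq: "e = ch1 E e ` {0<..<1}"
    using cell_structure(2)[OF e] by (elim conjE)
  show "e \<in> cells E" by (rule cells_simps(2)[OF e])
  show "e = ch1 E e ` {0<..<1}" by (rule eq)
  show "continuous_on {0<..<1} (ch1 E e)"
    by (rule continuous_on_subset[OF c]) auto
  have "(ch1 E e \<longlongrightarrow> ch1 E e t) (at t within {0..1})"
    using c t by (auto simp: continuous_on_def)
  then show "(ch1 E e \<longlongrightarrow> ch1 E e t) (at t within {0<..<1})"
    by (rule tendsto_within_subset) auto
  show "t \<in> closure {0<..<1}"
    using t by auto
  show "t \<notin> {0<..<1}"
    using t by auto
qed simp

lemma germ2:
  assumes f: "f \<in> cells2 E" and \<zeta>: "norm \<zeta> = 1"
  shows "boundary_germ \<Lambda> E f (ch2 E f) (ball 0 1) \<zeta>"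
proof unfold_locales
  have c: "continuous_on (cball 0 1) (ch2 E f)"
    using cell_structure(3)[OF f] by (elim conjE)
  have eq: "f = ch2 E f ` ball 0 1"
    using cell_structure(3)[OF f] by (elim conjE)
  show "f \<in> cells E" by (rule cells_simps(3)[OF f])
  show "f = ch2 E f ` ball 0 1" by (rule eq)
  show "continuous_on (ball 0 1) (ch2 E f)"
    by (rule continuous_on_subset[OF c]) auto
  have "(ch2 E f \<longlongrightarrow> ch2 E f \<zeta>) (at \<zeta> within cball 0 1)"
    using c \<zeta> by (auto simp: continuous_on_def)
  then show "(ch2 E f \<longlongrightarrow> ch2 E f \<zeta>) (at \<zeta> within ball 0 1)"
    by (rule tendsto_within_subset) auto
  show "\<zeta> \<in> closure (ball 0 1)"
    using \<zeta> by simp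
  show "\<zeta> \<notin> ball 0 1"
    using \<zeta> by simp
qed simp

lemma lim1_limit_of: "e \<in> cells1 E \<Longrightarrow> t \<in> {0,1} \<Longrightarrow>
    boundary_germ.limit_of \<Lambda> (ch1 E e) {0<..<1} t = lim1 \<Lambda> E e t"
  using boundary_germ.limit_of_def[OF germ1] unfolding lim1_def fun_eq_iff by blast

lemma lim2_limit_of: "f \<in> cells2 E \<Longrightarrow> norm \<zeta> = 1 \<Longrightarrow>
    boundary_germ.limit_of \<Lambda> (ch2 E f) (ball 0 1) \<zeta> = lim2 \<Lambda> E f \<zeta>"
  using boundary_germ.limit_of_def[OF germ2] unfolding lim2_def fun_eq_iff by blast

lemma norm_side_pt [simp]: "norm (side_pt E f i t) = 1" "norm (corner_pt E f i) = 1"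
  by (simp_all add: side_pt_def corner_pt_def)

lemma st_structureD: "st_vertex \<Lambda> E v \<Longrightarrow> st_structure \<Lambda> E v"
  using compatible unfolding compatible_decomposition_def by (elim conjE allE[of _ v] impE)

lemma swallowtail_structure:
  assumes "st_vertex \<Lambda> E v"
  shows st_edges: "{e \<in> cells1 E. end1 E e 0 = v} = {edge_cr E v, edge_S E v, edge_T E v}"
      "{e \<in> cells1 E. end1 E e 1 = v} = {}"
    and st_unique: "\<exists>!s. s \<in> swallowtails \<Lambda> \<and> base \<Lambda> s \<in> v"
    and st_uncrossed: "\<forall>p\<in>sheets \<Lambda> v. \<forall>q\<in>sheets \<Lambda> v. \<not> crosses \<Lambda> p q"
    and st_corners: "st_corner \<Lambda> E v (cornerS E v) (edge_S E v)"
      "st_corner \<Lambda> E v (cornerT E v) (edge_T E v)"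
    and st_direction: "upward \<Lambda> E v \<or> downward \<Lambda> E v"
    and st_one_crossing: "\<forall>p\<in>sheets \<Lambda> (edge_cr E v). \<forall>q\<in>sheets \<Lambda> (edge_cr E v).
        \<forall>p'\<in>sheets \<Lambda> (edge_cr E v). \<forall>q'\<in>sheets \<Lambda> (edge_cr E v).
        crosses \<Lambda> p q \<and> crosses \<Lambda> p' q' \<longrightarrow> {p,q} = {p',q'}"
    and st_limit_edge: "\<forall>e\<in>{edge_S E v, edge_T E v}. \<exists>!p. p \<in> sheets \<Lambda> e \<and> lim1 \<Lambda> E e 0 p (st_point \<Lambda> v)"
    and st_limit_face: "\<forall>f\<in>cells2 E. \<forall>j<nsides E f. vertex2 E f j = v \<and> (f,j) \<noteq> cornerS E v \<and> (f,j) \<noteq> cornerT E v \<longrightarrow>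
        (\<exists>!p. p \<in> sheets \<Lambda> f \<and> lim2 \<Lambda> E f (corner_pt E f j) p (st_point \<Lambda> v))"
  by (insert st_structureD[OF assms, unfolded st_structure_def]; elim conjE; assumption)+

lemma st_point:
  assumes "st_vertex \<Lambda> E v"
  shows "st_point \<Lambda> v \<in> swallowtails \<Lambda>" "base \<Lambda> (st_point \<Lambda> v) \<in> v"
    and "s \<in> swallowtails \<Lambda> \<Longrightarrow> base \<Lambda> s \<in> v \<Longrightarrow> s = st_point \<Lambda> v"
proof -
  note ex = st_unique[OF assms]
  show "st_point \<Lambda> v \<in> swallowtails \<Lambda>" "base \<Lambda> (st_point \<Lambda> v) \<in> v"
    using theI'[OF ex] unfolding st_point_def by auto
  then show "s \<in> swallowtails \<Lambda> \<Longrightarrow> base \<Lambda> s \<in> v \<Longrightarrow> s = st_point \<Lambda> v"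
    using ex by blast
qed

lemma end1_cell: "e \<in> cells1 E \<Longrightarrow> t \<in> {0,1} \<Longrightarrow> end1 E e t \<in> cells0 E"
  using cell_structure(2)[of e] by auto

text \<open>Away from swallowtail points the adjacent sheet exists by regularity. At a swallowtail
  the three adjacent edges point away from it, so \<open>t = 0\<close>; the crossing edge being
  excluded, \<open>e\<close> is a cusp edge, for which \<open>st_structure\<close> provides exactly
  one sheet ending at the swallowtail point.\<close>

lemma inc1_embeds:
  assumes e: "e \<in> cells1 E" and t: "t \<in> {0,1}" and v: "v = end1 E e t"
    and ne: "\<not> (st_vertex \<Lambda> E v \<and> e = edge_cr E v)"
  shows "embeds \<Lambda> v e (inc1 \<Lambda> E e t)"
    and "q \<in> sheets \<Lambda> v \<Longrightarrow> \<not> cusp_pair1 \<Lambda> E e t p (inc1 \<Lambda> E e t q)"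
proof -
  interpret boundary_germ \<Lambda> E e "ch1 E e" "{0<..<1}" t
    by (rule germ1[OF e t])
  have v': "v = {ch1 E e t}" and v0: "v \<in> cells0 E"
    using end1_cell[OF e t] by (simp_all add: v end1_def)
  have ex1: "\<exists>!p. p \<in> sheets \<Lambda> e \<and> limit_of p s" if "{s} \<in> sheets \<Lambda> v" for s
  proof (cases "s \<in> swallowtails \<Lambda>")
    case False
    moreover have "s \<notin> cusps \<Lambda>" "base \<Lambda> s = ch1 E e t"
      using sheet_subset[OF that] v' by auto
    ultimately show ?thesis
      by (intro regular_ex1)
  next
    case True
    moreover have bs: "base \<Lambda> s \<in> v"
      using sheet_subset[OF that] by auto
    ultimately have st: "st_vertex \<Lambda> E v"
      using v0 unfolding st_vertex_def by blast
    note S = st_edges[OF st] st_limit_edge[OF st]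
    have "t = 0"
      using S(2) e t v by auto
    then have "e \<in> {edge_S E v, edge_T E v}"
      using S(1) e v ne st by auto
    then have "\<exists>!p. p \<in> sheets \<Lambda> e \<and> lim1 \<Lambda> E e 0 p (st_point \<Lambda> v)"
      by (rule bspec[OF S(3)])
    then show ?thesis
      using st_point(3)[OF st True bs] lim1_limit_of[OF e t] \<open>t = 0\<close> by simp
  qed
  note emb = vertex_embeds[OF v0[unfolded v'] ex1[unfolded v'], of "inc1 \<Lambda> E e t", folded v']
  have \<iota>: "inc1 \<Lambda> E e t p' = (THE p. p \<in> sheets \<Lambda> e \<and> (\<forall>s\<in>p'. limit_of p s))" for p'
    unfolding inc1_def lim1_limit_of[OF e t] ..
  show emb1: "embeds \<Lambda> v e (inc1 \<Lambda> E e t)"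
    by (rule emb(1)[OF _ \<iota>])
  show "\<not> cusp_pair1 \<Lambda> E e t p (inc1 \<Lambda> E e t q)" if "q \<in> sheets \<Lambda> v"
  proof -
    have *: "\<not> limit_of (inc1 \<Lambda> E e t q) c" if "c \<in> cusps \<Lambda>" for c
    proof (rule limit_of_noncusp[where \<iota>="inc1 \<Lambda> E e t", folded v', OF v0 \<open>q \<in> sheets \<Lambda> v\<close> _ _ that])
      show "{s} \<in> sheets \<Lambda> v \<Longrightarrow> limit_of (inc1 \<Lambda> E e t {s}) s" for s
        by (rule emb(2)[OF _ \<iota>])
      show "inc1 \<Lambda> E e t q \<in> sheets \<Lambda> e"
        using emb1 \<open>q \<in> sheets \<Lambda> v\<close> by (auto simp: embeds_def)
    qed
    then show ?thesis
      unfolding cusp_pair1_def lim1_limit_of[OF e t, symmetric] by blast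
  qed
qed

lemma vertex2_cell:
  assumes f: "f \<in> cells2 E" and j: "j < nsides E f"
  shows "vertex2 E f j \<in> cells0 E"
proof -
  obtain \<tau> \<tau>' :: "real \<Rightarrow> real" where \<tau>: "side E f j \<in> cells1 E"
    "\<tau> 0 = (if agrees E f j then 0 else 1)" "\<forall>t\<in>{0..1}. ch2 E f (side_pt E f j t) = ch1 E (side E f j) (\<tau> t)"
    using cell_structure(4)[OF f j] by blast
  have "vertex2 E f j = end1 E (side E f j) (\<tau> 0)"
    using \<tau>(3) by (simp add: vertex2_def end1_def corner_pt_def)
  moreover have "\<tau> 0 \<in> {0,1}"
    using \<tau>(2) by simp
  ultimately show ?thesis
    using end1_cell[OF \<tau>(1)] by simp
qed

text \<open>Same reasoning as for edges. The corners \<open>S\<close> and \<open>T\<close> are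
  excluded, since three sheets end at the swallowtail point there; at the other corners of a
  swallowtail vertex exactly one does.\<close>

lemma inc2_embeds:
  assumes f: "f \<in> cells2 E" and j: "j < nsides E f" and v: "v = vertex2 E f j"
    and ne: "\<not> (st_vertex \<Lambda> E v \<and> ((f,j) = cornerS E v \<or> (f,j) = cornerT E v))"
  shows "embeds \<Lambda> v f (inc2 \<Lambda> E f j)"
    and "q \<in> sheets \<Lambda> v \<Longrightarrow> \<not> cusp_pair2 \<Lambda> E f j p (inc2 \<Lambda> E f j q)"
proof -
  let ?\<zeta> = "corner_pt E f j"
  interpret boundary_germ \<Lambda> E f "ch2 E f" "ball 0 1" ?\<zeta>
    by (rule germ2[OF f norm_side_pt(2)])
  note lim = lim2_limit_of[OF f norm_side_pt(2)[of f j]]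
  have v': "v = {ch2 E f ?\<zeta>}" and v0: "v \<in> cells0 E"
    using vertex2_cell[OF f j] by (simp_all add: v vertex2_def)
  have ex1: "\<exists>!p. p \<in> sheets \<Lambda> f \<and> limit_of p s" if "{s} \<in> sheets \<Lambda> v" for s
  proof (cases "s \<in> swallowtails \<Lambda>")
    case False
    moreover have "s \<notin> cusps \<Lambda>" "base \<Lambda> s = ch2 E f ?\<zeta>"
      using sheet_subset[OF that] v' by auto
    ultimately show ?thesis
      by (intro regular_ex1)
  next
    case True
    moreover have bs: "base \<Lambda> s \<in> v"
      using sheet_subset[OF that] by auto
    ultimately have st: "st_vertex \<Lambda> E v"
      using v0 unfolding st_vertex_def by blast
    have "\<exists>!p. p \<in> sheets \<Lambda> f \<and> lim2 \<Lambda> E f ?\<zeta> p (st_point \<Lambda> v)"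
      using st_limit_face[OF st, rule_format, OF f j] ne st v by simp
    then show ?thesis
      using st_point(3)[OF st True bs] lim by simp
  qed
  note emb = vertex_embeds[OF v0[unfolded v'] ex1[unfolded v'], of "inc2 \<Lambda> E f j", folded v']
  have \<iota>: "inc2 \<Lambda> E f j p' = (THE p. p \<in> sheets \<Lambda> f \<and> (\<forall>s\<in>p'. limit_of p s))" for p'
    unfolding inc2_def lim ..
  show emb1: "embeds \<Lambda> v f (inc2 \<Lambda> E f j)"
    by (rule emb(1)[OF _ \<iota>])
  show "\<not> cusp_pair2 \<Lambda> E f j p (inc2 \<Lambda> E f j q)" if "q \<in> sheets \<Lambda> v"
  proof -
    have *: "\<not> limit_of (inc2 \<Lambda> E f j q) c" if "c \<in> cusps \<Lambda>" for c
    proof (rule limit_of_noncusp[where \<iota>="inc2 \<Lambda> E f j", folded v', OF v0 \<open>q \<in> sheets \<Lambda> v\<close> _ _ that])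
      show "{s} \<in> sheets \<Lambda> v \<Longrightarrow> limit_of (inc2 \<Lambda> E f j {s}) s" for s
        by (rule emb(2)[OF _ \<iota>])
      show "inc2 \<Lambda> E f j q \<in> sheets \<Lambda> f"
        using emb1 \<open>q \<in> sheets \<Lambda> v\<close> by (auto simp: embeds_def)
    qed
    then show ?thesis
      unfolding cusp_pair2_def lim[symmetric] by blast
  qed
qed

lemma cells_disjoint:
  "e \<in> cells E \<Longrightarrow> e' \<in> cells E \<Longrightarrow> e \<noteq> e' \<Longrightarrow> e \<inter> e' = {}"
  using cell_structure(8) unfolding disjoint_def by blast

lemma swallowtail_not_over_edge:
  assumes "e \<in> cells1 E" "base \<Lambda> s \<in> e"
  shows "s \<notin> swallowtails \<Lambda>"
proof
  assume s: "s \<in> swallowtails \<Lambda>"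
  have "\<forall>x\<in>base \<Lambda> ` swallowtails \<Lambda>. {x} \<in> cells0 E"
    using compatible unfolding compatible_decomposition_def by (elim conjE)
  then have v: "{base \<Lambda> s} \<in> cells0 E"
    using s by blast
  then have "{base \<Lambda> s} \<noteq> e"
    using assms(1) cell_structure(5) by blast
  then show False
    using cells_disjoint[OF cells_simps(1)[OF v] cells_simps(2)[OF assms(1)]] assms(2) by blast
qed

text \<open>The sheet of \<open>f\<close> adjacent to \<open>p'\<close> at a point of the side is locally constant along the side.\<close>

lemma inc_side_limit:
  assumes f: "f \<in> cells2 E" and i: "i < nsides E f" and p': "p' \<in> sheets \<Lambda> (side E f i)"
  shows "inc_side \<Lambda> E f i p' \<in> sheets \<Lambda> f \<and> (\<exists>s\<in>p'. base \<Lambda> s = ch2 E f (side_pt E f i (1/2))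
     \<and> lim2 \<Lambda> E f (side_pt E f i (1/2)) (inc_side \<Lambda> E f i p') s)"
proof -
  define e where "e = side E f i"
  obtain \<tau> \<tau>' :: "real \<Rightarrow> real" where e: "e \<in> cells1 E" and
    \<tau>: "homeomorphism {0..1} {0..1} \<tau> \<tau>'" "\<tau> 0 = (if agrees E f i then 0 else 1)"
    "\<tau> 1 = (if agrees E f i then 1 else 0)"
    "\<forall>t\<in>{0..1}. ch2 E f (side_pt E f i t) = ch1 E e (\<tau> t)"
    using cell_structure(4)[OF f i] unfolding e_def by blast
  define A where "A = {0<..<1::real}"
  define \<xi> where "\<xi> = side_pt E f i"
  have \<xi>_cont: "continuous_on UNIV \<xi>"
    unfolding \<xi>_def side_pt_def[abs_def] using i by (intro continuous_intros) auto
  \<comment> \<open>An injective \<open>\<tau>\<close> that maps the endpoints of the interval to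
    its endpoints maps interior points to interior points.\<close>
  have \<tau>A: "\<tau> t \<in> A" if t: "t \<in> A" for t
  proof -
    have inj: "inj_on \<tau> {0..1}"
      using homeomorphism_apply1[OF \<tau>(1)] by (rule inj_on_inverseI)
    have "\<tau> t \<in> {0..1}"
      using t homeomorphism_image1[OF \<tau>(1)] by (auto simp: A_def)
    moreover have "\<tau> t \<noteq> \<tau> 0" "\<tau> t \<noteq> \<tau> 1"
      using t inj_onD[OF inj, of t 0] inj_onD[OF inj, of t 1] by (auto simp: A_def)
    ultimately show ?thesis
      using \<tau>(2,3) by (auto simp: A_def split: if_splits)
  qed
  have \<xi>e: "ch2 E f (\<xi> t) \<in> e" if "t \<in> A" for t
  proof -
    have "e = ch1 E e ` A"
      using cell_structure(2)[OF e] by (simp add: A_def)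
    moreover have "ch1 E e (\<tau> t) \<in> ch1 E e ` A"
      using \<tau>A[OF that] by (rule imageI)
    moreover have "ch2 E f (\<xi> t) = ch1 E e (\<tau> t)"
      using \<tau>(4) that by (simp add: \<xi>_def A_def)
    ultimately show ?thesis by simp
  qed
  have p'e: "p' \<in> sheets \<Lambda> e"
    using p' by (simp add: e_def)
  obtain g where g: "homeomorphism p' e (base \<Lambda>) g"
    using sheet_homeomorphism[OF cells_simps(2)[OF e] p'e] by blast
  define \<sigma> where "\<sigma> t = g (ch2 E f (\<xi> t))" for t
  have ch2_cont: "continuous_on (cball 0 1) (ch2 E f)"
    using cell_structure(3)[OF f] by (elim conjE)
  have "continuous_on A (\<lambda>t. ch2 E f (\<xi> t))"
    by (rule continuous_on_compose2[OF ch2_cont continuous_on_subset[OF \<xi>_cont]]) (auto simp: \<xi>_def)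
  then have \<sigma>_cont: "continuous_on A \<sigma>"
    unfolding \<sigma>_def[abs_def] using \<xi>e
    by (intro continuous_on_compose2[OF homeomorphism_cont2[OF g]]) auto
  have \<sigma>: "\<sigma> t \<in> p'" "base \<Lambda> (\<sigma> t) = ch2 E f (\<xi> t)" if "t \<in> A" for t
    using \<xi>e[OF that] g by (auto simp: \<sigma>_def homeomorphism_def)
  have \<sigma>_unique: "s = \<sigma> t" if "s \<in> p'" "base \<Lambda> s = ch2 E f (\<xi> t)" for s t
    using homeomorphism_apply1[OF g that(1)] that(2) by (simp add: \<sigma>_def)
  have reg: "\<sigma> t \<notin> cusps \<Lambda>" "\<sigma> t \<notin> swallowtails \<Lambda>" if "t \<in> A" for t
    using sheet_subset[OF p'e] \<sigma>[OF that] swallowtail_not_over_edge[OF e, of "\<sigma> t"] by auto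
  have germ: "boundary_germ \<Lambda> E f (ch2 E f) (ball 0 1) (\<xi> t)" for t
    by (rule germ2[OF f]) (simp add: \<xi>_def)
  have lim: "boundary_germ.limit_of \<Lambda> (ch2 E f) (ball 0 1) (\<xi> t) = lim2 \<Lambda> E f (\<xi> t)" for t
    by (rule lim2_limit_of[OF f]) (simp add: \<xi>_def)
  have ex1: "\<exists>!p. p \<in> sheets \<Lambda> f \<and> lim2 \<Lambda> E f (\<xi> t) p (\<sigma> t)" if "t \<in> A" for t
    using boundary_germ.regular_ex1[OF germ reg[OF that] \<sigma>(2)[OF that]] unfolding lim .
  define P where "P t = (THE p. p \<in> sheets \<Lambda> f \<and> lim2 \<Lambda> E f (\<xi> t) p (\<sigma> t))" for t
  have P: "P t \<in> sheets \<Lambda> f" "lim2 \<Lambda> E f (\<xi> t) (P t) (\<sigma> t)" if "t \<in> A" for t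
    using theI'[OF ex1[OF that]] unfolding P_def by auto
  have "\<forall>\<^sub>F t in at u within A. P u = P t" if u: "u \<in> A" for u
  proof -
    \<comment> \<open>All points of \<open>N\<close> over the part of the face near the point at
      \<open>u\<close> lie in the one sheet \<open>p\<close>. For \<open>t\<close> near
      \<open>u\<close>, the sheet \<open>P t\<close> has points there too, so it is the same
      sheet.\<close>
    obtain N r p where N: "open N" "\<sigma> u \<in> N" "r > 0" "p \<in> sheets \<Lambda> f" "lim2 \<Lambda> E f (\<xi> u) p (\<sigma> u)"
      "N \<inter> base \<Lambda> -` (ch2 E f ` (ball 0 1 \<inter> ball (\<xi> u) r)) \<subseteq> p"
      using boundary_germ.regular_neighborhood[OF germ reg[OF u] \<sigma>(2)[OF u]] unfolding lim by blast
    have pu: "p = P u"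
      using ex1[OF u] P[OF u] N(4,5) by blast
    have "(\<sigma> \<longlongrightarrow> \<sigma> u) (at u within A)"
      using \<sigma>_cont u by (simp add: continuous_on_def)
    then have 1: "\<forall>\<^sub>F t in at u within A. \<sigma> t \<in> N"
      using N(1,2) by (rule topological_tendstoD)
    have "(\<xi> \<longlongrightarrow> \<xi> u) (at u within A)"
      using continuous_on_subset[OF \<xi>_cont, of A] u by (simp add: continuous_on_def)
    then have 2: "\<forall>\<^sub>F t in at u within A. dist (\<xi> t) (\<xi> u) < r"
      using N(3) by (rule tendstoD)
    have 3: "\<forall>\<^sub>F t in at u within A. t \<in> A"
      by (simp add: eventually_at_filter)
    show ?thesis
      using 1 2 3
    proof eventually_elim
      case (elim t)
      define r' where "r' = r - dist (\<xi> t) (\<xi> u)"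
      have "r' > 0"
        using elim by (simp add: r'_def)
      obtain a where a: "a \<in> N" "a \<in> P t" "base \<Lambda> a \<in> ch2 E f ` (ball 0 1 \<inter> ball (\<xi> t) r')"
        by (rule boundary_germ.limit_ofD[OF germ P(2)[OF elim(3), folded lim] N(1) elim(1) \<open>r' > 0\<close>])
          (rule that; assumption)
      have "ball (\<xi> t) r' \<subseteq> ball (\<xi> u) r"
      proof
        fix z assume "z \<in> ball (\<xi> t) r'"
        then show "z \<in> ball (\<xi> u) r"
          using dist_triangle[of "\<xi> u" z "\<xi> t"] by (simp add: r'_def dist_commute)
      qed
      then have "base \<Lambda> a \<in> ch2 E f ` (ball 0 1 \<inter> ball (\<xi> u) r)"
        using a(3) by (auto simp: image_iff)
      then have "a \<in> p"
        using N(6) a(1) by auto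
      then show ?case
        using sheets_eqI[OF N(4) P(1)[OF elim(3)] _ a(2)] pu by simp
    qed
  qed
  moreover have "connected A"
    unfolding A_def by (intro convex_connected) simp
  \<comment> \<open>The midpoint stands for the whole side from here on: a single limit point is
    enough to prove injectivity and monotonicity of \<open>inc_side\<close>.\<close>
  moreover have h: "1/2 \<in> A"
    by (simp add: A_def)
  ultimately have const: "P t = P (1/2)" if "t \<in> A" for t
    using connected_local_const[of A t "1/2" P] that by blast
  have "inc_side \<Lambda> E f i p' = P (1/2)"
    unfolding inc_side_def
  proof (rule the_equality, intro conjI ballI impI)
    show "P (1/2) \<in> sheets \<Lambda> f"
      by (rule P(1)[OF h])
    fix t s assume t: "t \<in> {0<..<1}" and s: "s \<in> p'" "base \<Lambda> s = ch2 E f (side_pt E f i t)"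
    have "lim2 \<Lambda> E f (\<xi> t) (P t) (\<sigma> t)"
      using t by (intro P(2)) (simp add: A_def)
    then show "lim2 \<Lambda> E f (side_pt E f i t) (P (1/2)) s"
      using const[of t] t \<sigma>_unique[OF s(1), of t] s(2) by (simp add: A_def \<xi>_def)
  next
    fix p assume p: "p \<in> sheets \<Lambda> f \<and> (\<forall>t\<in>{0<..<1}. \<forall>s\<in>p'. base \<Lambda> s = ch2 E f (side_pt E f i t)
      \<longrightarrow> lim2 \<Lambda> E f (side_pt E f i t) p s)"
    then have "\<forall>s\<in>p'. base \<Lambda> s = ch2 E f (side_pt E f i (1/2))
      \<longrightarrow> lim2 \<Lambda> E f (side_pt E f i (1/2)) p s"
      using h unfolding A_def by blast
    then have "lim2 \<Lambda> E f (\<xi> (1/2)) p (\<sigma> (1/2))"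
      using \<sigma>[OF h] by (simp add: \<xi>_def)
    then show "p = P (1/2)"
      using ex1[OF h] P[OF h] p by blast
  qed
  then show ?thesis
    using P[OF h] \<sigma>[OF h] by (auto simp: \<xi>_def)
qed

text \<open>The argument is that for vertices, applied at the midpoint of the side. Equal images
  share their limit there, and sheets over the edge with a common point coincide.\<close>

lemma inc_side_embeds:
  assumes f: "f \<in> cells2 E" and i: "i < nsides E f"
  shows "embeds \<Lambda> (side E f i) f (inc_side \<Lambda> E f i)"
  unfolding embeds_def
proof (intro conjI ballI impI inj_onI subsetI)
  let ?\<zeta> = "side_pt E f i (1/2)" and ?\<iota> = "inc_side \<Lambda> E f i"
  interpret boundary_germ \<Lambda> E f "ch2 E f" "ball 0 1" ?\<zeta>
    by (rule germ2[OF f norm_side_pt(1)])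
  note lim = lim2_limit_of[OF f norm_side_pt(1)[of f i "1/2"]]
  show "p \<in> sheets \<Lambda> f" if "p \<in> ?\<iota> ` sheets \<Lambda> (side E f i)" for p
    using that inc_side_limit[OF f i] by auto
  fix p q assume p: "p \<in> sheets \<Lambda> (side E f i)" and q: "q \<in> sheets \<Lambda> (side E f i)"
  obtain s where s: "?\<iota> p \<in> sheets \<Lambda> f" "s \<in> p" "base \<Lambda> s = ch2 E f ?\<zeta>" "limit_of (?\<iota> p) s"
    using inc_side_limit[OF f i p] unfolding lim by blast
  obtain t where t: "?\<iota> q \<in> sheets \<Lambda> f" "t \<in> q" "base \<Lambda> t = ch2 E f ?\<zeta>" "limit_of (?\<iota> q) t"
    using inc_side_limit[OF f i q] unfolding lim by blast
  show "p = q" if "?\<iota> p = ?\<iota> q"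
  proof -
    have "s = t"
      using limit_of_unique[OF s(1,4), of t] t(4) that by simp
    then show ?thesis
      using sheets_eqI[OF p q s(2)] t(2) by simp
  qed
  show "higher \<Lambda> (?\<iota> p) (?\<iota> q)" if "higher \<Lambda> p q"
    using that s(2,3) t(2,3) by (intro higher_limit[OF s(1,4) t(1,4)]) (simp add: higher_def)
qed

text \<open>A crossing would put a base point in \<open>f\<close> into the singular locus, which
  lies in the 1-skeleton and hence is disjoint from \<open>f\<close>.\<close>

lemma no_crossings_over_face:
  assumes f: "f \<in> cells2 E" and p: "p \<in> sheets \<Lambda> f" and q: "q \<in> sheets \<Lambda> f"
  shows "\<not> crosses \<Lambda> p q"
proof
  assume c: "crosses \<Lambda> p q"
  note fc = cells_simps(3)[OF f]
  obtain y where y: "y \<in> f"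
    using cell_nonempty[OF fc] by blast
  obtain a b where ab: "a \<in> p" "b \<in> q" "base \<Lambda> a = y" "base \<Lambda> b = y"
    using sheet_over[OF fc p y] sheet_over[OF fc q y] by blast
  have "a \<noteq> b"
    using sheets_eqI[OF p q ab(1)] ab(2) c by (auto simp: crosses_def)
  moreover have "same_front \<Lambda> a b"
    using c ab by (auto simp: crosses_def same_front_def)
  ultimately have "a \<in> crossings \<Lambda>"
    unfolding crossings_def by auto
  then have "y \<in> singular_locus \<Lambda>"
    unfolding singular_locus_def ab(3)[symmetric] by simp
  moreover have "singular_locus \<Lambda> \<subseteq> \<Union>(cells0 E \<union> cells1 E)"
    using compatible unfolding compatible_decomposition_def by (elim conjE)
  ultimately obtain e where e: "e \<in> cells0 E \<union> cells1 E" "y \<in> e"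
    by blast
  have "e \<noteq> f"
    using e(1) f cell_structure(6,7) by blast
  then show False
    using cells_disjoint[of e f] e y fc by (auto simp: cells_def)
qed

end

subsection \<open>Numbering of sheets\<close>

context finite_strict_order
begin

context
  assumes total: "\<And>p q. p \<in> I \<Longrightarrow> q \<in> I \<Longrightarrow> p \<noteq> q \<Longrightarrow> lt p q \<or> lt q p"
begin

lemma number_less: "p \<in> I \<Longrightarrow> q \<in> I \<Longrightarrow> lt p q \<Longrightarrow> card {r\<in>I. lt r p} < card {r\<in>I. lt r q}"
proof (rule psubset_card_mono)
  assume *: "p \<in> I" "q \<in> I" "lt p q"
  have "{r\<in>I. lt r p} \<subseteq> {r\<in>I. lt r q}"
    using * trans by blast
  moreover have "p \<in> {r\<in>I. lt r q}" "p \<notin> {r\<in>I. lt r p}"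
    using * irrefl by auto
  ultimately show "{r\<in>I. lt r p} \<subset> {r\<in>I. lt r q}"
    by blast
qed simp

text \<open>The number of predecessors is strictly monotone, hence injective for a total order. No
  element precedes itself, so the values stay within the range, and equal cardinalities give
  surjectivity.\<close>

lemma number_bij: "bij_betw (\<lambda>p. Suc (card {r\<in>I. lt r p})) I {1..card I}"
proof -
  let ?n = "\<lambda>p. Suc (card {r\<in>I. lt r p})"
  have inj: "inj_on ?n I"
  proof (rule inj_onI)
    fix p q assume "p \<in> I" "q \<in> I" "?n p = ?n q"
    then show "p = q"
      using total[of p q] number_less[of p q] number_less[of q p] by auto
  qed
  have "?n ` I \<subseteq> {1..card I}"
  proof (intro image_subsetI)
    fix p assume p: "p \<in> I"
    then have "{r\<in>I. lt r p} \<subset> I"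
      using irrefl by blast
    then have "card {r\<in>I. lt r p} < card I"
      by (intro psubset_card_mono) auto
    then show "?n p \<in> {1..card I}"
      by simp
  qed
  then have "?n ` I = {1..card I}"
    by (intro card_subset_eq) (auto simp: card_image[OF inj])
  then show ?thesis
    using inj by (simp add: bij_betw_def)
qed

end

end

context legendrian_setting
begin

text \<open>The cells over which sheets are totally ordered, so that \<open>sheet_no\<close> and
  \<open>nth_sheet\<close> are inverse to each other. Faces and swallowtail vertices are of this
  kind, the crossing edge is not.\<close>

definition uncrossed :: "'m set \<Rightarrow> bool" where
  "uncrossed e \<longleftrightarrow> e \<in> cells E \<and> (\<forall>p\<in>sheets \<Lambda> e. \<forall>q\<in>sheets \<Lambda> e. \<not> crosses \<Lambda> p q)"

lemma uncrossed_face: "f \<in> cells2 E \<Longrightarrow> uncrossed f"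
  using no_crossings_over_face cells_simps(3) by (auto simp: uncrossed_def)

lemma uncrossed_swallowtail:
  assumes "st_vertex \<Lambda> E v"
  shows "uncrossed v"
  unfolding uncrossed_def
proof
  show "\<forall>p\<in>sheets \<Lambda> v. \<forall>q\<in>sheets \<Lambda> v. \<not> crosses \<Lambda> p q"
    by (rule st_uncrossed[OF assms])
  show "v \<in> cells E"
    using assms cells_simps(1) by (auto simp: st_vertex_def)
qed

lemma uncrossed_total:
  "uncrossed e \<Longrightarrow> p \<in> sheets \<Lambda> e \<Longrightarrow> q \<in> sheets \<Lambda> e \<Longrightarrow> p \<noteq> q \<Longrightarrow> higher \<Lambda> p q \<or> higher \<Lambda> q p"
  using sheet_trichotomy unfolding uncrossed_def by blast

lemma sheet_no_bij:
  assumes "uncrossed e"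
  shows "bij_betw (sheet_no \<Lambda> e) (sheets \<Lambda> e) {1..card (sheets \<Lambda> e)}"
proof -
  have e: "e \<in> cells E"
    using assms by (simp add: uncrossed_def)
  show ?thesis
    unfolding sheet_no_def[abs_def]
    by (rule finite_strict_order.number_bij[OF order_sheets[OF e]]) (rule uncrossed_total[OF assms])
qed

lemma sheet_no_less_iff:
  assumes e: "uncrossed e" and p: "p \<in> sheets \<Lambda> e" and q: "q \<in> sheets \<Lambda> e"
  shows "sheet_no \<Lambda> e p < sheet_no \<Lambda> e q \<longleftrightarrow> higher \<Lambda> p q"
proof -
  have "e \<in> cells E"
    using e by (simp add: uncrossed_def)
  then interpret finite_strict_order "sheets \<Lambda> e" "higher \<Lambda>"
    by (rule order_sheets)
  have *: "card {r \<in> sheets \<Lambda> e. higher \<Lambda> r a} < card {r \<in> sheets \<Lambda> e. higher \<Lambda> r b}"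
    if "a \<in> sheets \<Lambda> e" "b \<in> sheets \<Lambda> e" "higher \<Lambda> a b" for a b
    using that by (intro number_less uncrossed_total[OF e])
  show ?thesis
    using *[OF p q] *[OF q p] uncrossed_total[OF e p q] unfolding sheet_no_def by force
qed

lemma sheet_no_inj:
  "uncrossed e \<Longrightarrow> p \<in> sheets \<Lambda> e \<Longrightarrow> q \<in> sheets \<Lambda> e \<Longrightarrow> sheet_no \<Lambda> e p = sheet_no \<Lambda> e q \<longleftrightarrow> p = q"
  using bij_betw_imp_inj_on[OF sheet_no_bij] by (auto simp: inj_on_def)

lemma nth_sheet_no:
  assumes "uncrossed e" "p \<in> sheets \<Lambda> e"
  shows "nth_sheet \<Lambda> e (sheet_no \<Lambda> e p) = p"
  unfolding nth_sheet_def using assms sheet_no_inj by (intro the_equality) auto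

lemma sheet_no_range:
  "uncrossed e \<Longrightarrow> p \<in> sheets \<Lambda> e \<Longrightarrow> 1 \<le> sheet_no \<Lambda> e p \<and> sheet_no \<Lambda> e p \<le> card (sheets \<Lambda> e)"
  using bij_betwE[OF sheet_no_bij] by auto

lemma nth_sheet:
  assumes e: "uncrossed e" and i: "1 \<le> i" "i \<le> card (sheets \<Lambda> e)"
  shows "nth_sheet \<Lambda> e i \<in> sheets \<Lambda> e" "sheet_no \<Lambda> e (nth_sheet \<Lambda> e i) = i"
proof -
  have "i \<in> sheet_no \<Lambda> e ` sheets \<Lambda> e"
    using bij_betw_imp_surj_on[OF sheet_no_bij[OF e]] i by simp
  then obtain p where "p \<in> sheets \<Lambda> e" "i = sheet_no \<Lambda> e p"
    by blast
  then show "nth_sheet \<Lambda> e i \<in> sheets \<Lambda> e" "sheet_no \<Lambda> e (nth_sheet \<Lambda> e i) = i"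
    using nth_sheet_no[OF e] by auto
qed

text \<open>Sheets are components after removal of the cusp points only. Swallowtail points are
  never cusp points, so they survive as sheets above their vertex.\<close>

lemma swallowtail_sheet:
  assumes st: "st_vertex \<Lambda> E v"
  shows "{st_point \<Lambda> v} \<in> sheets \<Lambda> v"
proof -
  have v: "v \<in> cells0 E"
    using st by (simp add: st_vertex_def)
  have "st_point \<Lambda> v \<notin> cusps \<Lambda>"
    using st_point(1)[OF st] cusps_Int_swallowtails by blast
  then have "st_point \<Lambda> v \<in> base \<Lambda> -` v \<inter> - cusps \<Lambda>"
    using st_point(2)[OF st] by simp
  then have "st_point \<Lambda> v \<in> \<Union>(sheets \<Lambda> v)"
    unfolding sheets_def Union_components by simp
  then obtain p where p: "p \<in> sheets \<Lambda> v" "st_point \<Lambda> v \<in> p"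
    by blast
  obtain s where "p = {s}"
    by (rule vertex_sheet[OF v p(1)]) blast
  then show ?thesis
    using p by auto
qed

lemma st_no_range:
  assumes st: "st_vertex \<Lambda> E v"
  shows "1 \<le> st_no \<Lambda> v \<and> st_no \<Lambda> v \<le> card (sheets \<Lambda> v)"
  unfolding st_no_def by (rule sheet_no_range[OF uncrossed_swallowtail[OF st] swallowtail_sheet[OF st]])

end

section \<open>Swallowtail vertices\<close>

lemma mmul_elem_left:
  assumes "finite I" "i \<in> I" "j \<in> I" "b \<in> I"
  shows "mmul I (madd (mone I) (elem_mat a b)) X i j = X i j + (if i = a then X b j else 0)"
proof -
  have "mmul I (madd (mone I) (elem_mat a b)) X i j =
     mmul I (mone I) X i j + (\<Sum>r\<in>I. elem_mat a b i r * X r j)"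
    using assms by (simp add: mmul_def madd_def distrib_right sum.distrib)
  also have "(\<Sum>r\<in>I. elem_mat a b i r * X r j) = (\<Sum>r\<in>I. if r = b then (if i = a then X b j else 0) else 0)"
    by (rule sum.cong) (auto simp: elem_mat_def)
  finally show ?thesis
    using assms by (simp add: mmul_mone_left)
qed

lemma mmul_elem_right:
  assumes "finite I" "i \<in> I" "j \<in> I" "a \<in> I"
  shows "mmul I X (madd (mone I) (elem_mat a b)) i j = X i j + (if j = b then X i a else 0)"
proof -
  have "mmul I X (madd (mone I) (elem_mat a b)) i j =
     mmul I X (mone I) i j + (\<Sum>r\<in>I. X i r * elem_mat a b r j)"
    using assms by (simp add: mmul_def madd_def distrib_left sum.distrib)
  also have "(\<Sum>r\<in>I. X i r * elem_mat a b r j) = (\<Sum>r\<in>I. if r = a then (if j = b then X i a else 0) else 0)"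
    by (rule sum.cong) (auto simp: elem_mat_def)
  finally show ?thesis
    using assms by (simp add: mmul_mone_right)
qed

text \<open>Expansion of \<open>F X F\<close> for \<open>F = I + E\<close> with \<open>E\<close>
  elementary: row \<open>b\<close> is added to row \<open>a\<close>, then column \<open>a\<close> to
  column \<open>b\<close>. The innermost summand is the entry of \<open>E X E\<close>.\<close>

lemma conj_elem_entry:
  assumes "i \<in> {1..n}" "j \<in> {1..n}" "a \<in> {1..n}" "b \<in> {1..n}"
  shows "conj_elem n a b X i j = X i j + (if i = a then X b j else 0)
     + (if j = b then X i a + (if i = a then X b a else 0) else 0)"
  unfolding conj_elem_def Let_def using assms
  by (simp add: mmul_elem_left mmul_elem_right)

lemma enlarge_upper:
  assumes "\<And>i j. M i j \<noteq> 0 \<Longrightarrow> i < j" "a < b" "enlarge a b M i j \<noteq> 0"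
  shows "i < j"
proof (cases "i \<in> {a,b} \<or> j \<in> {a,b}")
  case True
  then show ?thesis
    using assms(2,3) by (auto simp: enlarge_def split: if_splits)
next
  case False
  then have "unskip a b i < unskip a b j"
    using assms(1,3) by (simp add: enlarge_def)
  then show ?thesis
    using assms(2) by (auto simp: unskip_def split: if_splits)
qed

text \<open>The passage between the numberings of sheets on the two sides of the crossing edge: the
  transposition of \<open>c\<close> and \<open>c + 1\<close>.\<close>

definition swap :: "nat \<Rightarrow> nat \<Rightarrow> nat" where
  "swap c i = (if i = c then c + 1 else if i = c + 1 then c else i)"

lemma swap_inj: "swap c i = swap c j \<longleftrightarrow> i = j"
  by (auto simp: swap_def)

text \<open>\<open>A_S\<close> inserts the cusp pair at positions \<open>k\<close> and
  \<open>k + 2\<close>. Exchanging the last two of the three positions moves it to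
  \<open>k, k + 1\<close>, exchanging the first two moves it to \<open>k + 1, k + 2\<close>: these
  are the positions in \<open>A_T\<close> for an upward and a downward swallowtail. The remaining
  indices keep their place after \<open>unskip\<close>.\<close>

lemma enlarge_swap:
  assumes "l = k + 1" "m = k + 2"
  shows "enlarge k m M i j = enlarge k l M (swap l i) (swap l j)"
    and "enlarge k m M i j = enlarge l m M (swap k i) (swap k j)"
proof -
  have 1: "swap l i \<in> {k,l} \<longleftrightarrow> i \<in> {k,m}" "swap k i \<in> {l,m} \<longleftrightarrow> i \<in> {k,m}" for i
    unfolding assms by (auto simp: swap_def)
  have 2: "swap l i = k \<longleftrightarrow> i = k" "swap k i = l \<longleftrightarrow> i = k"
    "swap l i = l \<longleftrightarrow> i = m" "swap k i = m \<longleftrightarrow> i = m" for i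
    unfolding assms by (auto simp: swap_def)
  have 3: "i \<notin> {k,m} \<Longrightarrow> unskip k l (swap l i) = unskip k m i"
    "i \<notin> {k,m} \<Longrightarrow> unskip l m (swap k i) = unskip k m i" for i
    unfolding assms by (auto simp: swap_def unskip_def)
  show "enlarge k m M i j = enlarge k l M (swap l i) (swap l j)"
    unfolding enlarge_def 1 2 by (auto simp: 3)
  show "enlarge k m M i j = enlarge l m M (swap k i) (swap k j)"
    unfolding enlarge_def 1 2 by (auto simp: 3)
qed

lemma conj_elem_swap:
  assumes "\<And>i j. X i j = Y (swap c i) (swap c j)" "1 \<le> c" "c + 1 \<le> n"
    and "i \<in> {1..n}" "j \<in> {1..n}" "a \<in> {1..n}" "b \<in> {1..n}"
  shows "conj_elem n a b X i j = conj_elem n (swap c a) (swap c b) Y (swap c i) (swap c j)"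
proof -
  have r: "swap c i \<in> {1..n}" if "i \<in> {1..n}" for i
    using assms(2,3) that by (auto simp: swap_def)
  show ?thesis
    unfolding conj_elem_entry[OF assms(4-7)] conj_elem_entry[OF r r r r, OF assms(4-7)] assms(1) swap_inj ..
qed

lemma (in legendrian_setting) gen_mat_upper: "strict_upper (sheets \<Lambda> e) (higher \<Lambda>) (gen_mat \<Lambda> e)"
  by (auto simp: strict_upper_def gen_mat_def)

lemma (in legendrian_setting) gen_mat_dga: "e \<in> cells E \<Longrightarrow> gen_mat \<Lambda> e p q \<in> dga \<Lambda> E"
  by (auto simp: gen_mat_def dga_def generators_def)

lemma (in legendrian_setting) subring_dga: "subring (dga \<Lambda> E)"
  unfolding dga_def by (rule subring_free_alg_on)

section \<open>Numbering of sheets and boundary matrices at a swallowtail\<close>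

locale swallowtail_vertex = legendrian_setting \<Lambda> E
  for \<Lambda> :: "('m::{t2_space,second_countable_topology}, 'l::{t2_space,second_countable_topology}) legendrian"
    and E :: "('m, 'l) decomposition" +
  fixes v :: "'m set"
  assumes st: "st_vertex \<Lambda> E v"
begin

abbreviation "k \<equiv> st_no \<Lambda> v"
abbreviation "n \<equiv> card (sheets \<Lambda> v) + 2"
abbreviation "fS \<equiv> fst (cornerS E v)"
abbreviation "fT \<equiv> fst (cornerT E v)"
abbreviation "cr \<equiv> edge_cr E v"

lemma k_range: "1 \<le> k" "k + 2 \<le> n"
  using st_no_range[OF st] by auto

lemma cr_cell: "cr \<in> cells1 E" "edge_S E v \<in> cells1 E" "edge_T E v \<in> cells1 E"
  using st_edges(1)[OF st] by auto

lemma corner: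
  assumes "st_corner \<Lambda> E v \<kappa> e"
  shows "fst \<kappa> \<in> cells2 E" "card (sheets \<Lambda> (fst \<kappa>)) = n"
    "bij_betw (inc_side \<Lambda> E (fst \<kappa>) (cr_side E v \<kappa>)) (sheets \<Lambda> cr) (sheets \<Lambda> (fst \<kappa>))"
    "embeds \<Lambda> cr (fst \<kappa>) (inc_side \<Lambda> E (fst \<kappa>) (cr_side E v \<kappa>))"
proof -
  obtain f j where \<kappa>: "\<kappa> = (f,j)" by (cases \<kappa>)
  note * = assms[unfolded \<kappa> st_corner_def prod.case]
  show "fst \<kappa> \<in> cells2 E" "card (sheets \<Lambda> (fst \<kappa>)) = n"
    "bij_betw (inc_side \<Lambda> E (fst \<kappa>) (cr_side E v \<kappa>)) (sheets \<Lambda> cr) (sheets \<Lambda> (fst \<kappa>))"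
    unfolding \<kappa> fst_conv by (insert *; elim conjE; assumption)+
  have f: "f \<in> cells2 E" and j: "j < nsides E f" and sides: "{side E f j, side E f (prev_side E f j)} = {cr, e}"
    by (insert *; elim conjE; assumption)+
  have "prev_side E f j < nsides E f"
    using j by (simp add: prev_side_def)
  then have i: "cr_side E v \<kappa> < nsides E f" "side E f (cr_side E v \<kappa>) = cr"
    using j sides by (auto simp: cr_side_def \<kappa>)
  show "embeds \<Lambda> cr (fst \<kappa>) (inc_side \<Lambda> E (fst \<kappa>) (cr_side E v \<kappa>))"
    using inc_side_embeds[OF f i(1)] unfolding i(2) by (simp add: \<kappa>)
qed

lemmas cornerS = corner[OF st_corners(1)[OF st], folded cr_to_S_def]
lemmas cornerT = corner[OF st_corners(2)[OF st], folded cr_to_T_def]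

lemmas uncrossed_S = uncrossed_face[OF cornerS(1)]
lemmas uncrossed_T = uncrossed_face[OF cornerT(1)]

text \<open>The sheets numbered \<open>c\<close> and \<open>c + 1\<close> are those that cross.\<close>

definition c :: nat where
  "c = (if upward \<Lambda> E v then k + 1 else k)"

lemma c_range: "1 \<le> c" "c + 1 \<le> n"
  using k_range by (auto simp: c_def)

lemma crossing_c: "crossing_at \<Lambda> E v c"
  using st_direction[OF st] by (auto simp: c_def upward_def downward_def)

text \<open>Since only one pair crosses, any other sheet over the crossing edge is comparable with
  all the rest, and these comparisons persist in both faces; the number of sheets above it is thus
  the same on either side. The crossing sheets themselves exchange numbers by
  \<open>crossing_at\<close>.\<close>

lemma sheet_no_swap:
  obtains p0 q0 where "p0 \<in> sheets \<Lambda> cr" "q0 \<in> sheets \<Lambda> cr"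
    "sheet_no \<Lambda> fT (cr_to_T \<Lambda> E v p0) = c + 1" "sheet_no \<Lambda> fT (cr_to_T \<Lambda> E v q0) = c"
    "\<And>p q. p \<in> sheets \<Lambda> cr \<Longrightarrow> q \<in> sheets \<Lambda> cr \<Longrightarrow> crosses \<Lambda> p q \<Longrightarrow> {p,q} = {p0,q0}"
    "\<And>p. p \<in> sheets \<Lambda> cr \<Longrightarrow>
       sheet_no \<Lambda> fT (cr_to_T \<Lambda> E v p) = swap c (sheet_no \<Lambda> fS (cr_to_S \<Lambda> E v p))"
proof -
  let ?S = "cr_to_S \<Lambda> E v" and ?T = "cr_to_T \<Lambda> E v"
  obtain p0 q0 where 0: "p0 \<in> sheets \<Lambda> cr" "q0 \<in> sheets \<Lambda> cr" "crosses \<Lambda> p0 q0"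
    "?S p0 = nth_sheet \<Lambda> fS c" "?S q0 = nth_sheet \<Lambda> fS (c + 1)"
    "?T p0 = nth_sheet \<Lambda> fT (c + 1)" "?T q0 = nth_sheet \<Lambda> fT c"
    using crossing_c unfolding crossing_at_def by blast
  note nS = nth_sheet(2)[OF uncrossed_S, unfolded cornerS(2)]
  note nT = nth_sheet(2)[OF uncrossed_T, unfolded cornerT(2)]
  have no: "sheet_no \<Lambda> fS (?S p0) = c" "sheet_no \<Lambda> fS (?S q0) = c + 1"
    "sheet_no \<Lambda> fT (?T p0) = c + 1" "sheet_no \<Lambda> fT (?T q0) = c"
    using nS nT c_range by (simp_all add: 0)
  have one: "{p,q} = {p0,q0}" if "p \<in> sheets \<Lambda> cr" "q \<in> sheets \<Lambda> cr" "crosses \<Lambda> p q" for p q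
    using st_one_crossing[OF st] that 0(1-3) by blast
  have count: "sheet_no \<Lambda> f (\<beta> r) = Suc (card {s \<in> sheets \<Lambda> cr. higher \<Lambda> s r})"
    if bij: "bij_betw \<beta> (sheets \<Lambda> cr) (sheets \<Lambda> f)" and emb: "embeds \<Lambda> cr f \<beta>" and f: "f \<in> cells2 E"
      and r: "r \<in> sheets \<Lambda> cr" "r \<notin> {p0,q0}" for f \<beta> r
  proof -
    have im: "\<beta> ` sheets \<Lambda> cr = sheets \<Lambda> f" and inj: "inj_on \<beta> (sheets \<Lambda> cr)"
      using bij by (auto simp: bij_betw_def)
    have iff: "higher \<Lambda> (\<beta> s) (\<beta> r) \<longleftrightarrow> higher \<Lambda> s r" if s: "s \<in> sheets \<Lambda> cr" for s
    proof
      show "higher \<Lambda> s r \<Longrightarrow> higher \<Lambda> (\<beta> s) (\<beta> r)"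
        using emb s r(1) by (auto simp: embeds_def)
      assume h: "higher \<Lambda> (\<beta> s) (\<beta> r)"
      have fs: "\<beta> s \<in> sheets \<Lambda> f" "\<beta> r \<in> sheets \<Lambda> f"
        using im s r by auto
      have "s \<noteq> r"
        using h finite_strict_order.irrefl[OF order_sheets[OF cells_simps(3)[OF f]] fs(2)] by auto
      moreover have "\<not> higher \<Lambda> r s"
        using emb s r(1) higher_asym[OF cells_simps(3)[OF f] fs h] by (auto simp: embeds_def)
      moreover have "\<not> crosses \<Lambda> s r"
        using one[OF s r(1)] r(2) by blast
      ultimately show "higher \<Lambda> s r"
        using sheet_trichotomy[OF cells_simps(2)[OF cr_cell(1)] s r(1)] by blast
    qed
    have "{q \<in> sheets \<Lambda> f. higher \<Lambda> q (\<beta> r)} = \<beta> ` {s \<in> sheets \<Lambda> cr. higher \<Lambda> s r}"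
      unfolding im[symmetric] using iff by auto
    moreover have "inj_on \<beta> {s \<in> sheets \<Lambda> cr. higher \<Lambda> s r}"
      using inj by (rule inj_on_subset) auto
    ultimately show ?thesis
      by (simp add: sheet_no_def card_image)
  qed
  have "sheet_no \<Lambda> fT (?T p) = swap c (sheet_no \<Lambda> fS (?S p))" if p: "p \<in> sheets \<Lambda> cr" for p
  proof (cases "p \<in> {p0,q0}")
    case True
    then show ?thesis
      using no by (auto simp: swap_def)
  next
    case False
    have eq: "sheet_no \<Lambda> fT (?T p) = sheet_no \<Lambda> fS (?S p)"
      using count[OF cornerT(3,4,1) p False] count[OF cornerS(3,4,1) p False] by simp
    have "?S p \<in> sheets \<Lambda> fS" "?S p0 \<in> sheets \<Lambda> fS" "?S q0 \<in> sheets \<Lambda> fS"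
      using cornerS(3) p 0(1,2) by (auto simp: bij_betw_def)
    moreover have "?S p \<noteq> ?S p0" "?S p \<noteq> ?S q0"
      using cornerS(3) p 0(1,2) False by (auto simp: bij_betw_def inj_on_def)
    ultimately have "sheet_no \<Lambda> fS (?S p) \<noteq> c" "sheet_no \<Lambda> fS (?S p) \<noteq> c + 1"
      using sheet_no_inj[OF uncrossed_S] no(1,2) by metis+
    then show ?thesis
      by (simp add: eq swap_def)
  qed
  then show thesis
    using that[OF 0(1,2) no(3,4) one] by blast
qed

lemma swap_range: "i \<in> {1..n} \<Longrightarrow> swap c i \<in> {1..n}"
  using c_range by (auto simp: swap_def)

lemma st_gen_mat_upper: "st_gen_mat \<Lambda> v i j \<noteq> 0 \<Longrightarrow> i < j"
proof -
  assume "st_gen_mat \<Lambda> v i j \<noteq> 0"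
  then have i: "1 \<le> i" "i \<le> card (sheets \<Lambda> v)" and j: "1 \<le> j" "j \<le> card (sheets \<Lambda> v)"
    and h: "higher \<Lambda> (nth_sheet \<Lambda> v i) (nth_sheet \<Lambda> v j)"
    by (auto simp: st_gen_mat_def gen_mat_def split: if_splits)
  note u = uncrossed_swallowtail[OF st]
  show "i < j"
    using sheet_no_less_iff[OF u nth_sheet(1)[OF u i] nth_sheet(1)[OF u j]] h
      nth_sheet(2)[OF u i] nth_sheet(2)[OF u j] by simp
qed

lemma enlarged_upper: "a < b \<Longrightarrow> enlarge a b (st_gen_mat \<Lambda> v) i j \<noteq> 0 \<Longrightarrow> i < j"
  using enlarge_upper[of "st_gen_mat \<Lambda> v"] st_gen_mat_upper by blast

text \<open>The conjugating factor lies above the diagonal, so triangularity survives. At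
  \<open>(c,c+1)\<close> the entry of the enlarged matrix is zero because exactly one of the two
  indices belongs to the inserted block and the pair is not the position of its 1; the terms added
  by conjugation lie on or below the diagonal. Vanishing there is essential, as the two crossing
  sheets are incomparable over the crossing edge and have the opposite order at
  \<open>S\<close>.\<close>

lemma A_T_upper:
  assumes ij: "i \<in> {1..n}" "j \<in> {1..n}" and nz: "A_T \<Lambda> E v i j \<noteq> 0"
  shows "i < j \<and> (i,j) \<noteq> (c,c+1)"
proof (rule ccontr)
  assume neg: "\<not> (i < j \<and> (i,j) \<noteq> (c,c+1))"
  define l m where "l = k + 1" and "m = k + 2"
  have lm: "k < l" "l < m" "k \<in> {1..n}" "l \<in> {1..n}" "m \<in> {1..n}"
    using k_range by (auto simp: l_def m_def)
  have "A_T \<Lambda> E v i j = 0"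
  proof (cases "upward \<Lambda> E v")
    case True
    define X where "X = enlarge k l (st_gen_mat \<Lambda> v)"
    have X: "j \<le> i \<Longrightarrow> X i j = 0" for i j
      using enlarged_upper[OF lm(1), of i j] unfolding X_def by (meson leD)
    have X0: "X l m = 0"
      using lm by (simp add: X_def enlarge_def)
    have *: "A_T \<Lambda> E v i j = X i j + (if i = l then X m j else 0)
       + (if j = m then X i l + (if i = l then X m l else 0) else 0)"
      using True unfolding A_T_def Let_def l_def[symmetric] m_def[symmetric] X_def[symmetric]
      by (simp only: if_True conj_elem_entry[OF ij lm(4,5)])
    have "j \<le> i \<or> i = l \<and> j = m"
      using neg True by (auto simp: c_def l_def m_def)
    then have "X i j = 0" "i = l \<Longrightarrow> X m j = 0" "j = m \<Longrightarrow> X i l = 0" "X m l = 0"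
      using X0 X[of j i] X[of j m] X[of l i] X[of l m] lm by auto
    then show ?thesis
      using X[of m m] unfolding * by simp
  next
    case False
    define X where "X = enlarge l m (st_gen_mat \<Lambda> v)"
    have X: "j \<le> i \<Longrightarrow> X i j = 0" for i j
      using enlarged_upper[OF lm(2), of i j] unfolding X_def by (meson leD)
    have X0: "X k l = 0"
      using lm by (simp add: X_def enlarge_def)
    have *: "A_T \<Lambda> E v i j = X i j + (if i = k then X l j else 0)
       + (if j = l then X i k + (if i = k then X l k else 0) else 0)"
      using False unfolding A_T_def Let_def l_def[symmetric] m_def[symmetric] X_def[symmetric]
      by (simp only: if_False conj_elem_entry[OF ij lm(3,4)])
    have "j \<le> i \<or> i = k \<and> j = l"
      using neg False by (auto simp: c_def l_def)
    then have "X i j = 0" "i = k \<Longrightarrow> X l j = 0" "j = l \<Longrightarrow> X i k = 0" "X l k = 0"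
      using X0 X[of j i] X[of j l] X[of k i] X[of k l] lm by auto
    then show ?thesis
      using X[of l l] unfolding * by simp
  qed
  then show False
    using nz by simp
qed

text \<open>The transposition matches the enlarged matrices by \<open>enlarge_swap\<close> and at
  the same time reverses the indices of the elementary factor: \<open>(k+2,k+1)\<close> becomes
  \<open>(k+1,k+2)\<close> for an upward swallowtail, and \<open>(k+1,k)\<close> becomes
  \<open>(k,k+1)\<close> for a downward one.\<close>

lemma A_S_swap:
  assumes ij: "i \<in> {1..n}" "j \<in> {1..n}"
  shows "A_S \<Lambda> E v i j = A_T \<Lambda> E v (swap c i) (swap c j)"
proof -
  define l m where "l = k + 1" and "m = k + 2"
  have lm: "k \<in> {1..n}" "l \<in> {1..n}" "m \<in> {1..n}"
    using k_range by (auto simp: l_def m_def)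
  have sw: "swap l l = m" "swap l m = l" "swap k k = l" "swap k l = k"
    by (auto simp: swap_def l_def m_def)
  note en = enlarge_swap[OF l_def m_def]
  show ?thesis
  proof (cases "upward \<Lambda> E v")
    case True
    have c: "c = l"
      using True by (simp add: c_def l_def)
    have "conj_elem n m l (enlarge k m (st_gen_mat \<Lambda> v)) i j =
       conj_elem n l m (enlarge k l (st_gen_mat \<Lambda> v)) (swap l i) (swap l j)"
      using conj_elem_swap[where Y="enlarge k l (st_gen_mat \<Lambda> v)", OF en(1) c_range[unfolded c] ij lm(3,2)] unfolding sw .
    then show ?thesis
      using True unfolding A_S_def A_T_def Let_def c l_def[symmetric] m_def[symmetric] by simp
  next
    case False
    have c: "c = k"
      using False by (simp add: c_def)
    have "conj_elem n l k (enlarge k m (st_gen_mat \<Lambda> v)) i j =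
       conj_elem n k l (enlarge l m (st_gen_mat \<Lambda> v)) (swap k i) (swap k j)"
      using conj_elem_swap[where Y="enlarge l m (st_gen_mat \<Lambda> v)", OF en(2) c_range[unfolded c] ij lm(2,1)] unfolding sw .
    then show ?thesis
      using False unfolding A_S_def A_T_def Let_def c l_def[symmetric] m_def[symmetric] by simp
  qed
qed

text \<open>The elementary factors of \<open>A_S\<close> lie below the diagonal, so triangularity is
  not visible from its definition. But \<open>swap\<close> reverses the order of only one pair, and
  the entry of \<open>A_T\<close> at that pair is zero.\<close>

lemma A_S_upper:
  assumes "i \<in> {1..n}" "j \<in> {1..n}" "A_S \<Lambda> E v i j \<noteq> 0"
  shows "i < j"
  using A_T_upper[OF swap_range[OF assms(1)] swap_range[OF assms(2)]] assms(3)
  unfolding A_S_swap[OF assms(1,2)] by (auto simp: swap_def split: if_splits)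

text \<open>Shows that \<open>bdry_A1\<close> at the crossing edge does not depend on the sheet
  order chosen there, which allows comparison with diagrams, where the differential always comes
  from the \<open>T\<close> side.\<close>

lemma transport_cr:
  assumes "p \<in> sheets \<Lambda> cr" "q \<in> sheets \<Lambda> cr"
  shows "by_number \<Lambda> fS (A_S \<Lambda> E v) (cr_to_S \<Lambda> E v p) (cr_to_S \<Lambda> E v q)
     = by_number \<Lambda> fT (A_T \<Lambda> E v) (cr_to_T \<Lambda> E v p) (cr_to_T \<Lambda> E v q)"
proof -
  have sh: "cr_to_S \<Lambda> E v p \<in> sheets \<Lambda> fS" "cr_to_S \<Lambda> E v q \<in> sheets \<Lambda> fS"
    "cr_to_T \<Lambda> E v p \<in> sheets \<Lambda> fT" "cr_to_T \<Lambda> E v q \<in> sheets \<Lambda> fT"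
    using cornerS(3) cornerT(3) assms by (auto simp: bij_betw_def)
  have r: "sheet_no \<Lambda> fS (cr_to_S \<Lambda> E v p) \<in> {1..n}" "sheet_no \<Lambda> fS (cr_to_S \<Lambda> E v q) \<in> {1..n}"
    using sheet_no_range[OF uncrossed_S] sh(1,2) unfolding cornerS(2) by simp_all
  have "sheet_no \<Lambda> fT (cr_to_T \<Lambda> E v p) = swap c (sheet_no \<Lambda> fS (cr_to_S \<Lambda> E v p))"
    "sheet_no \<Lambda> fT (cr_to_T \<Lambda> E v q) = swap c (sheet_no \<Lambda> fS (cr_to_S \<Lambda> E v q))"
    using assms by (metis sheet_no_swap)+
  then show ?thesis
    using sh A_S_swap[OF r] by (simp add: by_number_def)
qed

lemma S_to_T_sheet: "p \<in> sheets \<Lambda> fS \<Longrightarrow> S_to_T \<Lambda> E v p \<in> sheets \<Lambda> fT"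
  unfolding S_to_T_def using cornerS(3) cornerT(3)
  by (metis bij_betwE bij_betw_def inv_into_into)

lemma transport_S:
  assumes "p \<in> sheets \<Lambda> fS" "q \<in> sheets \<Lambda> fS"
  shows "by_number \<Lambda> fS (A_S \<Lambda> E v) p q
     = by_number \<Lambda> fT (A_T \<Lambda> E v) (S_to_T \<Lambda> E v p) (S_to_T \<Lambda> E v q)"
proof -
  have im: "cr_to_S \<Lambda> E v ` sheets \<Lambda> cr = sheets \<Lambda> fS"
    using cornerS(3) by (simp add: bij_betw_def)
  let ?i = "inv_into (sheets \<Lambda> cr) (cr_to_S \<Lambda> E v)"
  have "?i p \<in> sheets \<Lambda> cr" "?i q \<in> sheets \<Lambda> cr" "cr_to_S \<Lambda> E v (?i p) = p" "cr_to_S \<Lambda> E v (?i q) = q"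
    using assms by (auto simp: im[symmetric] inv_into_into f_inv_into_f)
  then show ?thesis
    using transport_cr[of "?i p" "?i q"] by (simp add: S_to_T_def)
qed

text \<open>Order of the numbers is weaker than \<open>higher\<close> over the crossing edge, where
  the crossing sheets are incomparable; the vanishing entry at \<open>(c,c+1)\<close> removes this
  pair. The reversed order is impossible because \<open>cr_to_T\<close> preserves
  \<open>higher\<close>.\<close>

lemma transport_cr_upper:
  "strict_upper (sheets \<Lambda> cr) (higher \<Lambda>)
     (\<lambda>p q. by_number \<Lambda> fT (A_T \<Lambda> E v) (cr_to_T \<Lambda> E v p) (cr_to_T \<Lambda> E v q))"
  unfolding strict_upper_def
proof (intro ballI impI)
  fix p q assume p: "p \<in> sheets \<Lambda> cr" and q: "q \<in> sheets \<Lambda> cr"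
    and nz: "by_number \<Lambda> fT (A_T \<Lambda> E v) (cr_to_T \<Lambda> E v p) (cr_to_T \<Lambda> E v q) \<noteq> 0"
  let ?p = "cr_to_T \<Lambda> E v p" and ?q = "cr_to_T \<Lambda> E v q"
  have sh: "?p \<in> sheets \<Lambda> fT" "?q \<in> sheets \<Lambda> fT"
    using cornerT(3) p q by (auto simp: bij_betw_def)
  have r: "sheet_no \<Lambda> fT ?p \<in> {1..n}" "sheet_no \<Lambda> fT ?q \<in> {1..n}"
    using sheet_no_range[OF uncrossed_T] sh unfolding cornerT(2) by simp_all
  have less: "sheet_no \<Lambda> fT ?p < sheet_no \<Lambda> fT ?q" "(sheet_no \<Lambda> fT ?p, sheet_no \<Lambda> fT ?q) \<noteq> (c, c+1)"
    using A_T_upper[OF r] nz sh by (auto simp: by_number_def)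
  then have h: "higher \<Lambda> ?p ?q"
    using sheet_no_less_iff[OF uncrossed_T sh] by simp
  obtain p0 q0 where 0: "sheet_no \<Lambda> fT (cr_to_T \<Lambda> E v p0) = c + 1" "sheet_no \<Lambda> fT (cr_to_T \<Lambda> E v q0) = c"
    "crosses \<Lambda> p q \<Longrightarrow> {p,q} = {p0,q0}"
    by (rule sheet_no_swap) (use p q in blast)
  have "\<not> crosses \<Lambda> p q"
    using 0 less by (auto simp: doubleton_eq_iff)
  moreover have "p \<noteq> q"
    using less by auto
  moreover have "\<not> higher \<Lambda> q p"
    using cornerT(4) p q higher_asym[OF cells_simps(3)[OF cornerT(1)] sh h] by (auto simp: embeds_def)
  ultimately show "higher \<Lambda> p q"
    using sheet_trichotomy[OF cells_simps(2)[OF cr_cell(1)] p q] by blast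
qed

lemma by_number_upper:
  assumes "uncrossed f" "\<And>i j. i \<in> {1..card (sheets \<Lambda> f)} \<Longrightarrow> j \<in> {1..card (sheets \<Lambda> f)} \<Longrightarrow> X i j \<noteq> 0 \<Longrightarrow> i < j"
  shows "strict_upper (sheets \<Lambda> f) (higher \<Lambda>) (by_number \<Lambda> f X)"
  unfolding strict_upper_def
proof (intro ballI impI)
  fix p q assume p: "p \<in> sheets \<Lambda> f" and q: "q \<in> sheets \<Lambda> f" and "by_number \<Lambda> f X p q \<noteq> 0"
  then have "sheet_no \<Lambda> f p < sheet_no \<Lambda> f q"
    using sheet_no_range[OF assms(1) p] sheet_no_range[OF assms(1) q]
    by (intro assms(2)) (auto simp: by_number_def)
  then show "higher \<Lambda> p q"
    using sheet_no_less_iff[OF assms(1) p q] by simp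
qed

lemma mone_sheet_no:
  assumes "uncrossed f" "p \<in> sheets \<Lambda> f" "q \<in> sheets \<Lambda> f" "card (sheets \<Lambda> f) = m"
  shows "mone {1..m} (sheet_no \<Lambda> f p) (sheet_no \<Lambda> f q) = mone (sheets \<Lambda> f) p q"
  using assms sheet_no_range[OF assms(1,2)] sheet_no_inj[OF assms(1,2,3)] by (simp add: mone_def)

lemma by_number_unipotent:
  assumes "uncrossed f" "card (sheets \<Lambda> f) = m"
    "\<And>i j. i \<in> {1..m} \<Longrightarrow> j \<in> {1..m} \<Longrightarrow> X i j - mone {1..m} i j \<noteq> 0 \<Longrightarrow> i < j"
  shows "unipotent (sheets \<Lambda> f) (higher \<Lambda>) (by_number \<Lambda> f X)"
proof -
  have "strict_upper (sheets \<Lambda> f) (higher \<Lambda>) (by_number \<Lambda> f (\<lambda>i j. X i j - mone {1..m} i j))"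
    by (rule by_number_upper[OF assms(1)]) (use assms(2,3) in blast)
  moreover have "by_number \<Lambda> f (\<lambda>i j. X i j - mone {1..m} i j) p q = by_number \<Lambda> f X p q - mone (sheets \<Lambda> f) p q"
    if "p \<in> sheets \<Lambda> f" "q \<in> sheets \<Lambda> f" for p q
    using that by (simp add: by_number_def mone_sheet_no[OF assms(1) that assms(2)] del: One_nat_def)
  ultimately show ?thesis
    unfolding unipotent_def strict_upper_def by simp
qed

lemma mat_S_unipotent: "unipotent (sheets \<Lambda> fS) (higher \<Lambda>) (by_number \<Lambda> fS (mat_S \<Lambda> E v))"
proof (rule by_number_unipotent[OF uncrossed_S cornerS(2)])
  fix i j assume nz: "mat_S \<Lambda> E v i j - mone {1..n} i j \<noteq> 0"
  show "i < j"
  proof (rule ccontr)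
    assume "\<not> i < j"
    then have z: "m < j' \<Longrightarrow> a * elem_mat m j' i j = 0" "m < j' \<Longrightarrow> elem_mat m j' i j = (0 :: ('m, 'l) cell_alg)"
      for m j' and a :: "('m, 'l) cell_alg"
      by (auto simp: elem_mat_def)
    have "(\<Sum>m\<in>{1..<k}. st_gen_mat \<Lambda> v m k * elem_mat m k i j) = 0"
      "(\<Sum>m\<in>{k<..card (sheets \<Lambda> v)}. st_gen_mat \<Lambda> v k m * elem_mat (k+2) (m+2) i j) = 0"
      by (intro sum.neutral ballI z; simp)+
    then show False
      using nz unfolding mat_S_def Let_def by (simp add: z split: if_splits)
  qed
qed

lemma mat_T_unipotent: "unipotent (sheets \<Lambda> fT) (higher \<Lambda>) (by_number \<Lambda> fT (mat_T \<Lambda> E v))"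
  by (rule by_number_unipotent[OF uncrossed_T cornerT(2)])
    (auto simp: mat_T_def Let_def elem_mat_def split: if_splits)

lemma swallowtail_dga:
  "A_S \<Lambda> E v i j \<in> dga \<Lambda> E" "A_T \<Lambda> E v i j \<in> dga \<Lambda> E" "mat_S \<Lambda> E v i j \<in> dga \<Lambda> E" "mat_T \<Lambda> E v i j \<in> dga \<Lambda> E"
proof -
  interpret subring "dga \<Lambda> E"
    by (rule subring_dga)
  have v: "v \<in> cells E"
    using uncrossed_swallowtail[OF st] by (simp add: uncrossed_def)
  have g: "st_gen_mat \<Lambda> v i j \<in> dga \<Lambda> E" for i j
    by (simp add: st_gen_mat_def gen_mat_dga[OF v])
  have e: "elem_mat a b i j \<in> dga \<Lambda> E" for a b i j :: nat
    by (simp add: elem_mat_def)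
  have en: "enlarge a b (st_gen_mat \<Lambda> v) i j \<in> dga \<Lambda> E" for a b i j
    by (simp add: enlarge_def g)
  have conj: "conj_elem m a b (enlarge a' b' (st_gen_mat \<Lambda> v)) i j \<in> dga \<Lambda> E" for m a b a' b' i j
    unfolding conj_elem_def Let_def madd_def
    by (intro mmul_in_R R_add mone_in_R e en)
  show "A_S \<Lambda> E v i j \<in> dga \<Lambda> E" "A_T \<Lambda> E v i j \<in> dga \<Lambda> E"
    unfolding A_S_def A_T_def Let_def by (simp_all add: conj)
  show "mat_S \<Lambda> E v i j \<in> dga \<Lambda> E" "mat_T \<Lambda> E v i j \<in> dga \<Lambda> E"
    unfolding mat_S_def mat_T_def Let_def
    by (auto intro!: R_add R_sum R_mult mone_in_R e g)
qed

end

section \<open>Triangularity of the differential\<close>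

context legendrian_setting
begin

lemma place_embeds:
  assumes "embeds \<Lambda> e' e \<iota>" "p' \<in> sheets \<Lambda> e'" "q' \<in> sheets \<Lambda> e'"
  shows "place \<iota> (sheets \<Lambda> e') X (\<iota> p') (\<iota> q') = X p' q'"
  using assms by (simp add: place_def embeds_def)

lemma place_upper:
  assumes "embeds \<Lambda> e' e \<iota>" "strict_upper (sheets \<Lambda> e') (higher \<Lambda>) X"
  shows "strict_upper (sheets \<Lambda> e) (higher \<Lambda>) (place \<iota> (sheets \<Lambda> e') X)"
  unfolding strict_upper_def
proof (intro ballI impI)
  fix p q assume nz: "place \<iota> (sheets \<Lambda> e') X p q \<noteq> 0"
  then obtain p' q' where pq: "p = \<iota> p'" "q = \<iota> q'" "p' \<in> sheets \<Lambda> e'" "q' \<in> sheets \<Lambda> e'"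
    by (auto simp: place_def split: if_splits)
  then have "X p' q' \<noteq> 0"
    using nz place_embeds[OF assms(1) pq(3,4), of X] by (simp add: pq(1,2))
  then have "higher \<Lambda> p' q'"
    using assms(2) pq(3,4) by (simp add: strict_upper_def)
  then show "higher \<Lambda> p q"
    using assms(1) pq by (simp add: embeds_def)
qed

lemma strict_upper_madd:
  assumes "e \<in> cells E" "strict_upper (sheets \<Lambda> e) (higher \<Lambda>) X" "strict_upper (sheets \<Lambda> e) (higher \<Lambda>) Y"
  shows "strict_upper (sheets \<Lambda> e) (higher \<Lambda>) (madd X Y)"
  using finite_strict_order.strict_upper_add[OF order_sheets[OF assms(1)] assms(2,3)]
  by (simp add: madd_def[abs_def])

lemma place_dga: "e' \<in> cells E \<Longrightarrow> place \<iota> I (gen_mat \<Lambda> e') p q \<in> dga \<Lambda> E"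
  using subring.R_0[OF subring_dga] gen_mat_dga by (simp add: place_def)

lemma by_number_dga: "(\<And>i j. X i j \<in> dga \<Lambda> E) \<Longrightarrow> by_number \<Lambda> e X p q \<in> dga \<Lambda> E"
  using subring.R_0[OF subring_dga] by (simp add: by_number_def)

lemma bdry_A1_swallowtail:
  assumes st: "st_vertex \<Lambda> E (end1 E e t)" and e: "e = edge_cr E (end1 E e t)"
    and p: "p \<in> sheets \<Lambda> e" and q: "q \<in> sheets \<Lambda> e"
  shows "bdry_A1 \<Lambda> E e t p q = by_number \<Lambda> (fst (cornerT E (end1 E e t))) (A_T \<Lambda> E (end1 E e t))
     (cr_to_T \<Lambda> E (end1 E e t) p) (cr_to_T \<Lambda> E (end1 E e t) q)"
proof -
  interpret swallowtail_vertex \<Lambda> E "end1 E e t"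
    by unfold_locales (rule st)
  show ?thesis
    using st e transport_cr[of p q] p q unfolding bdry_A1_def Let_def by simp
qed

lemma bdry_A1_upper:
  assumes e: "e \<in> cells1 E" and t: "t \<in> {0,1}"
  shows "strict_upper (sheets \<Lambda> e) (higher \<Lambda>) (bdry_A1 \<Lambda> E e t)"
proof (cases "st_vertex \<Lambda> E (end1 E e t) \<and> e = edge_cr E (end1 E e t)")
  case True
  interpret swallowtail_vertex \<Lambda> E "end1 E e t"
    by unfold_locales (use True in blast)
  show ?thesis
    using transport_cr_upper bdry_A1_swallowtail[of e t] True unfolding strict_upper_def by simp
next
  case False
  have "strict_upper (sheets \<Lambda> e) (higher \<Lambda>) (\<lambda>p q. if cusp_pair1 \<Lambda> E e t p q then 1 else 0 :: ('m,'l) cell_alg)"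
    by (simp add: strict_upper_def cusp_pair1_def)
  then have "strict_upper (sheets \<Lambda> e) (higher \<Lambda>)
      (madd (place (inc1 \<Lambda> E e t) (sheets \<Lambda> (end1 E e t)) (gen_mat \<Lambda> (end1 E e t)))
        (\<lambda>p q. if cusp_pair1 \<Lambda> E e t p q then 1 else 0))"
    by (intro strict_upper_madd[OF cells_simps(2)[OF e]]
      place_upper[OF inc1_embeds(1)[OF e t refl False] gen_mat_upper])
  then show ?thesis
    using False unfolding bdry_A1_def Let_def by (simp only: if_False)
qed

lemma bdry_A1_dga:
  assumes e: "e \<in> cells1 E" and t: "t \<in> {0,1}"
  shows "bdry_A1 \<Lambda> E e t p q \<in> dga \<Lambda> E"
proof (cases "st_vertex \<Lambda> E (end1 E e t) \<and> e = edge_cr E (end1 E e t)")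
  case True
  interpret swallowtail_vertex \<Lambda> E "end1 E e t"
    by unfold_locales (use True in blast)
  show ?thesis
    unfolding bdry_A1_def Let_def using True by (auto intro!: by_number_dga swallowtail_dga)
next
  case False
  interpret subring "dga \<Lambda> E"
    by (rule subring_dga)
  show ?thesis
    using False place_dga[OF cells_simps(1)[OF end1_cell[OF e t]]]
    unfolding bdry_A1_def Let_def madd_def by (auto intro!: R_add)
qed

lemma bdry_A2_upper:
  assumes f: "f \<in> cells2 E" and j: "j < nsides E f"
  shows "strict_upper (sheets \<Lambda> f) (higher \<Lambda>) (bdry_A2 \<Lambda> E f j)"
proof (cases "st_vertex \<Lambda> E (vertex2 E f j) \<and> ((f,j) = cornerS E (vertex2 E f j) \<or> (f,j) = cornerT E (vertex2 E f j))")
  case True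
  interpret swallowtail_vertex \<Lambda> E "vertex2 E f j"
    by unfold_locales (use True in blast)
  show ?thesis
  proof (cases "(f,j) = cornerS E (vertex2 E f j)")
    case S: True
    then have eq: "bdry_A2 \<Lambda> E f j = by_number \<Lambda> f (A_S \<Lambda> E (vertex2 E f j))"
      using True unfolding bdry_A2_def Let_def by simp
    have card: "card (sheets \<Lambda> f) = n"
      using cornerS(2) S True by (metis fst_conv)
    show ?thesis
      unfolding eq by (rule by_number_upper[OF uncrossed_face[OF f]], unfold card) (use A_S_upper in blast)
  next
    case S: False
    then have eq: "bdry_A2 \<Lambda> E f j = by_number \<Lambda> f (A_T \<Lambda> E (vertex2 E f j))"
      using True unfolding bdry_A2_def Let_def by simp
    have card: "card (sheets \<Lambda> f) = n"
      using cornerT(2) S True by (metis fst_conv)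
    show ?thesis
      unfolding eq by (rule by_number_upper[OF uncrossed_face[OF f]], unfold card) (use A_T_upper in blast)
  qed
next
  case False
  have "strict_upper (sheets \<Lambda> f) (higher \<Lambda>) (\<lambda>p q. if cusp_pair2 \<Lambda> E f j p q then 1 else 0 :: ('m,'l) cell_alg)"
    by (simp add: strict_upper_def cusp_pair2_def)
  then have "strict_upper (sheets \<Lambda> f) (higher \<Lambda>)
      (madd (place (inc2 \<Lambda> E f j) (sheets \<Lambda> (vertex2 E f j)) (gen_mat \<Lambda> (vertex2 E f j)))
        (\<lambda>p q. if cusp_pair2 \<Lambda> E f j p q then 1 else 0))"
    by (intro strict_upper_madd[OF cells_simps(3)[OF f]]
      place_upper[OF inc2_embeds(1)[OF f j refl False] gen_mat_upper])
  then show ?thesis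
    using False unfolding bdry_A2_def Let_def by auto
qed

lemma bdry_A2_dga:
  assumes f: "f \<in> cells2 E" and j: "j < nsides E f"
  shows "bdry_A2 \<Lambda> E f j p q \<in> dga \<Lambda> E"
proof (cases "st_vertex \<Lambda> E (vertex2 E f j) \<and> ((f,j) = cornerS E (vertex2 E f j) \<or> (f,j) = cornerT E (vertex2 E f j))")
  case True
  interpret swallowtail_vertex \<Lambda> E "vertex2 E f j"
    by unfold_locales (use True in blast)
  show ?thesis
    unfolding bdry_A2_def Let_def using True by (auto intro!: by_number_dga swallowtail_dga)
next
  case False
  interpret subring "dga \<Lambda> E"
    by (rule subring_dga)
  show ?thesis
    using False place_dga[OF cells_simps(1)[OF vertex2_cell[OF f j]]]
    unfolding bdry_A2_def Let_def madd_def by (auto intro!: R_add)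
qed

lemma side_factor:
  assumes f: "f \<in> cells2 E" and i: "i < nsides E f"
  shows side_factor_unipotent: "unipotent (sheets \<Lambda> f) (higher \<Lambda>) (side_factor \<Lambda> E f i)"
    and side_factor_dga: "p \<in> sheets \<Lambda> f \<Longrightarrow> q \<in> sheets \<Lambda> f \<Longrightarrow> side_factor \<Lambda> E f i p q \<in> dga \<Lambda> E"
proof -
  interpret subring "dga \<Lambda> E"
    by (rule subring_dga)
  interpret finite_strict_order "sheets \<Lambda> f" "higher \<Lambda>"
    by (rule order_sheets[OF cells_simps(3)[OF f]])
  define e where "e = side E f i"
  have e: "e \<in> cells1 E"
    using cell_structure(4)[OF f i] by (simp add: e_def)
  define v where "v = end1 E e 0"
  define M where "M = madd (mone (sheets \<Lambda> f)) (place (inc_side \<Lambda> E f i) (sheets \<Lambda> e) (gen_mat \<Lambda> e))"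
  have M1: "unipotent (sheets \<Lambda> f) (higher \<Lambda>) M"
    using place_upper[OF inc_side_embeds[OF f i] gen_mat_upper]
    by (simp add: unipotent_def M_def madd_def e_def)
  have M2: "M p q \<in> dga \<Lambda> E" for p q
    unfolding M_def madd_def by (intro R_add mone_in_R place_dga cells_simps(2)[OF e])
  have sf: "side_factor \<Lambda> E f i = (if st_vertex \<Lambda> E v \<and> f = fst (cornerS E v) \<and> e = edge_S E v
       then mmul (sheets \<Lambda> f) M (by_number \<Lambda> f (mat_S \<Lambda> E v))
     else if st_vertex \<Lambda> E v \<and> f = fst (cornerT E v) \<and> e = edge_T E v
       then mmul (sheets \<Lambda> f) M (by_number \<Lambda> f (mat_T \<Lambda> E v))
     else M)"
    unfolding side_factor_def Let_def e_def[symmetric] v_def[symmetric] M_def[symmetric] ..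
  have st: "unipotent (sheets \<Lambda> f) (higher \<Lambda>) (side_factor \<Lambda> E f i)
      \<and> side_factor \<Lambda> E f i p q \<in> dga \<Lambda> E" if v: "st_vertex \<Lambda> E v" for p q
  proof -
    interpret swallowtail_vertex \<Lambda> E v
      by unfold_locales (rule v)
    have *: "unipotent (sheets \<Lambda> f) (higher \<Lambda>) (mmul (sheets \<Lambda> f) M (by_number \<Lambda> f X))
        \<and> mmul (sheets \<Lambda> f) M (by_number \<Lambda> f X) p q \<in> dga \<Lambda> E"
      if "unipotent (sheets \<Lambda> f) (higher \<Lambda>) (by_number \<Lambda> f X)" "\<And>i j. X i j \<in> dga \<Lambda> E" for X
      by (intro conjI unipotent_mmul mmul_in_R M1 M2 by_number_dga that)
    have S: "f = fS \<Longrightarrow> unipotent (sheets \<Lambda> f) (higher \<Lambda>) (by_number \<Lambda> f (mat_S \<Lambda> E v))"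
      and T: "f = fT \<Longrightarrow> unipotent (sheets \<Lambda> f) (higher \<Lambda>) (by_number \<Lambda> f (mat_T \<Lambda> E v))"
      using mat_S_unipotent mat_T_unipotent by simp_all
    show ?thesis
      using *[OF S swallowtail_dga(3)] *[OF T swallowtail_dga(4)] M1 M2 unfolding sf by simp
  qed
  then show "unipotent (sheets \<Lambda> f) (higher \<Lambda>) (side_factor \<Lambda> E f i)"
    by (cases "st_vertex \<Lambda> E v") (simp_all add: sf M1)
  show "side_factor \<Lambda> E f i p q \<in> dga \<Lambda> E"
    using st by (cases "st_vertex \<Lambda> E v") (simp_all add: sf M2)
qed

lemma path_product_snoc:
  "path_product \<Lambda> E f (\<pi> @ [(i,b)]) = mmul (sheets \<Lambda> f)
     (if b then side_factor \<Lambda> E f i else minverse (sheets \<Lambda> f) (side_factor \<Lambda> E f i)) (path_product \<Lambda> E f \<pi>)"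
  by (simp add: path_product_def)

text \<open>Unipotence is needed along the way, not only in the end: it guarantees that the inverses
  of factors traversed backwards exist and have entries in the DGA.\<close>

lemma path_product:
  assumes f: "f \<in> cells2 E" and \<pi>: "\<forall>(i,b)\<in>set \<pi>. i < nsides E f"
  shows "unipotent (sheets \<Lambda> f) (higher \<Lambda>) (path_product \<Lambda> E f \<pi>) \<and> (\<forall>p q. path_product \<Lambda> E f \<pi> p q \<in> dga \<Lambda> E)"
  using \<pi>
proof (induction \<pi> rule: rev_induct)
  interpret subring "dga \<Lambda> E"
    by (rule subring_dga)
  interpret finite_strict_order "sheets \<Lambda> f" "higher \<Lambda>"
    by (rule order_sheets[OF cells_simps(3)[OF f]])
  case Nil
  then show ?case
    by (simp add: path_product_def unipotent_mone mone_in_R)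
next
  interpret subring "dga \<Lambda> E"
    by (rule subring_dga)
  interpret finite_strict_order "sheets \<Lambda> f" "higher \<Lambda>"
    by (rule order_sheets[OF cells_simps(3)[OF f]])
  case (snoc x \<pi>)
  obtain i b where x: "x = (i,b)" by (cases x)
  have i: "i < nsides E f"
    using snoc.prems by (simp add: x)
  have IH: "unipotent (sheets \<Lambda> f) (higher \<Lambda>) (path_product \<Lambda> E f \<pi>)" "path_product \<Lambda> E f \<pi> p q \<in> dga \<Lambda> E" for p q
    using snoc by auto
  note inv = unipotent_inverse[OF side_factor_unipotent[OF f i] side_factor_dga[OF f i] subring_dga]
  show ?case
    unfolding x path_product_snoc using IH inv(2,3) side_factor[OF f i]
    by (auto intro!: unipotent_mmul mmul_in_R)
qed

lemma path_sides:
  assumes f: "f \<in> cells2 E"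
  shows "\<forall>(i,b)\<in>set (ccw_path E f). i < nsides E f" "\<forall>(i,b)\<in>set (cw_path E f). i < nsides E f"
proof -
  have "0 < nsides E f"
    using cell_structure(3)[OF f] by simp
  then show "\<forall>(i,b)\<in>set (ccw_path E f). i < nsides E f" "\<forall>(i,b)\<in>set (cw_path E f). i < nsides E f"
    by (auto simp: ccw_path_def cw_path_def Let_def)
qed

lemma cell_algebra_char_2: "(a :: ('m,'l) cell_alg) + a = 0"
  by (rule poly_mapping_eqI) (simp add: lookup_add)

text \<open>The individual terms are not all strictly upper. For an edge, \<open>I + B\<close> is
  expanded, leaving the boundary matrices and their products with \<open>B\<close>; for a face, each
  path product has an identity part, and the two identities cancel in characteristic 2.\<close>

lemma gen_boundary:
  assumes e: "e \<in> cells E"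
  shows gen_boundary_upper: "strict_upper (sheets \<Lambda> e) (higher \<Lambda>) (\<lambda>p q. gen_boundary \<Lambda> E (e,p,q))"
    and gen_boundary_dga: "gen_boundary \<Lambda> E (e,p,q) \<in> dga \<Lambda> E"
proof -
  interpret subring "dga \<Lambda> E"
    by (rule subring_dga)
  interpret finite_strict_order "sheets \<Lambda> e" "higher \<Lambda>"
    by (rule order_sheets[OF e])
  let ?I = "sheets \<Lambda> e" and ?G = "gen_mat \<Lambda> e"
  note G = gen_mat_upper[of e] gen_mat_dga[OF e]
  have *: "strict_upper ?I (higher \<Lambda>) (\<lambda>p q. gen_boundary \<Lambda> E (e,p,q)) \<and> gen_boundary \<Lambda> E (e,p,q) \<in> dga \<Lambda> E" for p q
  proof -
    consider "e \<in> cells0 E" | "e \<in> cells1 E" "e \<notin> cells0 E" | "e \<in> cells2 E" "e \<notin> cells0 E" "e \<notin> cells1 E"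
      using e cell_structure(5-7) by (auto simp: cells_def)
    then show ?thesis
    proof cases
      case 1
      then show ?thesis
        unfolding gen_boundary_def Let_def prod.case using G
        by (auto intro!: strict_upper_mmul mmul_in_R)
    next
      case 2
      have t: "(1::real) \<in> {0,1}" "(0::real) \<in> {0,1}"
        by auto
      note A = bdry_A1_upper[OF 2(1)] bdry_A1_dga[OF 2(1)]
      have G1: "madd (mone ?I) ?G p q \<in> dga \<Lambda> E" for p q
        unfolding madd_def by (intro R_add mone_in_R G)
      have expand: "mmul ?I X (madd (mone ?I) ?G) p q = X p q + mmul ?I X ?G p q"
        "mmul ?I (madd (mone ?I) ?G) X p q = X p q + mmul ?I ?G X p q" if "p \<in> ?I" "q \<in> ?I" for X p q
      proof -
        have "mmul ?I X (madd (mone ?I) ?G) p q = mmul ?I X (mone ?I) p q + mmul ?I X ?G p q"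
          using that by (simp add: mmul_def madd_def distrib_left sum.distrib)
        then show "mmul ?I X (madd (mone ?I) ?G) p q = X p q + mmul ?I X ?G p q"
          using that by (simp add: mmul_mone_right)
        have "mmul ?I (madd (mone ?I) ?G) X p q = mmul ?I (mone ?I) X p q + mmul ?I ?G X p q"
          using that by (simp add: mmul_def madd_def distrib_right sum.distrib)
        then show "mmul ?I (madd (mone ?I) ?G) X p q = X p q + mmul ?I ?G X p q"
          using that by (simp add: mmul_mone_left)
      qed
      have "strict_upper ?I (higher \<Lambda>) (\<lambda>p q. (bdry_A1 \<Lambda> E e 1 p q + mmul ?I (bdry_A1 \<Lambda> E e 1) ?G p q)
          + (bdry_A1 \<Lambda> E e 0 p q + mmul ?I ?G (bdry_A1 \<Lambda> E e 0) p q))"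
        by (intro strict_upper_add strict_upper_mmul A(1) G(1) t)
      then show ?thesis
        unfolding gen_boundary_def Let_def prod.case using 2 A(2) G1 t
        by (auto simp: strict_upper_def expand intro!: R_add mmul_in_R)
    next
      case 3
      have v: "v1 E e < nsides E e" "v0 E e < nsides E e"
        using cell_structure(3)[OF 3(1)] by auto
      note A = bdry_A2_upper[OF 3(1)] bdry_A2_dga[OF 3(1)]
      note P = path_product[OF 3(1) path_sides(1)[OF 3(1)]] path_product[OF 3(1) path_sides(2)[OF 3(1)]]
      let ?P = "path_product \<Lambda> E e (ccw_path E e)" and ?Q = "path_product \<Lambda> E e (cw_path E e)"
      have "strict_upper ?I (higher \<Lambda>) (\<lambda>p q. mmul ?I (bdry_A2 \<Lambda> E e (v1 E e)) ?G p q
          + mmul ?I ?G (bdry_A2 \<Lambda> E e (v0 E e)) p q + (?P p q - mone ?I p q) + (?Q p q - mone ?I p q))"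
        using P by (intro strict_upper_add strict_upper_mmul A(1) G(1) v) (auto simp: unipotent_def)
      \<comment> \<open>Here \<open>b\<close> is the entry of the identity that was subtracted from
        both path products; it occurs twice and so drops out.\<close>
      moreover have "X + (a - b) + (a' - b) = X + a + a'" for X a a' b :: "('m,'l) cell_alg"
      proof -
        have "X + (a - b) + (a' - b) = X + a + a' - (b + b)"
          by (simp add: algebra_simps)
        then show ?thesis
          by (simp add: cell_algebra_char_2)
      qed
      ultimately show ?thesis
        unfolding gen_boundary_def Let_def prod.case using 3 A(2) G P v
        by (auto intro!: R_add mmul_in_R)
    qed
  qed
  then show "strict_upper ?I (higher \<Lambda>) (\<lambda>p q. gen_boundary \<Lambda> E (e,p,q))"
    "gen_boundary \<Lambda> E (e,p,q) \<in> dga \<Lambda> E"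
    by blast+
qed

end

section \<open>Linear maps represented by matrices\<close>

text \<open>Column convention: \<open>M p q\<close> is the coefficient of \<open>p\<close> in the
  image of the basis vector of \<open>q\<close>, in accordance with \<open>strictly_upper\<close>.
  Truncation to \<open>I\<close> keeps the values in \<open>sheet_space\<close>.\<close>

definition mat_op :: "'i set \<Rightarrow> ('i, 'a::ring_1) sqmat \<Rightarrow> ('i \<Rightarrow> 'a) \<Rightarrow> 'i \<Rightarrow> 'a" where
  "mat_op I M v = (\<lambda>p. if p \<in> I then \<Sum>q\<in>I. M p q * v q else 0)"

lemma mat_op_mmul: "mat_op I (mmul I M N) v = mat_op I M (mat_op I N v)"
proof
  fix p
  have "(\<Sum>q\<in>I. (\<Sum>r\<in>I. M p r * N r q) * v q) = (\<Sum>r\<in>I. M p r * (\<Sum>q\<in>I. N r q * v q))"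
    unfolding sum_distrib_right sum_distrib_left mult.assoc by (rule sum.swap)
  then show "mat_op I (mmul I M N) v p = mat_op I M (mat_op I N v) p"
    by (auto simp: mat_op_def mmul_def cong: sum.cong)
qed

lemma mat_op_mone: "finite I \<Longrightarrow> (\<And>p. p \<notin> I \<Longrightarrow> v p = 0) \<Longrightarrow> mat_op I (mone I) v = v"
  by (auto simp: fun_eq_iff mat_op_def mone_def if_distrib[of "\<lambda>u. u * _"] cong: if_cong)

lemma mat_op_unit:
  "finite I \<Longrightarrow> q \<in> I \<Longrightarrow> mat_op I M (\<lambda>p. if p = q then 1 else 0) p = (if p \<in> I then M p q else 0)"
  by (simp add: mat_op_def if_distrib[of "\<lambda>u. _ * u"] cong: if_cong)

lemma mat_op_cong:
  "(\<And>p q. p \<in> I \<Longrightarrow> q \<in> I \<Longrightarrow> M p q = M' p q) \<Longrightarrow> mat_op I M v = mat_op I M' v"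
  by (auto simp: mat_op_def fun_eq_iff intro!: sum.cong)

lemma mat_op_madd: "mat_op I (madd M N) v = (\<lambda>p. mat_op I M v p + mat_op I N v p)"
  by (auto simp: mat_op_def madd_def fun_eq_iff distrib_right sum.distrib)

text \<open>Agreement is demanded on \<open>sheet_space\<close> only: composites, inverses by
  \<open>inv_into\<close> and the empty path \<open>id\<close> are not extensional, so equality of
  functions would be too strong.\<close>

definition represents ::
    "('m::topological_space, 'l::topological_space) legendrian \<Rightarrow> 'm set \<Rightarrow> ('l vec \<Rightarrow> 'l vec) \<Rightarrow> ('l set, bit) sqmat \<Rightarrow> bool" where
  "represents \<Lambda> e T M \<longleftrightarrow> (\<forall>v\<in>sheet_space \<Lambda> e. T v = mat_op (sheets \<Lambda> e) M v)"

lemma mat_op_sheet_space: "mat_op (sheets \<Lambda> e) M v \<in> sheet_space \<Lambda> e"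
  by (simp add: sheet_space_def mat_op_def)

lemma basis_vec_sheet_space: "q \<in> sheets \<Lambda> e \<Longrightarrow> basis_vec q \<in> sheet_space \<Lambda> e"
  by (auto simp: sheet_space_def basis_vec_def)

lemma represents_basis:
  assumes "finite (sheets \<Lambda> e)" "represents \<Lambda> e T M" "q \<in> sheets \<Lambda> e"
  shows "T (basis_vec q) p = (if p \<in> sheets \<Lambda> e then M p q else 0)"
  using assms(2) basis_vec_sheet_space[OF assms(3)] mat_op_unit[OF assms(1,3), where M=M and p=p]
  unfolding represents_def basis_vec_def by simp

lemma represents_cong:
  "represents \<Lambda> e T M \<Longrightarrow> (\<And>p q. p \<in> sheets \<Lambda> e \<Longrightarrow> q \<in> sheets \<Lambda> e \<Longrightarrow> M p q = M' p q) \<Longrightarrow> represents \<Lambda> e T M'"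
  unfolding represents_def using mat_op_cong[of "sheets \<Lambda> e" M M'] by metis

lemma represents_comp:
  "represents \<Lambda> e T M \<Longrightarrow> represents \<Lambda> e S N \<Longrightarrow> represents \<Lambda> e (T \<circ> S) (mmul (sheets \<Lambda> e) M N)"
  by (simp add: represents_def mat_op_mmul mat_op_sheet_space)

lemma represents_add:
  "represents \<Lambda> e T M \<Longrightarrow> represents \<Lambda> e S N \<Longrightarrow> represents \<Lambda> e (\<lambda>v p. T v p + S v p) (madd M N)"
  by (simp add: represents_def mat_op_madd)

lemma represents_id: "finite (sheets \<Lambda> e) \<Longrightarrow> represents \<Lambda> e id (mone (sheets \<Lambda> e))"
  by (simp add: represents_def mat_op_mone sheet_space_def)

text \<open>Basis vectors recover the entries of a matrix. This turns every identity in the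
  definition of a diagram into a system of entrywise equations.\<close>

lemma represents_eq_iff:
  assumes "finite (sheets \<Lambda> e)" "represents \<Lambda> e T M" "represents \<Lambda> e T' M'"
  shows "(\<forall>v\<in>sheet_space \<Lambda> e. T v = T' v) \<longleftrightarrow> (\<forall>p\<in>sheets \<Lambda> e. \<forall>q\<in>sheets \<Lambda> e. M p q = M' p q)"
proof
  assume *: "\<forall>v\<in>sheet_space \<Lambda> e. T v = T' v"
  show "\<forall>p\<in>sheets \<Lambda> e. \<forall>q\<in>sheets \<Lambda> e. M p q = M' p q"
  proof (intro ballI)
    fix p q assume p: "p \<in> sheets \<Lambda> e" and q: "q \<in> sheets \<Lambda> e"
    have "T (basis_vec q) p = T' (basis_vec q) p"
      using * basis_vec_sheet_space[OF q] by simp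
    then show "M p q = M' p q"
      using represents_basis[OF assms(1,2) q, of p] represents_basis[OF assms(1,3) q, of p] p by simp
  qed
next
  assume "\<forall>p\<in>sheets \<Lambda> e. \<forall>q\<in>sheets \<Lambda> e. M p q = M' p q"
  then show "\<forall>v\<in>sheet_space \<Lambda> e. T v = T' v"
    using assms(2,3) mat_op_cong[of "sheets \<Lambda> e" M M'] unfolding represents_def by metis
qed

lemma represents_zero: "represents \<Lambda> e (\<lambda>v p. 0) (\<lambda>p q. 0)"
  by (simp add: represents_def mat_op_def fun_eq_iff)

text \<open>A two-sided inverse matrix makes \<open>T\<close> injective on
  \<open>sheet_space\<close> and exhibits a preimage there, which pins down the choice made by
  \<open>inv_into\<close>.\<close>

lemma represents_inverse:
  assumes fin: "finite (sheets \<Lambda> e)" and T: "represents \<Lambda> e T M"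
    and inv: "mmul (sheets \<Lambda> e) M N = mone (sheets \<Lambda> e)" "mmul (sheets \<Lambda> e) N M = mone (sheets \<Lambda> e)"
  shows "represents \<Lambda> e (inv_into (sheet_space \<Lambda> e) T) N"
  unfolding represents_def
proof
  fix v assume v: "v \<in> sheet_space \<Lambda> e"
  let ?op = "mat_op (sheets \<Lambda> e)"
  have Tv: "T w = ?op M w" if "w \<in> sheet_space \<Lambda> e" for w
    using T that by (simp add: represents_def)
  have one: "?op (mone (sheets \<Lambda> e)) w = w" if "w \<in> sheet_space \<Lambda> e" for w
    using that by (intro mat_op_mone[OF fin]) (simp add: sheet_space_def)
  have "?op N (T w) = w" if "w \<in> sheet_space \<Lambda> e" for w
    using Tv[OF that] one[OF that] by (simp add: inv flip: mat_op_mmul)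
  then have "inj_on T (sheet_space \<Lambda> e)"
    by (rule inj_on_inverseI[where g="?op N"])
  moreover have "T (?op N v) = v"
    using Tv[OF mat_op_sheet_space] one[OF v] by (simp add: inv flip: mat_op_mmul)
  ultimately show "inv_into (sheet_space \<Lambda> e) T v = ?op N v"
    using mat_op_sheet_space by (intro inv_into_f_eq)
qed

text \<open>\<open>lin_ext\<close> does not cut off its values outside the sheets of
  \<open>e\<close>, whereas \<open>mat_op\<close> does; the hypothesis bridges this
  difference.\<close>

lemma represents_lin_ext:
  assumes "\<And>p q. q \<in> sheets \<Lambda> e \<Longrightarrow> p \<notin> sheets \<Lambda> e \<Longrightarrow> g q p = 0"
  shows "represents \<Lambda> e (lin_ext \<Lambda> e g) (\<lambda>p q. g q p)"
  unfolding represents_def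
proof (intro ballI ext)
  fix v p assume v: "v \<in> sheet_space \<Lambda> e"
  have "lin_ext \<Lambda> e g v p = (\<Sum>q\<in>sheets \<Lambda> e. g q p * v q)"
    unfolding lin_ext_def restrict_apply'[OF v] by (simp only: mult.commute)
  also have "\<dots> = mat_op (sheets \<Lambda> e) (\<lambda>p q. g q p) v p"
  proof (cases "p \<in> sheets \<Lambda> e")
    case True
    then show ?thesis
      by (simp only: mat_op_def if_True)
  next
    case False
    then have "(\<Sum>q\<in>sheets \<Lambda> e. g q p * v q) = 0"
      by (intro sum.neutral) (simp add: assms)
    then show ?thesis
      using False by (simp only: mat_op_def if_False)
  qed
  finally show "lin_ext \<Lambda> e g v p = mat_op (sheets \<Lambda> e) (\<lambda>p q. g q p) v p" .
qed

lemma form_basis: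
  assumes "finite (sheets \<Lambda> e)" "p \<in> sheets \<Lambda> e"
  shows "form \<Lambda> e w (basis_vec p) = w p"
proof -
  have "form \<Lambda> e w (basis_vec p) = (\<Sum>q\<in>sheets \<Lambda> e. if q = p then w q else 0)"
    unfolding form_def basis_vec_def by (rule sum.cong) auto
  then show ?thesis
    using assms by (simp only: sum.delta) simp
qed

lemma push_eq:
  assumes "finite I" "inj_on \<iota> I"
  shows "push \<iota> I w p = (if p \<in> \<iota> ` I then w (inv_into I \<iota> p) else 0)"
proof (cases "p \<in> \<iota> ` I")
  case True
  then obtain p0 where p0: "p0 \<in> I" "p = \<iota> p0" by blast
  have "push \<iota> I w p = (\<Sum>q\<in>I. if q = p0 then w q else 0)"
    unfolding push_def basis_vec_def using assms(2) p0 by (intro sum.cong) (auto simp: inj_on_def)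
  then show ?thesis
    using assms p0 by (simp only: sum.delta) simp
next
  case False
  then have "push \<iota> I w p = 0"
    unfolding push_def basis_vec_def by (intro sum.neutral) auto
  then show ?thesis
    using False by simp
qed

text \<open>The matrix is described column by column: columns in the image of \<open>\<iota>\<close>
  come from \<open>M\<close>, the others from \<open>g\<close>. Injectivity of
  \<open>\<iota>\<close> is what lets \<open>push\<close> be written as a placement.\<close>

lemma represents_dsum:
  assumes emb: "embeds \<Lambda> e' e \<iota>" and fin: "finite (sheets \<Lambda> e')" and T: "represents \<Lambda> e' T M"
    and g: "\<And>q p. q \<in> sheets \<Lambda> e \<Longrightarrow> q \<notin> \<iota> ` sheets \<Lambda> e' \<Longrightarrow> p \<notin> sheets \<Lambda> e \<Longrightarrow> g q p = 0"
  shows "represents \<Lambda> e (dsum \<Lambda> e \<iota> (sheets \<Lambda> e') T g)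
    (\<lambda>p q. if q \<in> \<iota> ` sheets \<Lambda> e' then place \<iota> (sheets \<Lambda> e') M p q else g q p)"
proof -
  let ?G = "\<lambda>p. if p \<in> \<iota> ` sheets \<Lambda> e' then push \<iota> (sheets \<Lambda> e') (T (basis_vec (inv_into (sheets \<Lambda> e') \<iota> p))) else g p"
  have inj: "inj_on \<iota> (sheets \<Lambda> e')" and sub: "\<iota> ` sheets \<Lambda> e' \<subseteq> sheets \<Lambda> e"
    using emb by (auto simp: embeds_def)
  have G: "?G q p = (if q \<in> \<iota> ` sheets \<Lambda> e' then place \<iota> (sheets \<Lambda> e') M p q else g q p)" for p q
  proof (cases "q \<in> \<iota> ` sheets \<Lambda> e'")
    case True
    then have q: "inv_into (sheets \<Lambda> e') \<iota> q \<in> sheets \<Lambda> e'"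
      by (rule inv_into_into)
    show ?thesis
      using True q inv_into_into[of p \<iota> "sheets \<Lambda> e'"]
      by (simp add: push_eq[OF fin inj] represents_basis[OF fin T q] place_def)
  qed simp
  have "represents \<Lambda> e (lin_ext \<Lambda> e ?G) (\<lambda>p q. ?G q p)"
  proof (rule represents_lin_ext)
    fix p q assume "q \<in> sheets \<Lambda> e" "p \<notin> sheets \<Lambda> e"
    then show "?G q p = 0"
      unfolding G using g sub by (auto simp: place_def)
  qed
  then show ?thesis
    unfolding G dsum_def .
qed

lemma represents_transport:
  assumes T: "represents \<Lambda> f T M" and fin: "finite (sheets \<Lambda> f)"
    and \<beta>: "\<And>p. p \<in> sheets \<Lambda> e \<Longrightarrow> \<beta> p \<in> sheets \<Lambda> f"
  shows "represents \<Lambda> e (transport \<Lambda> e \<beta> T) (\<lambda>p q. M (\<beta> p) (\<beta> q))"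
  unfolding transport_def
  by (rule represents_cong[OF represents_lin_ext]) (simp_all add: represents_basis[OF fin T] \<beta>)

section \<open>Evaluation of matrices over the cellular algebra\<close>

definition evm :: "('g \<Rightarrow> bit) \<Rightarrow> ('i, 'g free_alg) sqmat \<Rightarrow> ('i, bit) sqmat" where
  "evm x M = (\<lambda>p q. ev x (M p q))"

lemma evm_simps:
  "evm x (mmul I X Y) = mmul I (evm x X) (evm x Y)"
  "evm x (madd X Y) = madd (evm x X) (evm x Y)"
  "evm x (mone I) = mone I"
  "evm x (elem_mat i j) = elem_mat i j"
  "evm x (enlarge a b Z) = enlarge a b (evm x Z)"
  "evm x (place \<iota> I X) = place \<iota> I (evm x X)"
  by (simp_all only: evm_def fun_eq_iff ev_mmul)
    (auto simp: madd_def ev_add elem_mat_def enlarge_def place_def)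

lemma ev_elem_mat: "ev x (elem_mat i j p q) = elem_mat i j p q"
  by (simp add: elem_mat_def)

lemma evm_conj_elem: "evm x (conj_elem m a b X) = conj_elem m a b (evm x X)"
  unfolding conj_elem_def Let_def evm_simps ..

lemma evm_by_number: "evm x (by_number \<Lambda> e X) = by_number \<Lambda> e (evm x X)"
  by (simp add: evm_def by_number_def fun_eq_iff)

context legendrian_setting
begin

text \<open>The inner sum over sheets is reindexed by the bijection \<open>sheet_no\<close>.
  Products at swallowtails can thus be computed with numbers and read off in terms of
  sheets.\<close>

lemma by_number_mmul:
  assumes f: "uncrossed f" and m: "card (sheets \<Lambda> f) = m"
  shows "by_number \<Lambda> f (mmul {1..m} X Y) = mmul (sheets \<Lambda> f) (by_number \<Lambda> f X) (by_number \<Lambda> f Y)"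
proof (intro ext)
  fix p q
  show "by_number \<Lambda> f (mmul {1..m} X Y) p q = mmul (sheets \<Lambda> f) (by_number \<Lambda> f X) (by_number \<Lambda> f Y) p q"
  proof (cases "p \<in> sheets \<Lambda> f \<and> q \<in> sheets \<Lambda> f")
    case True
    then have r: "sheet_no \<Lambda> f p \<in> {1..m}" "sheet_no \<Lambda> f q \<in> {1..m}"
      using sheet_no_range[OF f] m by auto
    have "(\<Sum>r\<in>sheets \<Lambda> f. X (sheet_no \<Lambda> f p) (sheet_no \<Lambda> f r) * Y (sheet_no \<Lambda> f r) (sheet_no \<Lambda> f q))
        = (\<Sum>r\<in>{1..m}. X (sheet_no \<Lambda> f p) r * Y r (sheet_no \<Lambda> f q))"
      by (rule sum.reindex_bij_betw[OF sheet_no_bij[OF f, unfolded m]])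
    then show ?thesis
      using True r by (simp add: by_number_def mmul_def cong: sum.cong del: One_nat_def)
  next
    case False
    then show ?thesis
      by (auto simp: by_number_def mmul_def)
  qed
qed

lemma finite_uncrossed: "uncrossed f \<Longrightarrow> finite (sheets \<Lambda> f)"
  using finite_sheets by (simp add: uncrossed_def)

lemma represents_handle:
  assumes f: "uncrossed f" and m: "card (sheets \<Lambda> f) = m" and u: "u \<in> {1..m}" and l: "l \<in> {1..m}"
  shows "represents \<Lambda> f (handle \<Lambda> f u l) (by_number \<Lambda> f (madd (mone {1..m}) (elem_mat u l)))"
proof -
  have nth: "nth_sheet \<Lambda> f i \<in> sheets \<Lambda> f" "p = nth_sheet \<Lambda> f i \<longleftrightarrow> sheet_no \<Lambda> f p = i"
    if "i \<in> {1..m}" "p \<in> sheets \<Lambda> f" for p i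
    using nth_sheet[OF f, of i] nth_sheet_no[OF f that(2)] that m by auto
  show ?thesis
    unfolding handle_def
  proof (rule represents_cong[OF represents_lin_ext])
    fix p q assume q: "q \<in> sheets \<Lambda> f"
    show "p \<notin> sheets \<Lambda> f \<Longrightarrow> (if q = nth_sheet \<Lambda> f l
     then vadd (basis_vec q) (basis_vec (nth_sheet \<Lambda> f u)) else basis_vec q) p = 0"
      using q nth(1)[OF u q] by (auto simp: vadd_def basis_vec_def)
    assume p: "p \<in> sheets \<Lambda> f"
    show "(if q = nth_sheet \<Lambda> f l then vadd (basis_vec q) (basis_vec (nth_sheet \<Lambda> f u)) else basis_vec q) p
      = by_number \<Lambda> f (madd (mone {1..m}) (elem_mat u l)) p q"
      using p q sheet_no_range[OF f p] sheet_no_inj[OF f p q]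
      unfolding by_number_def madd_def vadd_def basis_vec_def mone_def elem_mat_def
      by (simp add: nth(2)[OF u p] nth(2)[OF l q] m)
  qed
qed

end

section \<open>Matrices of the exceptional boundary differentials and handleslides at a
  swallowtail\<close>

context swallowtail_vertex
begin

text \<open>Numbers other than \<open>a\<close> and \<open>b\<close> correspond through
  \<open>unskip\<close> to the numbers of the sheets above the vertex, where the entries are those
  of \<open>d0\<close>. Column \<open>b\<close> has its single 1 in row \<open>a\<close>, and column
  \<open>a\<close> is zero.\<close>

lemma represents_enlarge:
  assumes d0: "represents \<Lambda> v d0 (evm x (gen_mat \<Lambda> v))"
    and f: "uncrossed f" "card (sheets \<Lambda> f) = n" and ab: "1 \<le> a" "a < b" "b \<le> n"
  shows "represents \<Lambda> f (st_enlarge \<Lambda> v f a b d0) (by_number \<Lambda> f (enlarge a b (evm x (st_gen_mat \<Lambda> v))))"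
  unfolding st_enlarge_def
proof (rule represents_cong[OF represents_lin_ext])
  let ?g = "\<lambda>q. if sheet_no \<Lambda> f q = b then basis_vec (nth_sheet \<Lambda> f a)
     else if sheet_no \<Lambda> f q = a then (\<lambda>p. 0)
     else (\<lambda>p. if p \<notin> sheets \<Lambda> f \<or> sheet_no \<Lambda> f p \<in> {a,b} then 0
       else form \<Lambda> v (d0 (basis_vec (nth_sheet \<Lambda> v (unskip a b (sheet_no \<Lambda> f q)))))
                     (basis_vec (nth_sheet \<Lambda> v (unskip a b (sheet_no \<Lambda> f p)))))"
  note uv = uncrossed_swallowtail[OF st]
  note nth = nth_sheet[OF f(1), unfolded f(2)]
  have a: "nth_sheet \<Lambda> f a \<in> sheets \<Lambda> f" "sheet_no \<Lambda> f (nth_sheet \<Lambda> f a) = a"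
    using nth[of a] ab by auto
  fix p q assume q: "q \<in> sheets \<Lambda> f"
  show "p \<notin> sheets \<Lambda> f \<Longrightarrow> ?g q p = 0"
    using a(1) by (auto simp: basis_vec_def)
  assume p: "p \<in> sheets \<Lambda> f"
  let ?i = "sheet_no \<Lambda> f p" and ?j = "sheet_no \<Lambda> f q"
  have ij: "1 \<le> ?i" "?i \<le> n" "1 \<le> ?j" "?j \<le> n"
    using sheet_no_range[OF f(1) p] sheet_no_range[OF f(1) q] f(2) by simp_all
  have un: "1 \<le> unskip a b i \<and> unskip a b i \<le> card (sheets \<Lambda> v)" if "1 \<le> i" "i \<le> n" "i \<noteq> a" "i \<noteq> b" for i
    using that ab by (auto simp: unskip_def)
  have pa: "p = nth_sheet \<Lambda> f a \<longleftrightarrow> ?i = a"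
    using a nth_sheet_no[OF f(1) p] by auto
  show "?g q p = by_number \<Lambda> f (enlarge a b (evm x (st_gen_mat \<Lambda> v))) p q"
  proof (cases "?i \<in> {a,b} \<or> ?j \<in> {a,b}")
    case True
    then show ?thesis
      using p q ab(2) pa by (auto simp: by_number_def enlarge_def basis_vec_def)
  next
    case False
    then have ui: "1 \<le> unskip a b ?i" "unskip a b ?i \<le> card (sheets \<Lambda> v)"
      and uj: "1 \<le> unskip a b ?j" "unskip a b ?j \<le> card (sheets \<Lambda> v)"
      using un[of ?i] un[of ?j] ij by auto
    note P = nth_sheet(1)[OF uv ui] and Q = nth_sheet(1)[OF uv uj]
    have "?g q p = d0 (basis_vec (nth_sheet \<Lambda> v (unskip a b ?j))) (nth_sheet \<Lambda> v (unskip a b ?i))"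
      using False p form_basis[OF finite_uncrossed[OF uv] P] by simp
    also have "\<dots> = evm x (gen_mat \<Lambda> v) (nth_sheet \<Lambda> v (unskip a b ?i)) (nth_sheet \<Lambda> v (unskip a b ?j))"
      using represents_basis[OF finite_uncrossed[OF uv] d0 Q] P by simp
    also have "\<dots> = by_number \<Lambda> f (enlarge a b (evm x (st_gen_mat \<Lambda> v))) p q"
      using False p q ui uj by (simp add: by_number_def enlarge_def evm_def st_gen_mat_def)
    finally show ?thesis .
  qed
qed

text \<open>The handleslide on either side of the enlarged differential is the same map and has the
  matrix \<open>I + E\<close>, so the composite has exactly the form of \<open>conj_elem\<close>.
  One computation with free indices serves both directions of the swallowtail.\<close>

lemma represents_hat_d_T:
  assumes d0: "represents \<Lambda> v d0 (evm x (gen_mat \<Lambda> v))"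
  shows "represents \<Lambda> fT (hat_d_T \<Lambda> E v d0) (evm x (by_number \<Lambda> fT (A_T \<Lambda> E v)))"
proof -
  have *: "represents \<Lambda> fT (handle \<Lambda> fT u l \<circ> st_enlarge \<Lambda> v fT a b d0 \<circ> handle \<Lambda> fT u l)
     (evm x (by_number \<Lambda> fT (conj_elem n u l (enlarge a b (st_gen_mat \<Lambda> v)))))"
    if "u \<in> {1..n}" "l \<in> {1..n}" "1 \<le> a" "a < b" "b \<le> n" for a b u l
    unfolding evm_by_number evm_conj_elem evm_simps unfolding conj_elem_def Let_def
      by_number_mmul[OF uncrossed_T cornerT(2)]
    by (intro represents_comp represents_handle represents_enlarge d0 uncrossed_T cornerT(2) that)
  show ?thesis
    using *[of "k+1" "k+2" k "k+1"] *[of k "k+1" "k+1" "k+2"] k_range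
    unfolding hat_d_T_def A_T_def Let_def by simp
qed

text \<open>The last two conditions make all mixed products of elementary matrices vanish.\<close>

lemma represents_handles:
  assumes f: "uncrossed f" "card (sheets \<Lambda> f) = m" and T: "represents \<Lambda> f T (by_number \<Lambda> f X)"
    and ab: "\<And>a b. (a,b) \<in> set ps \<Longrightarrow> a \<in> {1..m} \<and> b \<in> {1..m} \<and> (\<forall>j\<in>{1..m}. X b j = mone {1..m} b j)"
    and ne: "\<And>a b a' b'. (a,b) \<in> set ps \<Longrightarrow> (a',b') \<in> set ps \<Longrightarrow> a' \<noteq> b"
  shows "represents \<Lambda> f (foldr (\<circ>) (map (\<lambda>(a,b). handle \<Lambda> f a b) ps) T)
     (by_number \<Lambda> f (\<lambda>i j. X i j + (\<Sum>(a,b)\<leftarrow>ps. elem_mat a b i j)))"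
  using ab ne
proof (induction ps)
  case Nil
  then show ?case
    using T by (simp only: list.map foldr_Nil id_apply sum_list.Nil add_0_right)
next
  case (Cons x ps)
  obtain a b where x: "x = (a,b)" by (cases x)
  define Y where "Y = (\<lambda>i j. X i j + (\<Sum>(a,b)\<leftarrow>ps. elem_mat a b i j))"
  have IH: "represents \<Lambda> f (foldr (\<circ>) (map (\<lambda>(a,b). handle \<Lambda> f a b) ps) T) (by_number \<Lambda> f Y)"
    unfolding Y_def
  proof (rule Cons.IH)
    show "a \<in> {1..m} \<and> b \<in> {1..m} \<and> (\<forall>j\<in>{1..m}. X b j = mone {1..m} b j)" if "(a,b) \<in> set ps" for a b
      using Cons.prems(1)[of a b] that by simp
    show "a' \<noteq> b" if "(a,b) \<in> set ps" "(a',b') \<in> set ps" for a b a' b'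
      using Cons.prems(2)[of a b a' b'] that by simp
  qed
  have a: "a \<in> {1..m}" and b: "b \<in> {1..m}" "\<And>j. j \<in> {1..m} \<Longrightarrow> X b j = mone {1..m} b j"
    using Cons.prems(1)[of a b] unfolding x by auto
  have "represents \<Lambda> f (handle \<Lambda> f a b \<circ> foldr (\<circ>) (map (\<lambda>(a,b). handle \<Lambda> f a b) ps) T)
      (by_number \<Lambda> f (mmul {1..m} (madd (mone {1..m}) (elem_mat a b)) Y))"
    unfolding by_number_mmul[OF f] by (intro represents_comp represents_handle IH f a b(1))
  then show ?case
    unfolding x list.map prod.case foldr_Cons o_apply
  proof (rule represents_cong)
    fix p q assume p: "p \<in> sheets \<Lambda> f" and q: "q \<in> sheets \<Lambda> f"
    let ?i = "sheet_no \<Lambda> f p" and ?j = "sheet_no \<Lambda> f q"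
    have i: "?i \<in> {1..m}" and j: "?j \<in> {1..m}"
      using sheet_no_range[OF f(1) p] sheet_no_range[OF f(1) q] f(2) by auto
    \<comment> \<open>No handleslide already applied alters row \<open>b\<close>, so row
      \<open>b\<close> of \<open>Y\<close> is still that of the identity, and multiplying by the
      next factor on the left adds just the elementary matrix at \<open>(a,b)\<close>.\<close>
    have "elem_mat a' b' b ?j = (0::bit)" if "(a',b') \<in> set ps" for a' b'
      using Cons.prems(2)[of a b a' b'] that unfolding x by (auto simp: elem_mat_def)
    then have "(\<Sum>(a',b')\<leftarrow>ps. elem_mat a' b' b ?j) = (0::bit)"
      by (induction ps) auto
    then have "Y b ?j = mone {1..m} b ?j"
      using b(2)[OF j] by (simp add: Y_def del: One_nat_def)
    then have "elem_mat a b ?i ?j = (if ?i = a then Y b ?j else 0)"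
      using b(1) by (auto simp: mone_def elem_mat_def)
    then have mm: "mmul {1..m} (madd (mone {1..m}) (elem_mat a b)) Y ?i ?j = Y ?i ?j + elem_mat a b ?i ?j"
      using mmul_elem_left[OF finite_atLeastAtMost i j b(1), where X=Y and a=a] by (simp only:)
    have bn: "by_number \<Lambda> f Z p q = Z ?i ?j" for Z :: "(nat, bit) sqmat"
      using p q by (simp only: by_number_def simp_thms if_True)
    show "by_number \<Lambda> f (mmul {1..m} (madd (mone {1..m}) (elem_mat a b)) Y) p q
       = by_number \<Lambda> f (\<lambda>i j. X i j + sum_list (elem_mat a b i j # map (\<lambda>(a,b). elem_mat a b i j) ps)) p q"
      unfolding bn mm unfolding Y_def by (simp only: sum_list.Cons add_ac)
  qed
qed

end

text \<open>\<open>H_S\<close> selects its handleslides by nonvanishing of an entry of the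
  differential, while \<open>mat_S\<close> uses this entry as a coefficient. Over \<open>bit\<close>
  the two agree.\<close>

lemma bit_sum_filter:
  fixes g :: "'a \<Rightarrow> bit"
  assumes "distinct xs"
  shows "(\<Sum>m\<leftarrow>filter (\<lambda>m. h m \<noteq> (0::bit)) xs. g m) = (\<Sum>m\<in>set xs. h m * g m)"
  using assms
proof (induction xs)
  case (Cons x xs)
  have x: "x \<notin> set xs"
    using Cons.prems by simp
  have *: "(\<Sum>m\<in>set (x # xs). h m * g m) = h x * g x + (\<Sum>m\<in>set xs. h m * g m)"
    by (simp only: list.set sum.insert[OF finite_set x])
  have IH: "(\<Sum>m\<leftarrow>filter (\<lambda>m. h m \<noteq> 0) xs. g m) = (\<Sum>m\<in>set xs. h m * g m)"
    using Cons by (simp only: distinct.simps)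
  show ?case
  proof (cases "h x = 0")
    case True
    then show ?thesis
      unfolding * IH[symmetric] by (simp only: filter.simps simp_thms if_False mult_zero_left add_0_left)
  next
    case False
    then have "h x = 1" by simp
    with False show ?thesis
      unfolding * IH[symmetric]
      by (simp only: filter.simps simp_thms if_True mult_1_left list.map sum_list.Cons)
  qed
qed simp

context swallowtail_vertex
begin

lemma evm_st_gen_mat_upper: "evm x (st_gen_mat \<Lambda> v) i j \<noteq> 0 \<Longrightarrow> i < j"
proof -
  assume "evm x (st_gen_mat \<Lambda> v) i j \<noteq> 0"
  then have "st_gen_mat \<Lambda> v i j \<noteq> 0"
    unfolding evm_def using ev_0 by metis
  then show "i < j"
    by (rule st_gen_mat_upper)
qed

lemma differential_entry:
  assumes d0: "represents \<Lambda> v d0 (evm x (gen_mat \<Lambda> v))"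
    and i: "i \<in> {1..card (sheets \<Lambda> v)}" and j: "j \<in> {1..card (sheets \<Lambda> v)}"
  shows "form \<Lambda> v (d0 (basis_vec (nth_sheet \<Lambda> v j))) (basis_vec (nth_sheet \<Lambda> v i)) = evm x (st_gen_mat \<Lambda> v) i j"
proof -
  note uv = uncrossed_swallowtail[OF st]
  have P: "nth_sheet \<Lambda> v i \<in> sheets \<Lambda> v" and Q: "nth_sheet \<Lambda> v j \<in> sheets \<Lambda> v"
    using nth_sheet(1)[OF uv] i j by auto
  show ?thesis
    using i j P unfolding form_basis[OF finite_uncrossed[OF uv] P] represents_basis[OF finite_uncrossed[OF uv] d0 Q]
    by (simp add: evm_def st_gen_mat_def)
qed

lemma represents_H_T: "represents \<Lambda> fT (H_T \<Lambda> E v) (evm x (by_number \<Lambda> fT (mat_T \<Lambda> E v)))"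
proof -
  have *: "represents \<Lambda> fT (handle \<Lambda> fT u l) (by_number \<Lambda> fT (madd (mone {1..n}) (elem_mat u l)))"
    if "u \<in> {1..n}" "l \<in> {1..n}" for u l
    by (rule represents_handle[OF uncrossed_T cornerT(2) that])
  have "evm x (mat_T \<Lambda> E v) = (if upward \<Lambda> E v then madd (mone {1..n}) (elem_mat (k+1) (k+2))
      else madd (mone {1..n}) (elem_mat k (k+1)))"
    unfolding evm_def mat_T_def Let_def madd_def fun_eq_iff
    by (cases "upward \<Lambda> E v") (simp_all only: if_True if_False ev_add ev_mone ev_elem_mat simp_thms)
  then show ?thesis
    using *[of "k+1" "k+2"] *[of k "k+1"] k_range
    unfolding H_T_def Let_def evm_by_number by simp
qed

text \<open>The handleslides do not interact. Upward, they act from row \<open>k\<close> to rows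
  \<open>i < k\<close>, and the initial factor changes only row \<open>k + 1\<close>. Downward, they
  act from rows \<open>j + 2 > k + 2\<close> to row \<open>k + 2\<close>, and the initial factor
  changes only row \<open>k\<close>. In both cases triangularity of the differential restricts the
  sum over all sheets to the range used in \<open>mat_S\<close>.\<close>

lemma represents_H_S:
  assumes d0: "represents \<Lambda> v d0 (evm x (gen_mat \<Lambda> v))"
  shows "represents \<Lambda> fS (H_S \<Lambda> E v d0) (evm x (by_number \<Lambda> fS (mat_S \<Lambda> E v)))"
proof -
  define N where "N = card (sheets \<Lambda> v)"
  define l m where "l = k + 1" and "m = k + 2"
  define a where "a = evm x (st_gen_mat \<Lambda> v)"
  have lm: "k < l" "l < m" "k \<in> {1..n}" "l \<in> {1..n}" "m \<in> {1..n}"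
    using k_range by (auto simp: l_def m_def)
  have kN: "k \<in> {1..N}" "n = N + 2"
    using k_range by (auto simp: N_def)
  have set_js: "set [1..<N+1] = {1..N}"
    by auto
  note form = differential_entry[OF d0, folded N_def a_def]
  have a_upper: "a i j \<noteq> 0 \<Longrightarrow> i < j" for i j
    unfolding a_def by (rule evm_st_gen_mat_upper)
  have a0: "\<not> i < j \<Longrightarrow> a i j = 0" for i j
    using a_upper by blast
  show ?thesis
  proof (cases "upward \<Lambda> E v")
    case True
    define js where "js = filter (\<lambda>i. a i k \<noteq> 0) [1..<N+1]"
    define X :: "(nat, bit) sqmat" where "X = madd (mone {1..n}) (elem_mat l m)"
    have js: "i \<in> {1..N} \<and> i < k" if "i \<in> set js" for i
      using that a_upper[of i k] by (auto simp: js_def)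
    have rep: "represents \<Lambda> fS (foldr (\<circ>) (map (\<lambda>(a,b). handle \<Lambda> fS a b) (map (\<lambda>i. (i,k)) js)) (handle \<Lambda> fS l m))
        (by_number \<Lambda> fS (\<lambda>i j. X i j + (\<Sum>(a,b)\<leftarrow>map (\<lambda>i. (i,k)) js. elem_mat a b i j)))"
    proof (rule represents_handles[OF uncrossed_S cornerS(2)])
      show "represents \<Lambda> fS (handle \<Lambda> fS l m) (by_number \<Lambda> fS X)"
        unfolding X_def by (rule represents_handle[OF uncrossed_S cornerS(2) lm(4,5)])
      fix a' b' assume "(a',b') \<in> set (map (\<lambda>i. (i,k)) js)"
      then have *: "a' \<in> set js" "b' = k" by auto
      show "a' \<in> {1..n} \<and> b' \<in> {1..n} \<and> (\<forall>j\<in>{1..n}. X b' j = mone {1..n} b' j)"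
        using js[OF *(1)] lm *(2) kN(2) by (auto simp: X_def madd_def elem_mat_def)
      fix a'' b'' assume "(a'',b'') \<in> set (map (\<lambda>i. (i,k)) js)"
      then show "a'' \<noteq> b'"
        using js *(2) by auto
    qed
    have mp: "map (\<lambda>(a,b). handle \<Lambda> fS a b) (map (\<lambda>i. (i,k)) js) = map (\<lambda>i. handle \<Lambda> fS i k) js"
      by simp
    have HS: "H_S \<Lambda> E v d0 = foldr (\<circ>) (map (\<lambda>i. handle \<Lambda> fS i k) js) (handle \<Lambda> fS l m)"
    proof -
      have "filter (\<lambda>i. form \<Lambda> v (d0 (basis_vec (nth_sheet \<Lambda> v k))) (basis_vec (nth_sheet \<Lambda> v i)) \<noteq> 0) [1..<N+1] = js"
        unfolding js_def using set_js form[OF _ kN(1)] by (intro filter_cong) auto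
      then show ?thesis
        unfolding H_S_def Let_def N_def[symmetric] l_def[symmetric] m_def[symmetric] using True by simp
    qed
    have MS: "(\<lambda>i j. X i j + (\<Sum>(a,b)\<leftarrow>map (\<lambda>i. (i,k)) js. elem_mat a b i j)) = evm x (mat_S \<Lambda> E v)"
    proof (intro ext)
      fix i j
      have "(\<Sum>(a,b)\<leftarrow>map (\<lambda>i. (i,k)) js. elem_mat a b i j) = (\<Sum>q\<leftarrow>js. elem_mat q k i j :: bit)"
        by (simp only: map_map o_def prod.case)
      also have "\<dots> = (\<Sum>q\<in>{1..N}. a q k * elem_mat q k i j)"
        unfolding js_def bit_sum_filter[OF distinct_upt] set_js ..
      also have "\<dots> = (\<Sum>q\<in>{1..<k}. a q k * elem_mat q k i j)"
        using kN(1) by (intro sum.mono_neutral_right) (auto simp: a0)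
      also have "\<dots> = ev x (\<Sum>q\<in>{1..<k}. st_gen_mat \<Lambda> v q k * elem_mat q k i j)"
        unfolding ev_sum ev_mult ev_elem_mat a_def evm_def ..
      finally show "X i j + (\<Sum>(a,b)\<leftarrow>map (\<lambda>i. (i,k)) js. elem_mat a b i j) = evm x (mat_S \<Lambda> E v) i j"
        using True unfolding evm_def mat_S_def Let_def l_def[symmetric] m_def[symmetric] N_def
        by (simp only: if_True ev_add ev_mone ev_elem_mat X_def madd_def add_ac)
    qed
    show ?thesis
      using rep unfolding mp MS HS evm_by_number .
  next
    case False
    define js where "js = filter (\<lambda>j. a k j \<noteq> 0) [1..<N+1]"
    define X :: "(nat, bit) sqmat" where "X = madd (mone {1..n}) (elem_mat k l)"
    have js: "j \<in> {1..N} \<and> k < j" if "j \<in> set js" for j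
      using that a_upper[of k j] by (auto simp: js_def)
    have rep: "represents \<Lambda> fS (foldr (\<circ>) (map (\<lambda>(a,b). handle \<Lambda> fS a b) (map (\<lambda>j. (m,j+2)) js)) (handle \<Lambda> fS k l))
        (by_number \<Lambda> fS (\<lambda>i j. X i j + (\<Sum>(a,b)\<leftarrow>map (\<lambda>j. (m,j+2)) js. elem_mat a b i j)))"
    proof (rule represents_handles[OF uncrossed_S cornerS(2)])
      show "represents \<Lambda> fS (handle \<Lambda> fS k l) (by_number \<Lambda> fS X)"
        unfolding X_def by (rule represents_handle[OF uncrossed_S cornerS(2) lm(3,4)])
      fix a' b' assume "(a',b') \<in> set (map (\<lambda>j. (m,j+2)) js)"
      then obtain j where *: "j \<in> set js" "a' = m" "b' = j + 2" by auto
      show "a' \<in> {1..n} \<and> b' \<in> {1..n} \<and> (\<forall>j\<in>{1..n}. X b' j = mone {1..n} b' j)"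
        using js[OF *(1)] lm *(2,3) kN(2) by (auto simp: X_def madd_def elem_mat_def)
      fix a'' b'' assume "(a'',b'') \<in> set (map (\<lambda>j. (m,j+2)) js)"
      then show "a'' \<noteq> b'"
        using js[OF *(1)] *(3) by (auto simp: m_def)
    qed
    have mp: "map (\<lambda>(a,b). handle \<Lambda> fS a b) (map (\<lambda>j. (m,j+2)) js) = map (\<lambda>j. handle \<Lambda> fS m (j+2)) js"
      by simp
    have HS: "H_S \<Lambda> E v d0 = foldr (\<circ>) (map (\<lambda>j. handle \<Lambda> fS m (j+2)) js) (handle \<Lambda> fS k l)"
    proof -
      have "filter (\<lambda>j. form \<Lambda> v (d0 (basis_vec (nth_sheet \<Lambda> v j))) (basis_vec (nth_sheet \<Lambda> v k)) \<noteq> 0) [1..<N+1] = js"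
        unfolding js_def using set_js form[OF kN(1)] by (intro filter_cong) auto
      then show ?thesis
        unfolding H_S_def Let_def N_def[symmetric] l_def[symmetric] m_def[symmetric] using False by simp
    qed
    have MS: "(\<lambda>i j. X i j + (\<Sum>(a,b)\<leftarrow>map (\<lambda>j. (m,j+2)) js. elem_mat a b i j)) = evm x (mat_S \<Lambda> E v)"
    proof (intro ext)
      fix i j
      have "(\<Sum>(a,b)\<leftarrow>map (\<lambda>j. (m,j+2)) js. elem_mat a b i j) = (\<Sum>q\<leftarrow>js. elem_mat m (q+2) i j :: bit)"
        by (simp only: map_map o_def prod.case)
      also have "\<dots> = (\<Sum>q\<in>{1..N}. a k q * elem_mat m (q+2) i j)"
        unfolding js_def bit_sum_filter[OF distinct_upt] set_js ..
      also have "\<dots> = (\<Sum>q\<in>{k<..N}. a k q * elem_mat m (q+2) i j)"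
        using kN(1) by (intro sum.mono_neutral_right) (auto simp: a0)
      also have "\<dots> = ev x (\<Sum>q\<in>{k<..N}. st_gen_mat \<Lambda> v k q * elem_mat m (q+2) i j)"
        unfolding ev_sum ev_mult ev_elem_mat a_def evm_def ..
      finally show "X i j + (\<Sum>(a,b)\<leftarrow>map (\<lambda>j. (m,j+2)) js. elem_mat a b i j) = evm x (mat_S \<Lambda> E v) i j"
        using False unfolding evm_def mat_S_def Let_def l_def[symmetric] m_def[symmetric] N_def
        by (simp only: if_False ev_add ev_mone ev_elem_mat X_def madd_def add_ac)
    qed
    show ?thesis
      using rep unfolding mp MS HS evm_by_number .
  qed
qed

end

text \<open>Only the matrices of the three families are prescribed by \<open>x\<close>; none of the
  equations of a diagram is assumed. The results can therefore be used in both directions of the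
  equivalence.\<close>

locale evaluation = legendrian_setting \<Lambda> E
  for \<Lambda> :: "('m::{t2_space,second_countable_topology}, 'l::{t2_space,second_countable_topology}) legendrian"
    and E :: "('m, 'l) decomposition" +
  fixes x :: "('m, 'l) generator \<Rightarrow> bit" and d F K :: "'m set \<Rightarrow> 'l vec \<Rightarrow> 'l vec"
  assumes d: "v \<in> cells0 E \<Longrightarrow> represents \<Lambda> v (d v) (evm x (gen_mat \<Lambda> v))"
    and F: "e \<in> cells1 E \<Longrightarrow> represents \<Lambda> e (F e) (madd (mone (sheets \<Lambda> e)) (evm x (gen_mat \<Lambda> e)))"
    and K: "f \<in> cells2 E \<Longrightarrow> represents \<Lambda> f (K f) (evm x (gen_mat \<Lambda> f))"
begin

text \<open>Each column of the boundary matrix is of one kind: either its sheet continues a sheet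
  above the vertex, or it can only carry a cusp entry. Hence the sum in \<open>bdry_A1\<close>
  agrees with the case distinction in \<open>dsum\<close>.\<close>

lemma represents_hat_d1:
  assumes e: "e \<in> cells1 E" and t: "t \<in> {0,1}"
  shows "represents \<Lambda> e (hat_d1 \<Lambda> E d e t) (evm x (bdry_A1 \<Lambda> E e t))"
proof -
  define v where "v = end1 E e t"
  have v: "v \<in> cells0 E"
    using end1_cell[OF e t] by (simp add: v_def)
  show ?thesis
  proof (cases "st_vertex \<Lambda> E v \<and> e = edge_cr E v")
    case True
    interpret swallowtail_vertex \<Lambda> E v
      by unfold_locales (use True in blast)
    have rep: "represents \<Lambda> e (transport \<Lambda> e (cr_to_T \<Lambda> E v) (hat_d_T \<Lambda> E v (d v)))
       (\<lambda>p q. evm x (by_number \<Lambda> fT (A_T \<Lambda> E v)) (cr_to_T \<Lambda> E v p) (cr_to_T \<Lambda> E v q))"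
      using cornerT(3) True
      by (intro represents_transport[OF represents_hat_d_T[OF d[OF v]] finite_uncrossed[OF uncrossed_T]])
        (auto simp: bij_betw_def)
    have hat: "hat_d1 \<Lambda> E d e t = transport \<Lambda> e (cr_to_T \<Lambda> E v) (hat_d_T \<Lambda> E v (d v))"
      using True unfolding hat_d1_def Let_def v_def[symmetric] by simp
    have "bdry_A1 \<Lambda> E e t p q = by_number \<Lambda> fT (A_T \<Lambda> E v) (cr_to_T \<Lambda> E v p) (cr_to_T \<Lambda> E v q)"
      if "p \<in> sheets \<Lambda> e" "q \<in> sheets \<Lambda> e" for p q
      using bdry_A1_swallowtail[of e t, folded v_def] True that by blast
    then show ?thesis
      unfolding hat by (intro represents_cong[OF rep]) (simp add: evm_def)
  next
    case False
    note inc = inc1_embeds[OF e t v_def False]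
    have "represents \<Lambda> e (dsum \<Lambda> e (inc1 \<Lambda> E e t) (sheets \<Lambda> v) (d v) (\<lambda>q p. if cusp_pair1 \<Lambda> E e t p q then 1 else 0))
      (\<lambda>p q. if q \<in> inc1 \<Lambda> E e t ` sheets \<Lambda> v
        then place (inc1 \<Lambda> E e t) (sheets \<Lambda> v) (evm x (gen_mat \<Lambda> v)) p q
        else if cusp_pair1 \<Lambda> E e t p q then 1 else 0)"
      by (rule represents_dsum[OF inc(1) finite_sheets[OF cells_simps(1)[OF v]] d[OF v]])
        (simp add: cusp_pair1_def)
    moreover have "bdry_A1 \<Lambda> E e t = madd (place (inc1 \<Lambda> E e t) (sheets \<Lambda> v) (gen_mat \<Lambda> v))
               (\<lambda>p q. if cusp_pair1 \<Lambda> E e t p q then 1 else 0)"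
      using False unfolding bdry_A1_def Let_def v_def[symmetric] by (simp only: if_False)
    ultimately show ?thesis
      using False inc(2) unfolding hat_d1_def Let_def v_def[symmetric] evm_simps
      by (auto elim!: represents_cong simp: madd_def evm_def place_def)
  qed
qed

lemma represents_hat_d2:
  assumes f: "f \<in> cells2 E" and j: "j < nsides E f"
  shows "represents \<Lambda> f (hat_d2 \<Lambda> E d f j) (evm x (bdry_A2 \<Lambda> E f j))"
proof -
  define v where "v = vertex2 E f j"
  have v: "v \<in> cells0 E"
    using vertex2_cell[OF f j] by (simp add: v_def)
  show ?thesis
  proof (cases "st_vertex \<Lambda> E v \<and> ((f,j) = cornerS E v \<or> (f,j) = cornerT E v)")
    case True
    interpret swallowtail_vertex \<Lambda> E v
      by unfold_locales (use True in blast)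
    note T = represents_hat_d_T[OF d[OF v]]
    show ?thesis
    proof (cases "(f,j) = cornerS E v")
      case S: True
      have f_eq: "fS = f"
        using S by (metis fst_conv)
      have "represents \<Lambda> f (transport \<Lambda> f (S_to_T \<Lambda> E v) (hat_d_T \<Lambda> E v (d v)))
         (\<lambda>p q. evm x (by_number \<Lambda> fT (A_T \<Lambda> E v)) (S_to_T \<Lambda> E v p) (S_to_T \<Lambda> E v q))"
        using S_to_T_sheet by (intro represents_transport[OF T finite_uncrossed[OF uncrossed_T]]) (simp add: f_eq)
      moreover have "bdry_A2 \<Lambda> E f j = by_number \<Lambda> f (A_S \<Lambda> E v)"
        using True S unfolding bdry_A2_def Let_def v_def[symmetric] by simp
      moreover have "hat_d2 \<Lambda> E d f j = transport \<Lambda> f (S_to_T \<Lambda> E v) (hat_d_T \<Lambda> E v (d v))"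
        using True S unfolding hat_d2_def Let_def v_def[symmetric] by simp
      ultimately show ?thesis
        using transport_S unfolding f_eq by (auto elim!: represents_cong simp: evm_def)
    next
      case S: False
      then have fT: "fT = f"
        using True by (metis fst_conv)
      have "bdry_A2 \<Lambda> E f j = by_number \<Lambda> f (A_T \<Lambda> E v)"
        using True S unfolding bdry_A2_def Let_def v_def[symmetric] by simp
      moreover have "hat_d2 \<Lambda> E d f j = hat_d_T \<Lambda> E v (d v)"
        using True S unfolding hat_d2_def Let_def v_def[symmetric] by simp
      ultimately show ?thesis
        using T unfolding fT by simp
    qed
  next
    case False
    note inc = inc2_embeds[OF f j v_def False]
    have "represents \<Lambda> f (dsum \<Lambda> f (inc2 \<Lambda> E f j) (sheets \<Lambda> v) (d v) (\<lambda>q p. if cusp_pair2 \<Lambda> E f j p q then 1 else 0))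
      (\<lambda>p q. if q \<in> inc2 \<Lambda> E f j ` sheets \<Lambda> v
        then place (inc2 \<Lambda> E f j) (sheets \<Lambda> v) (evm x (gen_mat \<Lambda> v)) p q
        else if cusp_pair2 \<Lambda> E f j p q then 1 else 0)"
      by (rule represents_dsum[OF inc(1) finite_sheets[OF cells_simps(1)[OF v]] d[OF v]])
        (simp add: cusp_pair2_def)
    moreover have "bdry_A2 \<Lambda> E f j = madd (place (inc2 \<Lambda> E f j) (sheets \<Lambda> v) (gen_mat \<Lambda> v))
               (\<lambda>p q. if cusp_pair2 \<Lambda> E f j p q then 1 else 0)"
      using False unfolding bdry_A2_def Let_def v_def[symmetric] by auto
    moreover have "hat_d2 \<Lambda> E d f j = dsum \<Lambda> f (inc2 \<Lambda> E f j) (sheets \<Lambda> v) (d v)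
            (\<lambda>q p. if cusp_pair2 \<Lambda> E f j p q then 1 else 0)"
      using False unfolding hat_d2_def Let_def v_def[symmetric] by auto
    ultimately show ?thesis
      using inc(2) unfolding evm_simps
      by (auto elim!: represents_cong simp: madd_def evm_def place_def)
  qed
qed

text \<open>The direct sum of \<open>I + B\<close> on the sheets of the edge with the identity on
  cusping sheets is the same as the identity on all sheets of \<open>f\<close> plus the placed
  \<open>B\<close>. At a swallowtail the extra factor is composed on the right, as in
  \<open>side_factor\<close>.\<close>

lemma represents_hat_f:
  assumes f: "f \<in> cells2 E" and i: "i < nsides E f"
  shows "represents \<Lambda> f (hat_f \<Lambda> E d F f i) (evm x (side_factor \<Lambda> E f i))"
proof -
  define e where "e = side E f i"
  have e: "e \<in> cells1 E"
    using cell_structure(4)[OF f i] by (simp add: e_def)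
  define v where "v = end1 E e 0"
  have v: "v \<in> cells0 E"
    using end1_cell[OF e, of 0] by (simp add: v_def)
  define M where "M = madd (mone (sheets \<Lambda> f)) (place (inc_side \<Lambda> E f i) (sheets \<Lambda> e) (gen_mat \<Lambda> e))"
  define G where "G = dsum \<Lambda> f (inc_side \<Lambda> E f i) (sheets \<Lambda> e) (F e) basis_vec"
  have emb: "embeds \<Lambda> e f (inc_side \<Lambda> E f i)"
    using inc_side_embeds[OF f i] by (simp add: e_def)
  have "represents \<Lambda> f G (\<lambda>p q. if q \<in> inc_side \<Lambda> E f i ` sheets \<Lambda> e
      then place (inc_side \<Lambda> E f i) (sheets \<Lambda> e) (madd (mone (sheets \<Lambda> e)) (evm x (gen_mat \<Lambda> e))) p q else basis_vec q p)"
    unfolding G_def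
    by (rule represents_dsum[OF emb finite_sheets[OF cells_simps(2)[OF e]] F[OF e]]) (auto simp: basis_vec_def)
  then have G: "represents \<Lambda> f G (evm x M)"
    unfolding M_def evm_simps
  proof (rule represents_cong)
    let ?\<iota> = "inc_side \<Lambda> E f i" and ?I = "sheets \<Lambda> e"
    fix p q assume p: "p \<in> sheets \<Lambda> f" and q: "q \<in> sheets \<Lambda> f"
    show "(if q \<in> ?\<iota> ` ?I then place ?\<iota> ?I (madd (mone ?I) (evm x (gen_mat \<Lambda> e))) p q else basis_vec q p)
       = madd (mone (sheets \<Lambda> f)) (place ?\<iota> ?I (evm x (gen_mat \<Lambda> e))) p q"
    proof (cases "p \<in> ?\<iota> ` ?I \<and> q \<in> ?\<iota> ` ?I")
      case True
      then have "inv_into ?I ?\<iota> p = inv_into ?I ?\<iota> q \<longleftrightarrow> p = q"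
        by (metis f_inv_into_f)
      then show ?thesis
        using True p inv_into_into[of p ?\<iota> ?I] by (simp add: place_def madd_def mone_def)
    next
      case False
      then show ?thesis
        using p q by (auto simp: place_def madd_def mone_def basis_vec_def)
    qed
  qed
  have sf: "side_factor \<Lambda> E f i = (if st_vertex \<Lambda> E v \<and> f = fst (cornerS E v) \<and> e = edge_S E v
       then mmul (sheets \<Lambda> f) M (by_number \<Lambda> f (mat_S \<Lambda> E v))
     else if st_vertex \<Lambda> E v \<and> f = fst (cornerT E v) \<and> e = edge_T E v
       then mmul (sheets \<Lambda> f) M (by_number \<Lambda> f (mat_T \<Lambda> E v))
     else M)"
    unfolding side_factor_def Let_def e_def[symmetric] v_def[symmetric] M_def[symmetric] ..
  have hf: "hat_f \<Lambda> E d F f i = (if st_vertex \<Lambda> E v \<and> f = fst (cornerS E v) \<and> e = edge_S E v then G \<circ> H_S \<Lambda> E v (d v)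
     else if st_vertex \<Lambda> E v \<and> f = fst (cornerT E v) \<and> e = edge_T E v then G \<circ> H_T \<Lambda> E v
     else G)"
    unfolding hat_f_def Let_def e_def[symmetric] v_def[symmetric] G_def[symmetric] ..
  show ?thesis
  proof (cases "st_vertex \<Lambda> E v")
    case True
    interpret swallowtail_vertex \<Lambda> E v
      by unfold_locales (rule True)
    have S: "f = fS \<Longrightarrow> represents \<Lambda> f (H_S \<Lambda> E v (d v)) (evm x (by_number \<Lambda> f (mat_S \<Lambda> E v)))"
      and T: "f = fT \<Longrightarrow> represents \<Lambda> f (H_T \<Lambda> E v) (evm x (by_number \<Lambda> f (mat_T \<Lambda> E v)))"
      using represents_H_S[OF d[OF v]] represents_H_T by simp_all
    have SG: "f = fS \<Longrightarrow> represents \<Lambda> f (G \<circ> H_S \<Lambda> E v (d v)) (evm x (mmul (sheets \<Lambda> f) M (by_number \<Lambda> f (mat_S \<Lambda> E v))))"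
      and TG: "f = fT \<Longrightarrow> represents \<Lambda> f (G \<circ> H_T \<Lambda> E v) (evm x (mmul (sheets \<Lambda> f) M (by_number \<Lambda> f (mat_T \<Lambda> E v))))"
      unfolding evm_simps using represents_comp[OF G S] represents_comp[OF G T] by blast+
    show ?thesis
    proof (cases "f = fS \<and> e = edge_S E v")
      case S: True
      then have c: "(st_vertex \<Lambda> E v \<and> f = fS \<and> e = edge_S E v) = True"
        using True by blast
      show ?thesis
        unfolding sf hf c if_True using S by (intro SG) blast
    next
      case S: False
      then have c: "(st_vertex \<Lambda> E v \<and> f = fS \<and> e = edge_S E v) = False"
        by blast
      show ?thesis
      proof (cases "f = fT \<and> e = edge_T E v")
        case T: True
        then have c': "(st_vertex \<Lambda> E v \<and> f = fT \<and> e = edge_T E v) = True"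
          using True by blast
        show ?thesis
          unfolding sf hf c c' if_True if_False using T by (intro TG) blast
      next
        case False
        then have c': "(st_vertex \<Lambda> E v \<and> f = fT \<and> e = edge_T E v) = False"
          by blast
        show ?thesis
          unfolding sf hf c c' if_False by (rule G)
      qed
    qed
  next
    case False
    then show ?thesis
      using G unfolding sf hf by simp
  qed
qed

text \<open>For a side traversed backwards, the inverse is formed over the free algebra in the DGA
  and over \<open>bit\<close> in the diagram. Evaluation is a ring homomorphism, so it takes a
  two-sided inverse to a two-sided inverse.\<close>

lemma represents_path:
  assumes f: "f \<in> cells2 E" and \<pi>: "\<forall>(i,b)\<in>set \<pi>. i < nsides E f"
  shows "represents \<Lambda> f (path_map \<Lambda> E d F f \<pi>) (evm x (path_product \<Lambda> E f \<pi>))"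
  using \<pi>
proof (induction \<pi> rule: rev_induct)
  case Nil
  then show ?case
    unfolding path_map_def path_product_def foldl.simps evm_simps
    by (intro represents_id finite_sheets cells_simps(3) f)
next
  interpret finite_strict_order "sheets \<Lambda> f" "higher \<Lambda>"
    by (rule order_sheets[OF cells_simps(3)[OF f]])
  case (snoc y \<pi>)
  obtain i b where y: "y = (i,b)" by (cases y)
  have i: "i < nsides E f"
    using snoc.prems by (simp add: y)
  have inv: "mmul (sheets \<Lambda> f) (side_factor \<Lambda> E f i) (minverse (sheets \<Lambda> f) (side_factor \<Lambda> E f i)) = mone (sheets \<Lambda> f)"
    "mmul (sheets \<Lambda> f) (minverse (sheets \<Lambda> f) (side_factor \<Lambda> E f i)) (side_factor \<Lambda> E f i) = mone (sheets \<Lambda> f)"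
    by (rule unipotent_inverse(4,5)[OF side_factor_unipotent[OF f i] side_factor_dga[OF f i] subring_dga]; assumption)+
  note H = represents_hat_f[OF f i]
  have "mmul (sheets \<Lambda> f) (evm x (side_factor \<Lambda> E f i)) (evm x (minverse (sheets \<Lambda> f) (side_factor \<Lambda> E f i)))
      = mone (sheets \<Lambda> f)"
    "mmul (sheets \<Lambda> f) (evm x (minverse (sheets \<Lambda> f) (side_factor \<Lambda> E f i))) (evm x (side_factor \<Lambda> E f i))
      = mone (sheets \<Lambda> f)"
    unfolding evm_simps(1)[symmetric] inv evm_simps(3) by (rule refl)+
  then have "represents \<Lambda> f (inv_into (sheet_space \<Lambda> f) (hat_f \<Lambda> E d F f i))
      (evm x (minverse (sheets \<Lambda> f) (side_factor \<Lambda> E f i)))"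
    by (rule represents_inverse[OF fin H])
  then have "represents \<Lambda> f (if b then hat_f \<Lambda> E d F f i else inv_into (sheet_space \<Lambda> f) (hat_f \<Lambda> E d F f i))
      (evm x (if b then side_factor \<Lambda> E f i else minverse (sheets \<Lambda> f) (side_factor \<Lambda> E f i)))"
    using H by simp
  moreover have "represents \<Lambda> f (path_map \<Lambda> E d F f \<pi>) (evm x (path_product \<Lambda> E f \<pi>))"
    using snoc by simp
  ultimately show ?case
    unfolding y path_product_snoc evm_simps path_map_def foldl_append foldl.simps prod.case
    by (rule represents_comp)
qed

section \<open>The equations of a diagram as vanishing of the evaluated differential\<close>

lemma boundary_zero_iff:
  assumes e: "e \<in> cells E"
    and *: "\<And>p q. p \<in> sheets \<Lambda> e \<Longrightarrow> q \<in> sheets \<Lambda> e \<Longrightarrow> P p q \<longleftrightarrow> ev x (gen_boundary \<Lambda> E (e,p,q)) = 0"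
  shows "(\<forall>p\<in>sheets \<Lambda> e. \<forall>q\<in>sheets \<Lambda> e. P p q) \<longleftrightarrow>
    (\<forall>p\<in>sheets \<Lambda> e. \<forall>q\<in>sheets \<Lambda> e. higher \<Lambda> p q \<longrightarrow> ev x (gen_boundary \<Lambda> E (e,p,q)) = 0)"
proof -
  have "ev x (gen_boundary \<Lambda> E (e,p,q)) = 0" if "p \<in> sheets \<Lambda> e" "q \<in> sheets \<Lambda> e" "\<not> higher \<Lambda> p q" for p q
  proof -
    have "gen_boundary \<Lambda> E (e,p,q) = 0"
      using gen_boundary_upper[OF e] that unfolding strict_upper_def by blast
    then show ?thesis
      by simp
  qed
  then show ?thesis
    using * by blast
qed

lemma bit_eq_iff_add: "(a::bit) = b \<longleftrightarrow> a + b = 0"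
  by (cases "a = 0"; cases "b = 0") simp_all

lemma differential_iff:
  assumes v: "v \<in> cells0 E"
  shows "(\<forall>w\<in>sheet_space \<Lambda> v. d v (d v w) = (\<lambda>p. 0)) \<longleftrightarrow>
    (\<forall>p\<in>sheets \<Lambda> v. \<forall>q\<in>sheets \<Lambda> v. higher \<Lambda> p q \<longrightarrow> ev x (gen_boundary \<Lambda> E (v,p,q)) = 0)"
proof -
  let ?G = "evm x (gen_mat \<Lambda> v)"
  have "(\<forall>w\<in>sheet_space \<Lambda> v. (d v \<circ> d v) w = (\<lambda>p. 0)) \<longleftrightarrow>
      (\<forall>p\<in>sheets \<Lambda> v. \<forall>q\<in>sheets \<Lambda> v. mmul (sheets \<Lambda> v) ?G ?G p q = 0)"
    by (rule represents_eq_iff[OF finite_sheets[OF cells_simps(1)[OF v]] represents_comp[OF d[OF v] d[OF v]] represents_zero])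
  also have "\<dots> \<longleftrightarrow> (\<forall>p\<in>sheets \<Lambda> v. \<forall>q\<in>sheets \<Lambda> v. higher \<Lambda> p q \<longrightarrow> ev x (gen_boundary \<Lambda> E (v,p,q)) = 0)"
    by (rule boundary_zero_iff[OF cells_simps(1)[OF v]])
      (simp add: gen_boundary_def Let_def v ev_mmul evm_def)
  finally show ?thesis
    by simp
qed

lemma chain_map_iff:
  assumes e: "e \<in> cells1 E"
  shows "(\<forall>w\<in>sheet_space \<Lambda> e. hat_d1 \<Lambda> E d e 1 (F e w) = F e (hat_d1 \<Lambda> E d e 0 w)) \<longleftrightarrow>
    (\<forall>p\<in>sheets \<Lambda> e. \<forall>q\<in>sheets \<Lambda> e. higher \<Lambda> p q \<longrightarrow> ev x (gen_boundary \<Lambda> E (e,p,q)) = 0)"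
proof -
  let ?I = "sheets \<Lambda> e"
  let ?M = "madd (mone ?I) (evm x (gen_mat \<Lambda> e))"
  have t: "(1::real) \<in> {0,1}" "(0::real) \<in> {0,1}"
    by auto
  have e0: "e \<notin> cells0 E"
    using e cell_structure(5) by blast
  have "(\<forall>w\<in>sheet_space \<Lambda> e. (hat_d1 \<Lambda> E d e 1 \<circ> F e) w = (F e \<circ> hat_d1 \<Lambda> E d e 0) w) \<longleftrightarrow>
      (\<forall>p\<in>?I. \<forall>q\<in>?I. mmul ?I (evm x (bdry_A1 \<Lambda> E e 1)) ?M p q = mmul ?I ?M (evm x (bdry_A1 \<Lambda> E e 0)) p q)"
    by (rule represents_eq_iff[OF finite_sheets[OF cells_simps(2)[OF e]]
      represents_comp[OF represents_hat_d1[OF e t(1)] F[OF e]]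
      represents_comp[OF F[OF e] represents_hat_d1[OF e t(2)]]])
  also have "\<dots> \<longleftrightarrow> (\<forall>p\<in>?I. \<forall>q\<in>?I. higher \<Lambda> p q \<longrightarrow> ev x (gen_boundary \<Lambda> E (e,p,q)) = 0)"
  proof (rule boundary_zero_iff[OF cells_simps(2)[OF e]])
    fix p q
    have eq: "ev x (gen_boundary \<Lambda> E (e,p,q)) =
        mmul ?I (evm x (bdry_A1 \<Lambda> E e 1)) ?M p q + mmul ?I ?M (evm x (bdry_A1 \<Lambda> E e 0)) p q"
      by (simp only: gen_boundary_def Let_def prod.case e e0 if_True if_False ev_add ev_mmul evm_def
        madd_def[abs_def] ev_mone)
    show "mmul ?I (evm x (bdry_A1 \<Lambda> E e 1)) ?M p q = mmul ?I ?M (evm x (bdry_A1 \<Lambda> E e 0)) p q \<longleftrightarrow>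
        ev x (gen_boundary \<Lambda> E (e,p,q)) = 0"
      unfolding eq by (rule bit_eq_iff_add)
  qed
  finally show ?thesis
    by simp
qed

lemma homotopy_iff:
  assumes f: "f \<in> cells2 E"
  shows "(\<forall>w\<in>sheet_space \<Lambda> f. \<forall>p.
             path_map \<Lambda> E d F f (ccw_path E f) w p - path_map \<Lambda> E d F f (cw_path E f) w p
             = hat_d2 \<Lambda> E d f (v1 E f) (K f w) p + K f (hat_d2 \<Lambda> E d f (v0 E f) w) p) \<longleftrightarrow>
    (\<forall>p\<in>sheets \<Lambda> f. \<forall>q\<in>sheets \<Lambda> f. higher \<Lambda> p q \<longrightarrow> ev x (gen_boundary \<Lambda> E (f,p,q)) = 0)"
proof -
  let ?I = "sheets \<Lambda> f" and ?G = "evm x (gen_mat \<Lambda> f)"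
  let ?P = "evm x (path_product \<Lambda> E f (ccw_path E f))" and ?Q = "evm x (path_product \<Lambda> E f (cw_path E f))"
  let ?A = "\<lambda>j. evm x (bdry_A2 \<Lambda> E f j)"
  have v: "v1 E f < nsides E f" "v0 E f < nsides E f"
    using cell_structure(3)[OF f] by auto
  have f01: "f \<notin> cells0 E" "f \<notin> cells1 E"
    using f cell_structure(6,7) by blast+
  have "(\<forall>w\<in>sheet_space \<Lambda> f.
          (\<lambda>p. path_map \<Lambda> E d F f (ccw_path E f) w p + path_map \<Lambda> E d F f (cw_path E f) w p)
        = (\<lambda>p. (hat_d2 \<Lambda> E d f (v1 E f) \<circ> K f) w p + (K f \<circ> hat_d2 \<Lambda> E d f (v0 E f)) w p)) \<longleftrightarrow>
      (\<forall>p\<in>?I. \<forall>q\<in>?I. madd ?P ?Q p q = madd (mmul ?I (?A (v1 E f)) ?G) (mmul ?I ?G (?A (v0 E f))) p q)"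
    by (rule represents_eq_iff[OF finite_sheets[OF cells_simps(3)[OF f]]
      represents_add[OF represents_path[OF f path_sides(1)[OF f]] represents_path[OF f path_sides(2)[OF f]]]
      represents_add[OF represents_comp[OF represents_hat_d2[OF f v(1)] K[OF f]]
        represents_comp[OF K[OF f] represents_hat_d2[OF f v(2)]]]])
  also have "\<dots> \<longleftrightarrow> (\<forall>p\<in>?I. \<forall>q\<in>?I. higher \<Lambda> p q \<longrightarrow> ev x (gen_boundary \<Lambda> E (f,p,q)) = 0)"
  proof (rule boundary_zero_iff[OF cells_simps(3)[OF f]])
    fix p q
    have eq: "ev x (gen_boundary \<Lambda> E (f,p,q)) =
        (?P p q + ?Q p q) + (mmul ?I (?A (v1 E f)) ?G p q + mmul ?I ?G (?A (v0 E f)) p q)"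
      by (simp only: gen_boundary_def Let_def prod.case f01 if_False ev_add ev_mmul evm_def add_ac)
    show "madd ?P ?Q p q = madd (mmul ?I (?A (v1 E f)) ?G) (mmul ?I ?G (?A (v0 E f))) p q \<longleftrightarrow>
        ev x (gen_boundary \<Lambda> E (f,p,q)) = 0"
      unfolding eq madd_def by (rule bit_eq_iff_add)
  qed
  also have "(\<forall>w\<in>sheet_space \<Lambda> f.
          (\<lambda>p. path_map \<Lambda> E d F f (ccw_path E f) w p + path_map \<Lambda> E d F f (cw_path E f) w p)
        = (\<lambda>p. (hat_d2 \<Lambda> E d f (v1 E f) \<circ> K f) w p + (K f \<circ> hat_d2 \<Lambda> E d f (v0 E f)) w p)) \<longleftrightarrow>
      (\<forall>w\<in>sheet_space \<Lambda> f. \<forall>p.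
             path_map \<Lambda> E d F f (ccw_path E f) w p - path_map \<Lambda> E d F f (cw_path E f) w p
             = hat_d2 \<Lambda> E d f (v1 E f) (K f w) p + K f (hat_d2 \<Lambda> E d f (v0 E f) w) p)"
    by (simp only: fun_eq_iff o_apply minus_bit_def)
  finally show ?thesis .
qed

end

section \<open>Augmentations and chain homotopy diagrams\<close>

text \<open>Restricted to \<open>sheet_space\<close> because \<open>endos\<close> consists of
  extensional functions; equality of maps then becomes equality of the functions themselves.\<close>

definition mat_map ::
    "('m::topological_space, 'l::topological_space) legendrian \<Rightarrow> 'm set \<Rightarrow> ('l set, bit) sqmat \<Rightarrow> 'l vec \<Rightarrow> 'l vec" where
  "mat_map \<Lambda> e M = restrict (mat_op (sheets \<Lambda> e) M) (sheet_space \<Lambda> e)"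

lemma mat_map_represents: "represents \<Lambda> e (mat_map \<Lambda> e M) M"
  by (simp add: represents_def mat_map_def)

lemma mat_map_endos: "mat_map \<Lambda> e M \<in> endos \<Lambda> e"
proof -
  have "mat_op (sheets \<Lambda> e) M (vadd v w) = vadd (mat_op (sheets \<Lambda> e) M v) (mat_op (sheets \<Lambda> e) M w)" for v w
    unfolding mat_op_def vadd_def fun_eq_iff by (simp only: distrib_left sum.distrib) auto
  moreover have "vadd v w \<in> sheet_space \<Lambda> e" if "v \<in> sheet_space \<Lambda> e" "w \<in> sheet_space \<Lambda> e" for v w
    using that by (simp add: sheet_space_def vadd_def)
  ultimately show ?thesis
    unfolding endos_def mat_map_def by (auto simp: mat_op_sheet_space)
qed

text \<open>Over \<open>bit\<close> additivity already implies linearity: a vector is the sum of the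
  basis vectors at which it is nonzero, and induction over this finite set computes
  \<open>T\<close>. The image of the zero vector is zero because it equals its own double.\<close>

lemma endos_eq_mat_map:
  assumes T: "T \<in> endos \<Lambda> e" and fin: "finite (sheets \<Lambda> e)"
  shows "T = mat_map \<Lambda> e (\<lambda>p q. T (basis_vec q) p)"
proof
  let ?M = "\<lambda>p q. T (basis_vec q) p"
  have TE: "T \<in> sheet_space \<Lambda> e \<rightarrow>\<^sub>E sheet_space \<Lambda> e"
    and add: "\<And>v w. v \<in> sheet_space \<Lambda> e \<Longrightarrow> w \<in> sheet_space \<Lambda> e \<Longrightarrow> T (vadd v w) = vadd (T v) (T w)"
    using T by (auto simp: endos_def)
  have zero: "T (\<lambda>p. 0) = (\<lambda>p. 0)"
  proof -
    have "T (vadd (\<lambda>p. 0) (\<lambda>p. 0)) = vadd (T (\<lambda>p. 0)) (T (\<lambda>p. 0))"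
      by (rule add) (simp_all add: sheet_space_def)
    then have eq: "T (\<lambda>p. 0) p = T (\<lambda>p. 0) p + T (\<lambda>p. 0) p" for p
      unfolding vadd_def fun_eq_iff by (simp only: add_0_left)
    show ?thesis
    proof
      fix p
      show "T (\<lambda>p. 0) p = 0"
        using eq[of p] by (cases "T (\<lambda>p. 0) p = 0") simp_all
    qed
  qed
  have *: "T (\<lambda>p. if p \<in> J then v p else 0) p = (\<Sum>q\<in>J. T (basis_vec q) p * v q)"
    if "finite J" "J \<subseteq> sheets \<Lambda> e" for J v p
    using that
  proof (induction J arbitrary: p rule: finite_induct)
    case empty
    then show ?case
      by (simp add: zero)
  next
    case (insert j J)
    let ?w = "\<lambda>p. if p \<in> J then v p else 0"
    have w: "?w \<in> sheet_space \<Lambda> e"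
      using insert.prems by (auto simp: sheet_space_def)
    have IH: "T ?w p = (\<Sum>q\<in>J. T (basis_vec q) p * v q)"
      using insert by blast
    have j: "basis_vec j \<in> sheet_space \<Lambda> e"
      using insert.prems by (intro basis_vec_sheet_space) blast
    show ?case
    proof (cases "v j = 0")
      case True
      then have "(\<lambda>p. if p \<in> insert j J then v p else 0) = ?w"
        by auto
      then show ?thesis
        using True unfolding sum.insert[OF insert.hyps] IH[symmetric] by (simp only: mult_zero_right add_0_left)
    next
      case False
      then have vj: "v j = 1" by simp
      then have eq: "(\<lambda>p. if p \<in> insert j J then v p else 0) = vadd (basis_vec j) ?w"
        using insert.hyps by (auto simp: vadd_def basis_vec_def fun_eq_iff)
      show ?thesis
        unfolding sum.insert[OF insert.hyps] IH[symmetric] vj mult_1_right eq add[OF j w]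
        unfolding vadd_def ..
    qed
  qed
  fix v
  show "T v = mat_map \<Lambda> e ?M v"
  proof (cases "v \<in> sheet_space \<Lambda> e")
    case False
    then have "mat_map \<Lambda> e ?M v = undefined"
      unfolding mat_map_def restrict_def by (rule if_not_P)
    then show ?thesis
      using PiE_arb[OF TE False] by (simp only:)
  next
    case True
    have v: "(\<lambda>p. if p \<in> sheets \<Lambda> e then v p else 0) = v"
      using True by (auto simp: sheet_space_def)
    have Tv: "T v p = (\<Sum>q\<in>sheets \<Lambda> e. T (basis_vec q) p * v q)" for p
      using *[OF fin subset_refl, of v p] unfolding v .
    have "T v p = mat_op (sheets \<Lambda> e) ?M v p" for p
    proof (cases "p \<in> sheets \<Lambda> e")
      case p: True
      show ?thesis
        unfolding mat_op_def if_P[OF p] by (rule Tv)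
    next
      case p: False
      show ?thesis
        unfolding mat_op_def if_not_P[OF p] using PiE_mem[OF TE True] p unfolding sheet_space_def by blast
    qed
    then show ?thesis
      unfolding mat_map_def restrict_apply'[OF True] by (rule ext)
  qed
qed

lemma mat_map_cong:
  assumes "\<And>p q. p \<in> sheets \<Lambda> e \<Longrightarrow> q \<in> sheets \<Lambda> e \<Longrightarrow> M p q = M' p q"
  shows "mat_map \<Lambda> e M = mat_map \<Lambda> e M'"
proof -
  have "mat_op (sheets \<Lambda> e) M v = mat_op (sheets \<Lambda> e) M' v" for v
    by (rule mat_op_cong) (rule assms)
  then have "mat_op (sheets \<Lambda> e) M = mat_op (sheets \<Lambda> e) M'"
    by (rule ext)
  then show ?thesis
    by (simp only: mat_map_def)
qed

lemma mat_map_basis: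
  "finite (sheets \<Lambda> e) \<Longrightarrow> p \<in> sheets \<Lambda> e \<Longrightarrow> q \<in> sheets \<Lambda> e \<Longrightarrow> mat_map \<Lambda> e M (basis_vec q) p = M p q"
  by (simp add: represents_basis[OF _ mat_map_represents])

lemma strictly_upper_mat_map:
  "finite (sheets \<Lambda> e) \<Longrightarrow> strictly_upper \<Lambda> e (mat_map \<Lambda> e M) \<longleftrightarrow> strict_upper (sheets \<Lambda> e) (higher \<Lambda>) M"
proof -
  assume fin: "finite (sheets \<Lambda> e)"
  have "form \<Lambda> e (mat_map \<Lambda> e M (basis_vec q)) (basis_vec p) = M p q"
    if "p \<in> sheets \<Lambda> e" "q \<in> sheets \<Lambda> e" for p q
    unfolding form_basis[OF fin that(1)] mat_map_basis[OF fin that] ..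
  then show ?thesis
    unfolding strictly_upper_def strict_upper_def by (intro ball_cong refl) (simp only:)
qed

lemma strictly_upper_mat_map_diff:
  "finite (sheets \<Lambda> e) \<Longrightarrow> strictly_upper \<Lambda> e (\<lambda>v p. mat_map \<Lambda> e M v p - v p)
     \<longleftrightarrow> unipotent (sheets \<Lambda> e) (higher \<Lambda>) M"
proof -
  assume fin: "finite (sheets \<Lambda> e)"
  have "form \<Lambda> e (\<lambda>p. mat_map \<Lambda> e M (basis_vec q) p - basis_vec q p) (basis_vec p) = M p q - mone (sheets \<Lambda> e) p q"
    if "p \<in> sheets \<Lambda> e" "q \<in> sheets \<Lambda> e" for p q
    unfolding form_basis[OF fin that(1)] mat_map_basis[OF fin that] using that by (simp add: basis_vec_def mone_def)
  then show ?thesis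
    unfolding strictly_upper_def unipotent_def strict_upper_def by (intro ball_cong refl) (simp only:)
qed

text \<open>Basis vectors are homogeneous, which gives one direction. For the other, a nonzero
  coefficient of an image comes from some \<open>q\<close> with both \<open>M p q\<close> and
  \<open>v q\<close> nonzero, and the two congruences add up.\<close>

lemma has_degree_mat_map:
  assumes fin: "finite (sheets \<Lambda> e)"
  shows "has_degree \<Lambda> E \<mu> \<rho> e (mat_map \<Lambda> e M) j \<longleftrightarrow> (\<forall>p\<in>sheets \<Lambda> e. \<forall>q\<in>sheets \<Lambda> e.
     M p q \<noteq> 0 \<longrightarrow> [sheet_degree \<Lambda> E \<mu> e p = sheet_degree \<Lambda> E \<mu> e q + j] (mod int \<rho>))"
    (is "?L \<longleftrightarrow> ?R")
proof
  assume L: ?L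
  show ?R
  proof (intro ballI impI)
    fix p q assume p: "p \<in> sheets \<Lambda> e" and q: "q \<in> sheets \<Lambda> e" and nz: "M p q \<noteq> 0"
    have "basis_vec q \<in> graded_part \<Lambda> E \<mu> \<rho> e (sheet_degree \<Lambda> E \<mu> e q)"
      using basis_vec_sheet_space[OF q] by (auto simp: graded_part_def basis_vec_def)
    then have "mat_map \<Lambda> e M (basis_vec q) \<in> graded_part \<Lambda> E \<mu> \<rho> e (sheet_degree \<Lambda> E \<mu> e q + j)"
      using L unfolding has_degree_def by blast
    then show "[sheet_degree \<Lambda> E \<mu> e p = sheet_degree \<Lambda> E \<mu> e q + j] (mod int \<rho>)"
      using p nz mat_map_basis[OF fin p q, of M] unfolding graded_part_def by simp
  qed
next
  assume R: ?R
  show ?L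
    unfolding has_degree_def
  proof (intro allI image_subsetI)
    fix i v assume v: "v \<in> graded_part \<Lambda> E \<mu> \<rho> e i"
    then have vs: "v \<in> sheet_space \<Lambda> e"
      by (simp add: graded_part_def)
    have op: "mat_map \<Lambda> e M v = mat_op (sheets \<Lambda> e) M v"
      using vs by (simp add: mat_map_def)
    have "[sheet_degree \<Lambda> E \<mu> e p = i + j] (mod int \<rho>)"
      if p: "p \<in> sheets \<Lambda> e" and nz: "mat_op (sheets \<Lambda> e) M v p \<noteq> 0" for p
    proof -
      have "(\<Sum>q\<in>sheets \<Lambda> e. M p q * v q) \<noteq> 0"
        using nz unfolding mat_op_def if_P[OF p] .
      then obtain q where q: "q \<in> sheets \<Lambda> e" "M p q * v q \<noteq> 0"
        by (meson sum.neutral)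
      then have "M p q \<noteq> 0" "v q \<noteq> 0"
        by auto
      then have "[sheet_degree \<Lambda> E \<mu> e p = sheet_degree \<Lambda> E \<mu> e q + j] (mod int \<rho>)"
        "[sheet_degree \<Lambda> E \<mu> e q = i] (mod int \<rho>)"
        using R p q(1) v by (auto simp: graded_part_def)
      then show ?thesis
        by (meson cong_add_rcancel cong_trans)
    qed
    then show "mat_map \<Lambda> e M v \<in> graded_part \<Lambda> E \<mu> \<rho> e (i + j)"
      unfolding op graded_part_def using mat_op_sheet_space by blast
  qed
qed

context legendrian_setting
begin

text \<open>Augmentations and chain homotopy diagrams are both parametrized by these families of values on
  generators.\<close>

definition solutions :: "('l \<Rightarrow> int) \<Rightarrow> nat \<Rightarrow> (('m, 'l) generator \<Rightarrow> bit) set" where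
  "solutions \<mu> \<rho> = {x. (\<forall>g. g \<notin> generators \<Lambda> E \<longrightarrow> x g = 0)
     \<and> (\<forall>g\<in>generators \<Lambda> E. ev x (gen_boundary \<Lambda> E g) = 0)
     \<and> (\<forall>g\<in>generators \<Lambda> E. x g \<noteq> 0 \<longrightarrow> [gen_degree \<Lambda> E \<mu> g = 0] (mod int \<rho>))}"

lemma generator_cases:
  "(\<forall>g\<in>generators \<Lambda> E. Q g) \<longleftrightarrow>
    (\<forall>e\<in>cells0 E. \<forall>p\<in>sheets \<Lambda> e. \<forall>q\<in>sheets \<Lambda> e. higher \<Lambda> p q \<longrightarrow> Q (e,p,q))
  \<and> (\<forall>e\<in>cells1 E. \<forall>p\<in>sheets \<Lambda> e. \<forall>q\<in>sheets \<Lambda> e. higher \<Lambda> p q \<longrightarrow> Q (e,p,q))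
  \<and> (\<forall>e\<in>cells2 E. \<forall>p\<in>sheets \<Lambda> e. \<forall>q\<in>sheets \<Lambda> e. higher \<Lambda> p q \<longrightarrow> Q (e,p,q))"
  unfolding generators_def cells_def by auto

lemma gen_boundary_generator: "g \<in> generators \<Lambda> E \<Longrightarrow> gen_boundary \<Lambda> E g \<in> dga \<Lambda> E"
  using gen_boundary_dga by (auto simp: generators_def)

lemma dga_diff_dga: "a \<in> dga \<Lambda> E \<Longrightarrow> dga_diff \<Lambda> E a \<in> dga \<Lambda> E"
  unfolding dga_diff_def dga_def
  by (rule derivation_in_free_alg_on) (use gen_boundary_generator in \<open>simp_all add: dga_def\<close>)

text \<open>The inverse records the values on generators. Solutions vanish off the generators and
  augmentations are extensional on \<open>dga\<close>, so the two assignments are inverse to each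
  other as functions on whole types.\<close>

lemma augmentations_bij:
  "bij_betw (\<lambda>x. restrict (ev x) (dga \<Lambda> E)) (solutions \<mu> \<rho>) (graded_augmentations \<Lambda> E \<mu> \<rho>)"
proof (rule bij_betwI[where g="\<lambda>\<epsilon> g. if g \<in> generators \<Lambda> E then \<epsilon> (gen g) else 0"])
  interpret subring "dga \<Lambda> E"
    by (rule subring_dga)
  have gen: "gen g \<in> dga \<Lambda> E \<longleftrightarrow> g \<in> generators \<Lambda> E" for g
    by (simp add: dga_def)
  show "(\<lambda>x. restrict (ev x) (dga \<Lambda> E)) \<in> solutions \<mu> \<rho> \<rightarrow> graded_augmentations \<Lambda> E \<mu> \<rho>"
  proof
    fix x assume x: "x \<in> solutions \<mu> \<rho>"
    have "ev x (dga_diff \<Lambda> E a) = 0" if "a \<in> dga \<Lambda> E" for a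
      using that x unfolding dga_diff_def dga_def
      by (intro ev_derivation_eq_0[of a "generators \<Lambda> E"]) (auto simp: solutions_def)
    then have "restrict (ev x) (dga \<Lambda> E) \<in> augmentations \<Lambda> E"
      unfolding augmentations_def mem_Collect_eq
      by (intro conjI ballI) (simp_all only: restrict_extensional restrict_apply' R_1 R_add R_mult ev_1 ev_add ev_mult
        dga_diff_dga)
    moreover have "restrict (ev x) (dga \<Lambda> E) (gen g) = x g" if "g \<in> generators \<Lambda> E" for g
      using that by (simp only: gen restrict_apply' ev_gen)
    ultimately show "restrict (ev x) (dga \<Lambda> E) \<in> graded_augmentations \<Lambda> E \<mu> \<rho>"
      using x unfolding graded_augmentations_def solutions_def by auto
  qed
  show "(\<lambda>\<epsilon> g. if g \<in> generators \<Lambda> E then \<epsilon> (gen g) else 0) \<in> graded_augmentations \<Lambda> E \<mu> \<rho> \<rightarrow> solutions \<mu> \<rho>"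
  proof
    fix \<epsilon> assume \<epsilon>: "\<epsilon> \<in> graded_augmentations \<Lambda> E \<mu> \<rho>"
    let ?x = "\<lambda>g. if g \<in> generators \<Lambda> E then \<epsilon> (gen g) else 0"
    have "\<epsilon> \<in> augmentations \<Lambda> E"
      using \<epsilon> by (simp add: graded_augmentations_def)
    then have eps: "\<epsilon> 1 = 1" "\<And>a b. a \<in> dga \<Lambda> E \<Longrightarrow> b \<in> dga \<Lambda> E \<Longrightarrow> \<epsilon> (a + b) = \<epsilon> a + \<epsilon> b"
      "\<And>a b. a \<in> dga \<Lambda> E \<Longrightarrow> b \<in> dga \<Lambda> E \<Longrightarrow> \<epsilon> (a * b) = \<epsilon> a * \<epsilon> b"
      "\<And>a. a \<in> dga \<Lambda> E \<Longrightarrow> \<epsilon> (dga_diff \<Lambda> E a) = 0"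
      unfolding augmentations_def by blast+
    have ev: "\<epsilon> a = ev ?x a" if "a \<in> dga \<Lambda> E" for a
    proof -
      have "\<epsilon> a = ev (\<lambda>g. \<epsilon> (gen g)) a"
        by (rule algebra_map_eq_ev[where \<epsilon>=\<epsilon> and G="generators \<Lambda> E", folded dga_def, OF eps(1-3) that])
      also have "\<dots> = ev ?x a"
        using that unfolding dga_def by (rule ev_cong) simp
      finally show ?thesis .
    qed
    have "ev ?x (gen_boundary \<Lambda> E g) = 0" if "g \<in> generators \<Lambda> E" for g
      using eps(4)[of "gen g"] ev[OF gen_boundary_generator[OF that]] that
      unfolding dga_diff_def derivation_gen by (simp add: gen)
    then show "?x \<in> solutions \<mu> \<rho>"
      using \<epsilon> unfolding solutions_def graded_augmentations_def by simp
  qed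
  show "(\<lambda>g. if g \<in> generators \<Lambda> E then restrict (ev x) (dga \<Lambda> E) (gen g) else 0) = x"
    if "x \<in> solutions \<mu> \<rho>" for x
    using that by (auto simp: solutions_def gen fun_eq_iff)
  show "restrict (ev (\<lambda>g. if g \<in> generators \<Lambda> E then \<epsilon> (gen g) else 0)) (dga \<Lambda> E) = \<epsilon>"
    if \<epsilon>: "\<epsilon> \<in> graded_augmentations \<Lambda> E \<mu> \<rho>" for \<epsilon>
  proof (rule extensionalityI[of _ "dga \<Lambda> E"])
    have aug: "\<epsilon> \<in> augmentations \<Lambda> E"
      using \<epsilon> by (simp add: graded_augmentations_def)
    then show "\<epsilon> \<in> extensional (dga \<Lambda> E)"
      by (simp add: augmentations_def)
    have eps: "\<epsilon> 1 = 1" "\<And>a b. a \<in> dga \<Lambda> E \<Longrightarrow> b \<in> dga \<Lambda> E \<Longrightarrow> \<epsilon> (a + b) = \<epsilon> a + \<epsilon> b"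
      "\<And>a b. a \<in> dga \<Lambda> E \<Longrightarrow> b \<in> dga \<Lambda> E \<Longrightarrow> \<epsilon> (a * b) = \<epsilon> a * \<epsilon> b"
      using aug unfolding augmentations_def by blast+
    fix a assume a: "a \<in> dga \<Lambda> E"
    have "\<epsilon> a = ev (\<lambda>g. \<epsilon> (gen g)) a"
      by (rule algebra_map_eq_ev[where \<epsilon>=\<epsilon> and G="generators \<Lambda> E", folded dga_def, OF eps a])
    also have "\<dots> = ev (\<lambda>g. if g \<in> generators \<Lambda> E then \<epsilon> (gen g) else 0) a"
      using a unfolding dga_def by (rule ev_cong) simp
    finally show "restrict (ev (\<lambda>g. if g \<in> generators \<Lambda> E then \<epsilon> (gen g) else 0)) (dga \<Lambda> E) a = \<epsilon> a"
      using a by simp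
  qed simp
qed

text \<open>A nonzero entry \<open>(p,q)\<close> of a map of degree \<open>j\<close> forces the
  degrees of \<open>p\<close> and \<open>q\<close> to differ by \<open>j\<close>. For
  \<open>j\<close> equal to 1, 0 and -1 this is the vanishing of the degree of the corresponding
  generator over a vertex, an edge and a face, with its shift by -1, 0 and 1.\<close>

lemma diagrams_iff:
  assumes "evaluation \<Lambda> E x d F K"
    and "d \<in> extensional (cells0 E)" "F \<in> extensional (cells1 E)" "K \<in> extensional (cells2 E)"
    and "\<And>e. e \<in> cells0 E \<Longrightarrow> d e = mat_map \<Lambda> e (evm x (gen_mat \<Lambda> e))"
    and "\<And>e. e \<in> cells1 E \<Longrightarrow> F e = mat_map \<Lambda> e (madd (mone (sheets \<Lambda> e)) (evm x (gen_mat \<Lambda> e)))"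
    and "\<And>e. e \<in> cells2 E \<Longrightarrow> K e = mat_map \<Lambda> e (evm x (gen_mat \<Lambda> e))"
    and supp: "\<And>g. g \<notin> generators \<Lambda> E \<Longrightarrow> x g = 0"
  shows "(d, F, K) \<in> graded_CHDs \<Lambda> E \<mu> \<rho> \<longleftrightarrow> x \<in> solutions \<mu> \<rho>"
proof -
  interpret evaluation \<Lambda> E x d F K
    by fact
  have fin: "finite (sheets \<Lambda> e)" if "e \<in> cells0 E \<or> e \<in> cells1 E \<or> e \<in> cells2 E" for e
    using that finite_sheets by (auto simp: cells_def)
  have G: "strict_upper (sheets \<Lambda> e) (higher \<Lambda>) (evm x (gen_mat \<Lambda> e))" for e
    using gen_mat_upper[of e] by (auto simp: strict_upper_def evm_def gen_mat_def)
  have G1: "unipotent (sheets \<Lambda> e) (higher \<Lambda>) (madd (mone (sheets \<Lambda> e)) (evm x (gen_mat \<Lambda> e)))" for e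
  proof -
    have eq: "madd (mone (sheets \<Lambda> e)) X p q - mone (sheets \<Lambda> e) p q = X p q" for X :: "('l set, bit) sqmat" and p q
      unfolding madd_def by (rule add_diff_cancel_left')
    show ?thesis
      unfolding unipotent_def eq by (rule G)
  qed
  have entry: "evm x (gen_mat \<Lambda> e) p q = (if p \<in> sheets \<Lambda> e \<and> q \<in> sheets \<Lambda> e \<and> higher \<Lambda> p q then x (e,p,q) else 0)"
    for e p q
    by (simp add: evm_def gen_mat_def)
  have d0: "d e \<in> endos \<Lambda> e \<and> strictly_upper \<Lambda> e (d e)" if "e \<in> cells0 E" for e
    using that assms(5)[OF that] mat_map_endos G by (simp add: strictly_upper_mat_map fin)
  have F0: "F e \<in> endos \<Lambda> e \<and> strictly_upper \<Lambda> e (\<lambda>v p. F e v p - v p)" if "e \<in> cells1 E" for e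
    using that unfolding assms(6)[OF that] by (simp only: strictly_upper_mat_map_diff[OF fin] mat_map_endos G1 simp_thms)
  have K0: "K e \<in> endos \<Lambda> e \<and> strictly_upper \<Lambda> e (K e)" if "e \<in> cells2 E" for e
    using that assms(7)[OF that] mat_map_endos G by (simp add: strictly_upper_mat_map fin)
  have eqs: "(d, F, K) \<in> chain_homotopy_diagrams \<Lambda> E \<longleftrightarrow> (\<forall>g\<in>generators \<Lambda> E. ev x (gen_boundary \<Lambda> E g) = 0)"
    unfolding generator_cases chain_homotopy_diagrams_def mem_Collect_eq prod.case
    using assms(2-4) d0 F0 K0 differential_iff chain_map_iff homotopy_iff by auto
  have deg0: "has_degree \<Lambda> E \<mu> \<rho> e (d e) 1 \<longleftrightarrow> (\<forall>p\<in>sheets \<Lambda> e. \<forall>q\<in>sheets \<Lambda> e. higher \<Lambda> p q \<longrightarrow>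
      x (e,p,q) \<noteq> 0 \<longrightarrow> [gen_degree \<Lambda> E \<mu> (e,p,q) = 0] (mod int \<rho>))" if "e \<in> cells0 E" for e
    using that unfolding assms(5)[OF that] has_degree_mat_map[OF fin[OF disjI1[OF that]]]
    by (auto simp: entry gen_degree_def cong_iff_dvd_diff algebra_simps)
  have deg1: "has_degree \<Lambda> E \<mu> \<rho> e (F e) 0 \<longleftrightarrow> (\<forall>p\<in>sheets \<Lambda> e. \<forall>q\<in>sheets \<Lambda> e. higher \<Lambda> p q \<longrightarrow>
      x (e,p,q) \<noteq> 0 \<longrightarrow> [gen_degree \<Lambda> E \<mu> (e,p,q) = 0] (mod int \<rho>))" if e: "e \<in> cells1 E" for e
  proof -
    have e0: "e \<notin> cells0 E"
      using e cell_structure(5) by blast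
    \<comment> \<open>Entries of \<open>F\<close> at ordered pairs involve no identity term, and the
      diagonal entries of the identity satisfy the condition of degree 0 trivially.\<close>
    have "p \<noteq> q" if "p \<in> sheets \<Lambda> e" "higher \<Lambda> p q" for p q
      using that finite_strict_order.irrefl[OF order_sheets[OF cells_simps(2)[OF e]]] by blast
    then show ?thesis
      using e e0 unfolding assms(6)[OF e] has_degree_mat_map[OF fin[OF disjI2[OF disjI1[OF e]]]]
      by (auto simp: entry madd_def mone_def gen_degree_def cong_iff_dvd_diff algebra_simps)
  qed
  have deg2: "has_degree \<Lambda> E \<mu> \<rho> e (K e) (- 1) \<longleftrightarrow> (\<forall>p\<in>sheets \<Lambda> e. \<forall>q\<in>sheets \<Lambda> e. higher \<Lambda> p q \<longrightarrow>
      x (e,p,q) \<noteq> 0 \<longrightarrow> [gen_degree \<Lambda> E \<mu> (e,p,q) = 0] (mod int \<rho>))" if e: "e \<in> cells2 E" for e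
  proof -
    have e01: "e \<notin> cells0 E" "e \<notin> cells1 E"
      using e cell_structure(6,7) by blast+
    then show ?thesis
      using e unfolding assms(7)[OF e] has_degree_mat_map[OF fin[OF disjI2[OF disjI2[OF e]]]]
      by (auto simp: entry gen_degree_def cong_iff_dvd_diff algebra_simps)
  qed
  have "(d, F, K) \<in> graded_CHDs \<Lambda> E \<mu> \<rho> \<longleftrightarrow> (d, F, K) \<in> chain_homotopy_diagrams \<Lambda> E
     \<and> (\<forall>g\<in>generators \<Lambda> E. x g \<noteq> 0 \<longrightarrow> [gen_degree \<Lambda> E \<mu> g = 0] (mod int \<rho>))"
    unfolding graded_CHDs_def mem_Collect_eq prod.case generator_cases using deg0 deg1 deg2 by auto
  then show ?thesis
    unfolding eqs solutions_def using supp by auto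
qed

definition diagram_of ::
    "(('m, 'l) generator \<Rightarrow> bit) \<Rightarrow> ('m set \<Rightarrow> 'l vec \<Rightarrow> 'l vec) \<times> ('m set \<Rightarrow> 'l vec \<Rightarrow> 'l vec) \<times> ('m set \<Rightarrow> 'l vec \<Rightarrow> 'l vec)" where
  "diagram_of x = ((\<lambda>e\<in>cells0 E. mat_map \<Lambda> e (evm x (gen_mat \<Lambda> e))),
     (\<lambda>e\<in>cells1 E. mat_map \<Lambda> e (madd (mone (sheets \<Lambda> e)) (evm x (gen_mat \<Lambda> e)))),
     (\<lambda>e\<in>cells2 E. mat_map \<Lambda> e (evm x (gen_mat \<Lambda> e))))"

lemma diagram_of_iff:
  assumes "\<And>g. g \<notin> generators \<Lambda> E \<Longrightarrow> x g = 0"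
  shows "diagram_of x \<in> graded_CHDs \<Lambda> E \<mu> \<rho> \<longleftrightarrow> x \<in> solutions \<mu> \<rho>"
  unfolding diagram_of_def
  by (rule diagrams_iff[OF _ _ _ _ _ _ _ assms])
    (auto intro!: evaluation.intro evaluation_axioms.intro legendrian_setting_axioms mat_map_represents)

lemma diagram_of_entries:
  assumes "diagram_of x = diagram_of y" and g: "g \<in> generators \<Lambda> E"
  shows "x g = y g"
proof -
  obtain e p q where epq: "g = (e,p,q)" "e \<in> cells E" "p \<in> sheets \<Lambda> e" "q \<in> sheets \<Lambda> e" "higher \<Lambda> p q"
    using g by (auto simp: generators_def)
  have fin: "finite (sheets \<Lambda> e)"
    by (rule finite_sheets[OF epq(2)])
  have entry: "evm z (gen_mat \<Lambda> e) p q = z g" for z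
    using epq by (simp add: evm_def gen_mat_def)
  have eqs: "e \<in> cells0 E \<Longrightarrow> mat_map \<Lambda> e (evm x (gen_mat \<Lambda> e)) = mat_map \<Lambda> e (evm y (gen_mat \<Lambda> e))"
    "e \<in> cells1 E \<Longrightarrow> mat_map \<Lambda> e (madd (mone (sheets \<Lambda> e)) (evm x (gen_mat \<Lambda> e)))
        = mat_map \<Lambda> e (madd (mone (sheets \<Lambda> e)) (evm y (gen_mat \<Lambda> e)))"
    "e \<in> cells2 E \<Longrightarrow> mat_map \<Lambda> e (evm x (gen_mat \<Lambda> e)) = mat_map \<Lambda> e (evm y (gen_mat \<Lambda> e))"
  proof -
    note eq = assms(1)[unfolded diagram_of_def prod.inject]
    show "mat_map \<Lambda> e (evm x (gen_mat \<Lambda> e)) = mat_map \<Lambda> e (evm y (gen_mat \<Lambda> e))" if e: "e \<in> cells0 E"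
      using fun_cong[OF conjunct1[OF eq], of e] unfolding restrict_apply'[OF e] .
    show "mat_map \<Lambda> e (madd (mone (sheets \<Lambda> e)) (evm x (gen_mat \<Lambda> e)))
        = mat_map \<Lambda> e (madd (mone (sheets \<Lambda> e)) (evm y (gen_mat \<Lambda> e)))" if e: "e \<in> cells1 E"
      using fun_cong[OF conjunct1[OF conjunct2[OF eq]], of e] unfolding restrict_apply'[OF e] .
    show "mat_map \<Lambda> e (evm x (gen_mat \<Lambda> e)) = mat_map \<Lambda> e (evm y (gen_mat \<Lambda> e))" if e: "e \<in> cells2 E"
      using fun_cong[OF conjunct2[OF conjunct2[OF eq]], of e] unfolding restrict_apply'[OF e] .
  qed
  consider "mat_map \<Lambda> e (evm x (gen_mat \<Lambda> e)) = mat_map \<Lambda> e (evm y (gen_mat \<Lambda> e))"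
    | "mat_map \<Lambda> e (madd (mone (sheets \<Lambda> e)) (evm x (gen_mat \<Lambda> e)))
        = mat_map \<Lambda> e (madd (mone (sheets \<Lambda> e)) (evm y (gen_mat \<Lambda> e)))"
    using eqs epq(2) unfolding cells_def by blast
  then show ?thesis
  proof cases
    case 1
    then show ?thesis
      using mat_map_basis[OF fin epq(3,4)] entry by metis
  next
    case 2
    then have "madd (mone (sheets \<Lambda> e)) (evm x (gen_mat \<Lambda> e)) p q = madd (mone (sheets \<Lambda> e)) (evm y (gen_mat \<Lambda> e)) p q"
      using mat_map_basis[OF fin epq(3,4)] by metis
    then show ?thesis
      unfolding madd_def entry by (rule add_left_imp_eq)
  qed
qed

text \<open>The values of \<open>x\<close> are read off at pairs \<open>p\<close> above
  \<open>q\<close>. Nothing is lost, because the remaining entries of \<open>d\<close> and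
  \<open>K\<close> are zero and those of \<open>F\<close> agree with the identity.\<close>

lemma diagram_of_surj:
  assumes D: "D \<in> graded_CHDs \<Lambda> E \<mu> \<rho>"
  shows "\<exists>x. (\<forall>g. g \<notin> generators \<Lambda> E \<longrightarrow> x g = 0) \<and> diagram_of x = D"
proof -
  obtain d F K where D_eq: "D = (d, F, K)"
    by (cases D)
  have "(d, F, K) \<in> chain_homotopy_diagrams \<Lambda> E"
    using D unfolding D_eq graded_CHDs_def by simp
  then have ext: "d \<in> extensional (cells0 E)" "F \<in> extensional (cells1 E)" "K \<in> extensional (cells2 E)"
    and d: "\<And>e. e \<in> cells0 E \<Longrightarrow> d e \<in> endos \<Lambda> e \<and> strictly_upper \<Lambda> e (d e)"
    and F: "\<And>e. e \<in> cells1 E \<Longrightarrow> F e \<in> endos \<Lambda> e \<and> strictly_upper \<Lambda> e (\<lambda>v p. F e v p - v p)"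
    and K: "\<And>e. e \<in> cells2 E \<Longrightarrow> K e \<in> endos \<Lambda> e \<and> strictly_upper \<Lambda> e (K e)"
    unfolding chain_homotopy_diagrams_def by blast+
  \<comment> \<open>Cells of different dimensions are distinct, so this merges the three families
    without conflict and allows \<open>x\<close> to be defined by a single formula.\<close>
  define T where "T e = (if e \<in> cells0 E then d e else if e \<in> cells1 E then F e else K e)" for e
  define x where "x = (\<lambda>(e,p,q). if (e,p,q) \<in> generators \<Lambda> E then T e (basis_vec q) p else 0)"
  have entry: "evm x (gen_mat \<Lambda> e) p q = (if higher \<Lambda> p q then T e (basis_vec q) p else 0)"
    if "e \<in> cells E" "p \<in> sheets \<Lambda> e" "q \<in> sheets \<Lambda> e" for e p q
    using that by (simp add: evm_def gen_mat_def x_def generators_def)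
  have upper: "mat_map \<Lambda> e (evm x (gen_mat \<Lambda> e)) = T e"
    if e: "e \<in> cells E" and T: "T e \<in> endos \<Lambda> e" "strictly_upper \<Lambda> e (T e)" for e
  proof -
    note fin = finite_sheets[OF e]
    let ?M = "\<lambda>p q. T e (basis_vec q) p"
    have eq: "T e = mat_map \<Lambda> e ?M"
      by (rule endos_eq_mat_map[OF T(1) fin])
    have "strictly_upper \<Lambda> e (mat_map \<Lambda> e ?M)"
      using T(2) eq by simp
    then have "strict_upper (sheets \<Lambda> e) (higher \<Lambda>) ?M"
      unfolding strictly_upper_mat_map[OF fin] .
    then have "?M p q = 0" if "p \<in> sheets \<Lambda> e" "q \<in> sheets \<Lambda> e" "\<not> higher \<Lambda> p q" for p q
      using that unfolding strict_upper_def by blast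
    then have "mat_map \<Lambda> e (evm x (gen_mat \<Lambda> e)) = mat_map \<Lambda> e ?M"
      by (intro mat_map_cong) (simp add: entry[OF e])
    then show ?thesis
      using eq by simp
  qed
  have unip: "mat_map \<Lambda> e (madd (mone (sheets \<Lambda> e)) (evm x (gen_mat \<Lambda> e))) = T e"
    if e: "e \<in> cells E" and T: "T e \<in> endos \<Lambda> e" "strictly_upper \<Lambda> e (\<lambda>v p. T e v p - v p)" for e
  proof -
    note fin = finite_sheets[OF e]
    let ?M = "\<lambda>p q. T e (basis_vec q) p"
    have eq: "T e = mat_map \<Lambda> e ?M"
      by (rule endos_eq_mat_map[OF T(1) fin])
    have "strictly_upper \<Lambda> e (\<lambda>v p. mat_map \<Lambda> e ?M v p - v p)"
      using T(2) eq by simp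
    then have "unipotent (sheets \<Lambda> e) (higher \<Lambda>) ?M"
      unfolding strictly_upper_mat_map_diff[OF fin] .
    then have M: "higher \<Lambda> p q \<or> ?M p q = mone (sheets \<Lambda> e) p q" if "p \<in> sheets \<Lambda> e" "q \<in> sheets \<Lambda> e" for p q
      using that unfolding unipotent_def strict_upper_def by (metis right_minus_eq)
    have "mat_map \<Lambda> e (madd (mone (sheets \<Lambda> e)) (evm x (gen_mat \<Lambda> e))) = mat_map \<Lambda> e ?M"
    proof (rule mat_map_cong)
      fix p q assume p: "p \<in> sheets \<Lambda> e" and q: "q \<in> sheets \<Lambda> e"
      show "madd (mone (sheets \<Lambda> e)) (evm x (gen_mat \<Lambda> e)) p q = ?M p q"
      proof (cases "higher \<Lambda> p q")
        case True
        then have "p \<noteq> q"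
          using p finite_strict_order.irrefl[OF order_sheets[OF e]] by blast
        then show ?thesis
          using True unfolding madd_def entry[OF e p q] by (simp add: mone_def)
      next
        case False
        then show ?thesis
          using M[OF p q] unfolding madd_def entry[OF e p q] by (simp only: if_False add_0_right simp_thms)
      qed
    qed
    then show ?thesis
      using eq by simp
  qed
  have "(\<lambda>e\<in>cells0 E. mat_map \<Lambda> e (evm x (gen_mat \<Lambda> e))) = d"
  proof (rule extensionalityI[OF restrict_extensional ext(1)])
    fix e assume e: "e \<in> cells0 E"
    then show "(\<lambda>e\<in>cells0 E. mat_map \<Lambda> e (evm x (gen_mat \<Lambda> e))) e = d e"
      using upper[OF cells_simps(1)[OF e]] d[OF e] by (simp add: T_def)
  qed
  moreover have "(\<lambda>e\<in>cells1 E. mat_map \<Lambda> e (madd (mone (sheets \<Lambda> e)) (evm x (gen_mat \<Lambda> e)))) = F"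
  proof (rule extensionalityI[OF restrict_extensional ext(2)])
    fix e assume e: "e \<in> cells1 E"
    then have "T e = F e"
      using cell_structure(5) by (auto simp: T_def)
    then show "(\<lambda>e\<in>cells1 E. mat_map \<Lambda> e (madd (mone (sheets \<Lambda> e)) (evm x (gen_mat \<Lambda> e)))) e = F e"
      unfolding restrict_apply'[OF e] using unip[OF cells_simps(2)[OF e]] F[OF e] by metis
  qed
  moreover have "(\<lambda>e\<in>cells2 E. mat_map \<Lambda> e (evm x (gen_mat \<Lambda> e))) = K"
  proof (rule extensionalityI[OF restrict_extensional ext(3)])
    fix e assume e: "e \<in> cells2 E"
    then have "T e = K e"
      using cell_structure(6,7) by (auto simp: T_def)
    then show "(\<lambda>e\<in>cells2 E. mat_map \<Lambda> e (evm x (gen_mat \<Lambda> e))) e = K e"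
      unfolding restrict_apply'[OF e] using upper[OF cells_simps(3)[OF e]] K[OF e] by metis
  qed
  ultimately have "diagram_of x = D"
    by (simp only: diagram_of_def D_eq)
  moreover have "x g = 0" if "g \<notin> generators \<Lambda> E" for g
    using that by (cases g) (simp add: x_def)
  ultimately show ?thesis
    by blast
qed

lemma diagrams_bij: "bij_betw diagram_of (solutions \<mu> \<rho>) (graded_CHDs \<Lambda> E \<mu> \<rho>)"
  unfolding bij_betw_def
proof
  have supp: "\<And>g. g \<notin> generators \<Lambda> E \<Longrightarrow> x g = 0" if "x \<in> solutions \<mu> \<rho>" for x
    using that unfolding solutions_def by blast
  show "inj_on diagram_of (solutions \<mu> \<rho>)"
  proof (rule inj_onI)
    fix x y assume "x \<in> solutions \<mu> \<rho>" "y \<in> solutions \<mu> \<rho>" "diagram_of x = diagram_of y"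
    then have "x g = y g" for g
      using diagram_of_entries[of x y g] supp[of x g] supp[of y g] by (cases "g \<in> generators \<Lambda> E") simp_all
    then show "x = y"
      by (simp add: fun_eq_iff)
  qed
  show "diagram_of ` solutions \<mu> \<rho> = graded_CHDs \<Lambda> E \<mu> \<rho>"
  proof (intro equalityI subsetI)
    fix D assume "D \<in> diagram_of ` solutions \<mu> \<rho>"
    then show "D \<in> graded_CHDs \<Lambda> E \<mu> \<rho>"
      using diagram_of_iff supp by blast
  next
    fix D assume D: "D \<in> graded_CHDs \<Lambda> E \<mu> \<rho>"
    then obtain x where "\<forall>g. g \<notin> generators \<Lambda> E \<longrightarrow> x g = 0" "diagram_of x = D"
      using diagram_of_surj by blast
    then show "D \<in> diagram_of ` solutions \<mu> \<rho>"
      using diagram_of_iff[of x] D by blast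
  qed
qed

end

theorem proposition3p1:
  fixes \<Lambda> :: "('m::{t2_space,second_countable_topology}, 'l::{t2_space,second_countable_topology}) legendrian"
    and E :: "('m, 'l) decomposition"
    and \<mu> :: "'l \<Rightarrow> int"
    and \<rho> :: nat
  assumes "legendrian_surface \<Lambda>"
    and "generic_projections \<Lambda>"
    and "maslov_potential \<Lambda> \<mu>"
    and "compatible_decomposition \<Lambda> E"
    and "int \<rho> dvd maslov_number \<Lambda>"
  shows "\<exists>\<Phi>. bij_betw \<Phi> (graded_augmentations \<Lambda> E \<mu> \<rho>) (graded_CHDs \<Lambda> E \<mu> \<rho>)"
proof -
  interpret legendrian_setting \<Lambda> E
    by unfold_locales fact+
  show ?thesis
    using bij_betw_trans[OF bij_betw_inv_into[OF augmentations_bij] diagrams_bij] by blast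
qed

end
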